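(* Let $(A, X_1, X_2, X_3)$ be an $\mathbb{H}$-contraction on a complex Hilbert space $\mathcal{H}$ such that $X_3^n\to0$ strongly as $n\to\infty$. Let $G_1, G_2$ be the fundamental operators of $(X_1, X_2, X_3)$. Suppose there exist $A_0, A_1$ in $\mathcal{B}(\mathcal{D}_{X_3})$ such that the following hold: (1) $[G_1, G_2]=0$; (2) $[G_1^*, G_1]=[G_2^*, G_2]$; (3) $[G_2^*, A_0]=0$; (4) $[G_1, A_0]=[A_1, G_2^*]$; (5) $[G_1, A_1]=0$; (6) $[G_1^*, A_0]=0$; (7) $[G_2, A_0]=[A_1, G_1^*]$; (8) $[G_2, A_1]=0$; (9) $A_0^*A_0+A_1^*A_1=I-G_1G_1^*-G_2^*G_2$; (10) $A_0^*A_1+G_1G_2=0$; (11) $A^*D_{X_3}=D_{X_3}A_0+X_3^*D_{X_3}A_1$. Let $(N, N_1, N_2, N_3)=(V^*, V_1^*, V_2^*, V_3^* )$, where $$(V, V_1, V_2, V_3)=\left(I\otimes A_0+T_z\otimes A_1,\ I\otimes G_1^*+T_z\otimes G_2,\ I\otimes G_2^*+T_z\otimes G_1,\ T_z\otimes I\right)$$ on $\mathcal{K}=H^2(\mathbb{D})\otimes\mathcal{D}_{X_3}$, and let $W:\mathcal{H}\to H^2(\mathbb{D})\otimes\mathcal{D}_{X_3}$ be given by $Wh=\sum_{n=0}^\infty z^n\otimes D_{X_3}X_3^nh$. Then $(N, N_1, N_2, N_3)$ is an $\mathbb{H}$-co-isometry with $N_3$ being a pure co-isometry, and $W$ is an isometry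 such that $W(\mathcal{H})$ is a joint invariant subspace for $N,N_1,N_2,N_3$ and, identifying $\mathcal{H}$ with $W(\mathcal{H})$ via $W$, $(A, X_1, X_2, X_3)=(N|_{W(\mathcal{H})}, N_1|_{W(\mathcal{H})}, N_2|_{W(\mathcal{H})}, N_3|_{W(\mathcal{H})})$; that is, $NW=WA$ and $N_jW=WX_j$ for $j=1,2,3$.
   Context: All operators are bounded linear maps on complex Hilbert spaces; $[S,T]=ST-TS$; $\mathbb{D}$ is the open unit disc in $\mathbb{C}$; $T_z$ is multiplication by $z$ on the Hardy space $H^2(\mathbb{D})$. The tetrablock is $\mathbb{E}=\{(x_1,x_2,x_3)\in\mathbb{C}^3 : 1-x_1z_1-x_2z_2+x_3z_1z_2\neq 0 \text{ whenever } |z_1|\le 1, |z_2|\le 1\}$. The hexablock is $\mathbb{H}=\{(a,x_1,x_2,x_3)\in\mathbb{C}\times\mathbb{E} : \sup_{z_1,z_2\in\mathbb{D}}\left|\frac{a\sqrt{(1-|z_1|^2)(1-|z_2|^2)}}{1-x_1z_1-x_2z_2+x_3z_1z_2}\right|<1\}$. Both closures are polynomially convex. For $\Omega\in\{\mathbb{E},\mathbb{H}\}$, a commuting tuple $\underline{T}$ is an $\Omega$-contraction if $\|p(\underline{T})\|\le\sup_{\overline{\Omega}}|p|$ for every polynomial $p$. (If $(A,X_1,X_2,X_3)$ is an $\mathbb{H}$-contraction then $(X_1,X_2,X_3)$ is an $\mathbb{E}$-contraction.) For a contraction $T$, $D_T=(I-T^*T)^{1/2}$ and $\mathcal{D}_T=\overline{\operatorname{Ran}}\,D_T$.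 For an $\mathbb{E}$-contraction $(X_1,X_2,X_3)$, the equations $X_1-X_2^*X_3=D_{X_3}F_1D_{X_3}$ and $X_2-X_1^*X_3=D_{X_3}F_2D_{X_3}$ have unique solutions $F_1,F_2\in\mathcal{B}(\mathcal{D}_{X_3})$ (a known fact), called the fundamental operators of $(X_1,X_2,X_3)$. The distinguished boundary $b\mathbb{H}$ is the smallest closed subset of $\overline{\mathbb{H}}$ on which every function continuous on $\overline{\mathbb{H}}$ and analytic in $\mathbb{H}$ attains its maximum modulus. An $\mathbb{H}$-unitary is a commuting quadruple of normal operators with Taylor joint spectrum contained in $b\mathbb{H}$; an $\mathbb{H}$-isometry is the restriction of an $\mathbb{H}$-unitary to a closed joint invariant subspace; an $\mathbb{H}$-co-isometry is a quadruple whose tuple of adjoints is an $\mathbb{H}$-isometry. A pure isometry is an isometry with no nonzero reducing subspace on which it is unitary; a pure co-isometry is the adjoint of a pure isometry. *)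

theory Defs
  imports "HOL-Analysis.Analysis"
begin

section \<open>Complex Hilbert spaces\<close>

text \<open>The inner product is linear in the first argument.\<close>

class complex_inner = real_inner +
  fixes scaleC :: "complex \<Rightarrow> 'a \<Rightarrow> 'a"  (infixr "*\<^sub>C" 75)
    and cinner :: "'a \<Rightarrow> 'a \<Rightarrow> complex"
  assumes scaleC_add_right: "c *\<^sub>C (x + y) = c *\<^sub>C x + c *\<^sub>C y"
    and scaleC_add_left: "(c + d) *\<^sub>C x = c *\<^sub>C x + d *\<^sub>C x"
    and scaleC_scaleC: "c *\<^sub>C d *\<^sub>C x = (c * d) *\<^sub>C x"
    and scaleR_scaleC: "r *\<^sub>R x = complex_of_real r *\<^sub>C x"
    and cinner_commute: "cinner x y = cnj (cinner y x)"
    and cinner_add_left: "cinner (x + y) z = cinner x z + cinner y z"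
    and cinner_scaleC_left: "cinner (c *\<^sub>C x) y = c * cinner x y"
    and inner_eq_Re_cinner: "inner x y = Re (cinner x y)"

class chilbert_space = complex_inner + complete_space

instance chilbert_space \<subseteq> banach ..

instantiation complex :: chilbert_space
begin
definition scaleC_complex :: "complex \<Rightarrow> complex \<Rightarrow> complex"
  where "scaleC_complex c x = c * x"
definition cinner_complex :: "complex \<Rightarrow> complex \<Rightarrow> complex"
  where "cinner_complex x y = x * cnj y"
instance
  by standard
    (auto simp: scaleC_complex_def cinner_complex_def inner_complex_def algebra_simps
        scaleR_conv_of_real)
end

lemma scaleC_one [simp]: "1 *\<^sub>C x = (x::'a::complex_inner)"
  using scaleR_scaleC[of 1 x] by simp

lemma scaleC_zero_left [simp]: "0 *\<^sub>C x = (0::'a::complex_inner)"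
  using scaleR_scaleC[of 0 x] by simp

lemma scaleC_zero_right [simp]: "c *\<^sub>C 0 = (0::'a::complex_inner)"
  using scaleC_add_right[of c 0 "0::'a"] by simp

lemma cinner_self: "cinner x (x::'a::complex_inner) = complex_of_real ((norm x)\<^sup>2)"
proof -
  have "Im (cinner x x) = 0"
    using cinner_commute[of x x] by (metis cnj.sel(2) equal_neg_zero)
  moreover have "Re (cinner x x) = (norm x)\<^sup>2"
    by (metis inner_eq_Re_cinner norm_eq_sqrt_inner inner_ge_zero real_sqrt_pow2)
  ultimately show ?thesis by (simp add: complex_eq_iff)
qed

lemma norm_scaleC: "norm (c *\<^sub>C x) = cmod c * norm (x::'a::complex_inner)"
proof -
  have "cinner (c *\<^sub>C x) (c *\<^sub>C x) = c * cnj (c * cinner x x)"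
    by (metis cinner_commute cinner_scaleC_left)
  also have "\<dots> = complex_of_real ((cmod c)\<^sup>2) * complex_of_real ((norm x)\<^sup>2)"
    by (simp only: cinner_self complex_norm_square complex_cnj_mult complex_cnj_complex_of_real
        mult.assoc)
  finally have "complex_of_real ((norm (c *\<^sub>C x))\<^sup>2) = complex_of_real ((cmod c * norm x)\<^sup>2)"
    by (simp add: cinner_self power_mult_distrib)
  then have "(norm (c *\<^sub>C x))\<^sup>2 = (cmod c * norm x)\<^sup>2"
    using of_real_eq_iff by blast
  then show ?thesis by (simp add: power2_eq_iff_nonneg)
qed

lemma cinner_zero_left: "cinner 0 (x::'a::complex_inner) = 0"
  using cinner_add_left[of 0 0 x] by simp

lemma scaleC_minus_one: "(-1) *\<^sub>C x = - (x::'a::complex_inner)"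
  using scaleR_scaleC[of "-1" x] by simp

lemma cinner_add_right: "cinner (x::'a::complex_inner) (y + z) = cinner x y + cinner x z"
  by (metis cinner_add_left cinner_commute complex_cnj_add)

lemma cinner_scaleC_right: "cinner (x::'a::complex_inner) (c *\<^sub>C y) = cnj c * cinner x y"
  by (metis cinner_scaleC_left cinner_commute complex_cnj_mult)

lemma norm_cinner_le: "cmod (cinner (x::'a::complex_inner) y) \<le> norm x * norm y"
proof (cases "cinner x y = 0")
  case False
  define u where "u = cnj (cinner x y) / cmod (cinner x y)"
  have u: "cmod u = 1" using False by (simp add: u_def norm_divide)
  have "inner (u *\<^sub>C x) y = Re (u * cinner x y)"
    by (simp add: inner_eq_Re_cinner cinner_scaleC_left)
  also have "u * cinner x y = (cinner x y * cnj (cinner x y)) / cmod (cinner x y)"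
    by (simp add: u_def mult.commute)
  also have "\<dots> = cmod (cinner x y)"
    using False by (simp add: complex_norm_square[symmetric] power2_eq_square)
  finally have "cmod (cinner x y) = inner (u *\<^sub>C x) y" by simp
  also have "\<dots> \<le> norm (u *\<^sub>C x) * norm y" by (rule norm_cauchy_schwarz)
  finally show ?thesis using u by (simp add: norm_scaleC)
qed simp

lemma bounded_linear_scaleC_right: "bounded_linear (\<lambda>x::'a::complex_inner. c *\<^sub>C x)"
proof (rule bounded_linear_intro)
  show "c *\<^sub>C (r *\<^sub>R x) = r *\<^sub>R (c *\<^sub>C x)" for r and x :: 'a
    by (simp add: scaleR_scaleC scaleC_scaleC mult.commute)
  show "norm (c *\<^sub>C x) \<le> norm x * cmod c" for x :: 'a
    by (simp add: norm_scaleC)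
qed (rule scaleC_add_right)

lemma bounded_linear_cinner_left: "bounded_linear (\<lambda>x::'a::complex_inner. cinner x y)"
proof (rule bounded_linear_intro)
  show "cinner (r *\<^sub>R x) y = r *\<^sub>R cinner x y" for r and x :: 'a
    by (simp only: scaleR_scaleC[where 'a='a] cinner_scaleC_left scaleR_conv_of_real)
  show "cmod (cinner x y) \<le> norm x * norm y" for x :: 'a
    by (rule norm_cinner_le)
qed (rule cinner_add_left)


section \<open>The vector-valued Hardy space\<close>

text \<open>An element of \<open>H\<^sup>2(\<D>; E)\<close> is an \<open>E\<close>-valued power series on the unit disc with square summable
  coefficients. As a HOL function it is extended by \<open>0\<close> off the disc.\<close>

definition square_summable :: "(nat \<Rightarrow> 'a::real_normed_vector) \<Rightarrow> bool"
  where "square_summable a \<longleftrightarrow> summable (\<lambda>n. (norm (a n))\<^sup>2)"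

definition disc_series :: "(nat \<Rightarrow> 'a::chilbert_space) \<Rightarrow> complex \<Rightarrow> 'a"
  where "disc_series a z = (if cmod z < 1 then (\<Sum>n. z ^ n *\<^sub>C a n) else 0)"

lemma square_summable_zero [simp]: "square_summable (\<lambda>n. 0)"
  by (simp add: square_summable_def)

lemma square_summable_add:
  assumes "square_summable a" "square_summable b"
  shows "square_summable (\<lambda>n. a n + b n)"
proof -
  have "summable (\<lambda>n. 2 * (norm (a n))\<^sup>2 + 2 * (norm (b n))\<^sup>2)"
    using assms by (auto simp: square_summable_def intro: summable_add summable_mult)
  then show ?thesis unfolding square_summable_def
  proof (rule summable_comparison_test[rotated], intro exI allI impI)
    fix n
    have "(norm (a n + b n))\<^sup>2 \<le> (norm (a n) + norm (b n))\<^sup>2"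
      by (simp add: norm_triangle_ineq power_mono)
    also have "\<dots> \<le> 2 * (norm (a n))\<^sup>2 + 2 * (norm (b n))\<^sup>2"
      using sum_squares_ge_zero[of "norm (a n) - norm (b n)" 0]
      by (simp add: power2_eq_square algebra_simps)
    finally show "norm ((norm (a n + b n))\<^sup>2) \<le> 2 * (norm (a n))\<^sup>2 + 2 * (norm (b n))\<^sup>2"
      by simp
  qed
qed

lemma square_summable_scaleC:
  "square_summable a \<Longrightarrow> square_summable (\<lambda>n. c *\<^sub>C (a n :: 'a::complex_inner))"
  by (auto simp: square_summable_def norm_scaleC power_mult_distrib intro: summable_mult)

lemma square_summable_uminus: "square_summable a \<Longrightarrow> square_summable (\<lambda>n. - a n)"
  by (simp add: square_summable_def)

lemma square_summable_diff:
  "square_summable a \<Longrightarrow> square_summable b \<Longrightarrow> square_summable (\<lambda>n. a n - b n)"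
  using square_summable_add[of a "\<lambda>n. - b n"] square_summable_uminus[of b] by simp

lemma square_summable_cinner:
  assumes "square_summable a" "square_summable b"
  shows "summable (\<lambda>n. cinner (a n) (b n :: 'a::complex_inner))"
proof -
  have "summable (\<lambda>n. (norm (a n))\<^sup>2 + (norm (b n))\<^sup>2)"
    using assms by (auto simp: square_summable_def intro: summable_add)
  then show ?thesis
  proof (rule summable_comparison_test[rotated], intro exI allI impI)
    fix n
    have "cmod (cinner (a n) (b n)) \<le> norm (a n) * norm (b n)" by (rule norm_cinner_le)
    also have "\<dots> \<le> (norm (a n))\<^sup>2 + (norm (b n))\<^sup>2"
    proof -
      have "0 \<le> norm (a n) * norm (b n)" by simp
      moreover have "0 \<le> (norm (a n) - norm (b n))\<^sup>2" by simp
      ultimately show ?thesis unfolding power2_diff by linarith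
    qed
    finally show "norm (cinner (a n) (b n)) \<le> (norm (a n))\<^sup>2 + (norm (b n))\<^sup>2" .
  qed
qed

lemma square_summable_powser:
  fixes a :: "nat \<Rightarrow> 'a::chilbert_space"
  assumes "square_summable a" "cmod z < 1"
  shows "summable (\<lambda>n. z ^ n *\<^sub>C a n)"
proof -
  have "(\<lambda>n. (norm (a n))\<^sup>2) \<longlonglongrightarrow> 0"
    using assms(1) unfolding square_summable_def by (rule summable_LIMSEQ_zero)
  then have "Bseq (\<lambda>n. (norm (a n))\<^sup>2)" by (intro convergent_imp_Bseq convergentI)
  then obtain B where B: "(norm (a n))\<^sup>2 \<le> B" for n
    by (auto simp: Bseq_def)
  have le: "norm (a n) \<le> B + 1" for n
  proof (cases "norm (a n) \<le> 1")
    case True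
    moreover have "B \<ge> 0" using B[of n] zero_le_power2 order_trans by blast
    ultimately show ?thesis by simp
  next
    case False
    then have "norm (a n) \<le> (norm (a n))\<^sup>2" by (simp add: self_le_power)
    then show ?thesis using B[of n] by simp
  qed
  have "summable (\<lambda>n. cmod z ^ n * (B + 1))"
    using assms(2) by (intro summable_mult2 summable_geometric) simp
  then show ?thesis
  proof (rule summable_comparison_test[rotated], intro exI allI impI)
    show "norm (z ^ n *\<^sub>C a n) \<le> cmod z ^ n * (B + 1)" for n
      using le[of n] by (simp add: norm_scaleC norm_power mult_left_mono)
  qed
qed

lemma disc_series_eq_0:
  fixes a :: "nat \<Rightarrow> 'a::chilbert_space"
  assumes a: "square_summable a" and z: "\<And>z. disc_series a z = 0"
  shows "a n = 0"
proof -
  define w where "w = a n"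
  define f where "f = Abs_fps (\<lambda>k. cinner (a k) w)"
  have s: "(\<lambda>k. fps_nth f k * z ^ k) sums 0" if "cmod z < 1" for z
  proof -
    have "(\<lambda>k. z ^ k *\<^sub>C a k) sums 0"
      using z[of z] that square_summable_powser[OF a that] by (simp add: disc_series_def sums_iff)
    then have "(\<lambda>k. cinner (z ^ k *\<^sub>C a k) w) sums cinner 0 w"
      by (rule bounded_linear.sums[OF bounded_linear_cinner_left])
    then show ?thesis
      by (simp add: f_def cinner_scaleC_left mult.commute
          cinner_zero_left)
  qed
  have "conv_radius (fps_nth f) \<ge> norm (1/2::complex)"
    using s[of "1/2"] by (intro conv_radius_geI) (auto simp: sums_iff)
  then have "fps_conv_radius f \<ge> ereal (1/2)"
    by (simp add: fps_conv_radius_def)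
  then have r: "fps_conv_radius f > 0"
    by (rule less_le_trans[rotated]) simp
  have "eventually (\<lambda>z::complex. z \<in> ball 0 1) (nhds 0)"
    by (rule eventually_nhds_in_open) auto
  then have "eventually (\<lambda>z. eval_fps f z = eval_fps 0 z) (nhds 0)"
    by eventually_elim (use s in \<open>auto simp: eval_fps_def sums_iff\<close>)
  then have "f = 0" using r by (intro eval_fps_eqD) auto
  then have "fps_nth f n = 0" by simp
  then show ?thesis by (simp add: f_def w_def cinner_self)
qed

lemma disc_series_add:
  assumes "square_summable a" "square_summable b"
  shows "disc_series a z + disc_series b z = disc_series (\<lambda>n. a n + b n) z"
  using assms by (simp add: disc_series_def scaleC_add_right suminf_add square_summable_powser)

lemma disc_series_scaleC:
  assumes "square_summable a"
  shows "c *\<^sub>C disc_series a z = disc_series (\<lambda>n. c *\<^sub>C a n) z"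
  using bounded_linear.suminf[OF bounded_linear_scaleC_right square_summable_powser, OF assms]
  by (simp add: disc_series_def scaleC_scaleC mult.commute)

lemma disc_series_uminus: "square_summable a \<Longrightarrow> - disc_series a z = disc_series (\<lambda>n. - a n) z"
  using disc_series_scaleC[of a "-1" z] by (simp add: scaleC_minus_one)

lemma disc_series_diff:
  assumes "square_summable a" "square_summable b"
  shows "disc_series a z - disc_series b z = disc_series (\<lambda>n. a n - b n) z"
  using disc_series_add[OF assms(1) square_summable_uminus[OF assms(2)], of z]
    disc_series_uminus[OF assms(2), of z, symmetric] by simp

typedef (overloaded) 'a hardy =
  "{f :: complex \<Rightarrow> 'a::chilbert_space. \<exists>a. square_summable a \<and> f = disc_series a}"
  morphisms hardy_apply Abs_hardy
  by (auto intro: exI[of _ "\<lambda>n. 0"])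

setup_lifting type_definition_hardy

definition taylor_coeff :: "'a::chilbert_space hardy \<Rightarrow> nat \<Rightarrow> 'a"
  where "taylor_coeff f = (THE a. square_summable a \<and> hardy_apply f = disc_series a)"

lemma disc_series_inject:
  assumes "square_summable a" "square_summable b" "disc_series a = disc_series b"
  shows "a = b"
proof
  fix n
  have "disc_series (\<lambda>n. a n - b n) z = 0" for z
    using disc_series_diff[OF assms(1,2), of z] assms(3) by simp
  then have "a n - b n = 0"
    using disc_series_eq_0[OF square_summable_diff[OF assms(1,2)]] by blast
  then show "a n = b n" by simp
qed

lemma taylor_coeff_unique:
  assumes "square_summable a" "hardy_apply f = disc_series a"
  shows "taylor_coeff f = a"
  unfolding taylor_coeff_def using assms by (intro the_equality) (auto intro: disc_series_inject)

lemma taylor_coeff: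
  shows square_summable_taylor_coeff: "square_summable (taylor_coeff f)"
    and hardy_apply_taylor_coeff: "hardy_apply f = disc_series (taylor_coeff f)"
proof -
  obtain a where "square_summable a" "hardy_apply f = disc_series a"
    using hardy_apply[of f] by auto
  then show "square_summable (taylor_coeff f)" "hardy_apply f = disc_series (taylor_coeff f)"
    using taylor_coeff_unique by auto
qed

lemma hardy_eqI: "(\<And>n. taylor_coeff f n = taylor_coeff g n) \<Longrightarrow> f = g"
  by (metis ext hardy_apply_inject hardy_apply_taylor_coeff)

lemma taylor_coeff_Abs_hardy:
  assumes "square_summable a"
  shows "taylor_coeff (Abs_hardy (disc_series a)) = a"
  by (rule taylor_coeff_unique[OF assms], rule Abs_hardy_inverse) (use assms in blast)

instantiation hardy :: (chilbert_space) complex_inner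
begin

lift_definition zero_hardy :: "'a hardy" is "\<lambda>z. 0"
  by (rule exI[of _ "\<lambda>n. 0"]) (auto simp: disc_series_def)

lift_definition plus_hardy :: "'a hardy \<Rightarrow> 'a hardy \<Rightarrow> 'a hardy" is "\<lambda>f g z. f z + g z"
  using square_summable_add disc_series_add by (fast intro: ext)

lift_definition minus_hardy :: "'a hardy \<Rightarrow> 'a hardy \<Rightarrow> 'a hardy" is "\<lambda>f g z. f z - g z"
  using square_summable_diff disc_series_diff by (fast intro: ext)

lift_definition uminus_hardy :: "'a hardy \<Rightarrow> 'a hardy" is "\<lambda>f z. - f z"
  using square_summable_uminus disc_series_uminus by (fast intro: ext)

lift_definition scaleC_hardy :: "complex \<Rightarrow> 'a hardy \<Rightarrow> 'a hardy" is "\<lambda>c f z. c *\<^sub>C f z"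
  using square_summable_scaleC disc_series_scaleC by (fast intro: ext)

definition scaleR_hardy :: "real \<Rightarrow> 'a hardy \<Rightarrow> 'a hardy"
  where "scaleR_hardy r f = complex_of_real r *\<^sub>C f"

definition cinner_hardy :: "'a hardy \<Rightarrow> 'a hardy \<Rightarrow> complex"
  where "cinner_hardy f g = (\<Sum>n. cinner (taylor_coeff f n) (taylor_coeff g n))"

definition inner_hardy :: "'a hardy \<Rightarrow> 'a hardy \<Rightarrow> real"
  where "inner_hardy f g = Re (cinner f g)"

definition norm_hardy :: "'a hardy \<Rightarrow> real"
  where "norm_hardy f = sqrt (inner f f)"

definition sgn_hardy :: "'a hardy \<Rightarrow> 'a hardy"
  where "sgn_hardy f = inverse (norm f) *\<^sub>R f"

definition dist_hardy :: "'a hardy \<Rightarrow> 'a hardy \<Rightarrow> real"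
  where "dist_hardy f g = norm (f - g)"

definition uniformity_hardy :: "('a hardy \<times> 'a hardy) filter"
  where "uniformity_hardy = (INF e\<in>{0 <..}. principal {(x, y). dist x y < e})"

definition open_hardy :: "'a hardy set \<Rightarrow> bool"
  where "open_hardy U \<longleftrightarrow> (\<forall>x\<in>U. eventually (\<lambda>(x', y). x' = x \<longrightarrow> y \<in> U) uniformity)"

lemma taylor_coeff_zero: "taylor_coeff (0 :: 'a hardy) = (\<lambda>n. 0)"
  by (intro taylor_coeff_unique) (auto simp: zero_hardy.rep_eq disc_series_def)

lemma taylor_coeff_add:
  "taylor_coeff (f + g :: 'a hardy) = (\<lambda>n. taylor_coeff f n + taylor_coeff g n)"
  by (intro taylor_coeff_unique ext)
    (simp_all only: plus_hardy.rep_eq hardy_apply_taylor_coeff[of f] hardy_apply_taylor_coeff[of g] disc_series_add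
      square_summable_taylor_coeff square_summable_add)

lemma taylor_coeff_diff:
  "taylor_coeff (f - g :: 'a hardy) = (\<lambda>n. taylor_coeff f n - taylor_coeff g n)"
  by (intro taylor_coeff_unique ext)
    (simp_all only: minus_hardy.rep_eq hardy_apply_taylor_coeff[of f] hardy_apply_taylor_coeff[of g] disc_series_diff
      square_summable_taylor_coeff square_summable_diff)

lemma taylor_coeff_scaleC:
  "taylor_coeff (c *\<^sub>C f :: 'a hardy) = (\<lambda>n. c *\<^sub>C taylor_coeff f n)"
  by (intro taylor_coeff_unique ext)
    (simp_all only: scaleC_hardy.rep_eq hardy_apply_taylor_coeff[of f] disc_series_scaleC
      square_summable_taylor_coeff square_summable_scaleC)

lemma cinner_hardy_sums:
  "(\<lambda>n. cinner (taylor_coeff f n) (taylor_coeff g n)) sums cinner f (g :: 'a hardy)"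
  unfolding cinner_hardy_def
  by (intro summable_sums square_summable_cinner square_summable_taylor_coeff)

lemma inner_hardy_self_sums: "(\<lambda>n. (norm (taylor_coeff f n))\<^sup>2) sums inner f (f :: 'a hardy)"
proof -
  have "(\<lambda>n. Re (cinner (taylor_coeff f n) (taylor_coeff f n))) sums inner f f"
    unfolding inner_hardy_def by (rule sums_Re[OF cinner_hardy_sums])
  then show ?thesis by (simp only: cinner_self Re_complex_of_real)
qed

instance
proof
  fix f g h :: "'a hardy" and c d :: complex and r s :: real
  show "dist f g = norm (f - g)" by (rule dist_hardy_def)
  show "(uniformity :: ('a hardy \<times> 'a hardy) filter) =
      (INF e\<in>{0 <..}. principal {(x, y). dist x y < e})"
    by (rule uniformity_hardy_def)
  show "open U \<longleftrightarrow> (\<forall>x\<in>U. eventually (\<lambda>(x', y). x' = x \<longrightarrow> y \<in> U) uniformity)"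
    for U :: "'a hardy set"
    by (rule open_hardy_def)
  show "sgn f = inverse (norm f) *\<^sub>R f" by (rule sgn_hardy_def)
  show "f + g + h = f + (g + h)" "f + g = g + f" "0 + f = f" "- f + f = 0" "f - g = f + - g"
    by (transfer; simp add: algebra_simps)+
  show 1: "c *\<^sub>C (f + g) = c *\<^sub>C f + c *\<^sub>C g" for c and f g :: "'a hardy"
    by transfer (simp add: scaleC_add_right)
  show 2: "(c + d) *\<^sub>C f = c *\<^sub>C f + d *\<^sub>C f" for c d and f :: "'a hardy"
    by transfer (simp add: scaleC_add_left)
  show 3: "c *\<^sub>C d *\<^sub>C f = (c * d) *\<^sub>C f" for c d and f :: "'a hardy"
    by transfer (simp add: scaleC_scaleC)
  show 4: "r *\<^sub>R f = complex_of_real r *\<^sub>C f" for r and f :: "'a hardy"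
    by (rule scaleR_hardy_def)
  show "r *\<^sub>R (f + g) = r *\<^sub>R f + r *\<^sub>R g" "(r + s) *\<^sub>R f = r *\<^sub>R f + s *\<^sub>R f"
    "r *\<^sub>R s *\<^sub>R f = (r * s) *\<^sub>R f"
    by (simp_all add: 1 2 3 4)
  show "1 *\<^sub>R f = f" unfolding 4 by transfer simp
  show comm: "cinner f g = cnj (cinner g f)" for f g :: "'a hardy"
  proof -
    have "(\<lambda>n. cnj (cinner (taylor_coeff g n) (taylor_coeff f n))) sums cnj (cinner g f)"
      by (intro sums_cnj[THEN iffD2] cinner_hardy_sums)
    then have "(\<lambda>n. cinner (taylor_coeff f n) (taylor_coeff g n)) sums cnj (cinner g f)"
      by (simp only: cinner_commute[symmetric])
    then show ?thesis using cinner_hardy_sums sums_unique2 by blast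
  qed
  show add: "cinner (f + g) h = cinner f h + cinner g h" for f g h :: "'a hardy"
  proof (rule sums_unique2[OF cinner_hardy_sums])
    show "(\<lambda>n. cinner (taylor_coeff (f + g) n) (taylor_coeff h n)) sums (cinner f h + cinner g h)"
      unfolding taylor_coeff_add cinner_add_left by (intro sums_add cinner_hardy_sums)
  qed
  show scale: "cinner (c *\<^sub>C f) g = c * cinner f g" for c and f g :: "'a hardy"
  proof (rule sums_unique2[OF cinner_hardy_sums])
    show "(\<lambda>n. cinner (taylor_coeff (c *\<^sub>C f) n) (taylor_coeff g n)) sums (c * cinner f g)"
      unfolding taylor_coeff_scaleC cinner_scaleC_left by (intro sums_mult cinner_hardy_sums)
  qed
  show "inner f g = Re (cinner f g)" by (rule inner_hardy_def)
  show "inner f g = inner g f" unfolding inner_hardy_def using comm[of f g] by simp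
  show "inner (f + g) h = inner f h + inner g h" by (simp add: inner_hardy_def add)
  show "inner (r *\<^sub>R f) g = r * inner f g" by (simp add: inner_hardy_def scale 4)
  show "0 \<le> inner f f"
    using inner_hardy_self_sums[of f] by (rule sums_le[OF _ sums_zero, rotated]) simp
  show "inner f f = 0 \<longleftrightarrow> f = 0"
  proof
    assume "inner f f = 0"
    then have "(\<Sum>n. (norm (taylor_coeff f n))\<^sup>2) = 0"
      using inner_hardy_self_sums[of f] by (simp add: sums_iff)
    then have "(norm (taylor_coeff f n))\<^sup>2 = 0" for n
      using suminf_eq_zero_iff[of "\<lambda>n. (norm (taylor_coeff f n))\<^sup>2"]
        inner_hardy_self_sums[of f] by (simp add: sums_iff)
    then show "f = 0" by (intro hardy_eqI) (simp add: taylor_coeff_zero)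
  next
    assume "f = 0"
    then show "inner f f = 0"
      using inner_hardy_self_sums[of f] by (simp add: taylor_coeff_zero sums_iff)
  qed
  show "norm f = sqrt (inner f f)" by (rule norm_hardy_def)
qed

end

lemma taylor_coeff_norm_sums:
  "(\<lambda>n. (norm (taylor_coeff f n))\<^sup>2) sums (norm (f :: 'a::chilbert_space hardy))\<^sup>2"
  using inner_hardy_self_sums[of f] by (simp add: power2_norm_eq_inner)

lemma taylor_coeff_norm_sum_le:
  assumes "finite I"
  shows "(\<Sum>n\<in>I. (norm (taylor_coeff f n))\<^sup>2) \<le> (norm (f :: 'a::chilbert_space hardy))\<^sup>2"
proof -
  have "(\<Sum>n\<in>I. (norm (taylor_coeff f n))\<^sup>2) \<le> (\<Sum>n. (norm (taylor_coeff f n))\<^sup>2)"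
    using assms sums_summable[OF taylor_coeff_norm_sums] by (intro sum_le_suminf) auto
  then show ?thesis by (simp only: sums_unique[OF taylor_coeff_norm_sums])
qed

lemma norm_taylor_coeff_le: "norm (taylor_coeff f n) \<le> norm (f :: 'a::chilbert_space hardy)"
proof (rule power2_le_imp_le)
  show "(norm (taylor_coeff f n))\<^sup>2 \<le> (norm f)\<^sup>2"
    using taylor_coeff_norm_sum_le[of "{n}" f] by simp
qed (rule norm_ge_zero)

instance hardy :: (chilbert_space) chilbert_space
proof
  fix X :: "nat \<Rightarrow> 'a hardy"
  assume X: "Cauchy X"
  let ?c = "\<lambda>k. taylor_coeff (X k)"
  have "Cauchy (\<lambda>k. ?c k n)" for n
  proof (rule metric_CauchyI)
    fix e :: real
    assume "e > 0"
    then obtain M where M: "\<And>k m. k \<ge> M \<Longrightarrow> m \<ge> M \<Longrightarrow> dist (X k) (X m) < e"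
      using metric_CauchyD[OF X] by blast
    have "dist (?c k n) (?c m n) < e" if "k \<ge> M" "m \<ge> M" for k m
      using M[OF that] norm_taylor_coeff_le[of "X k - X m" n]
      by (simp add: dist_norm taylor_coeff_diff)
    then show "\<exists>M. \<forall>k\<ge>M. \<forall>m\<ge>M. dist (?c k n) (?c m n) < e" by blast
  qed
  then have "\<exists>l. (\<lambda>k. ?c k n) \<longlonglongrightarrow> l" for n
    using Cauchy_convergent convergent_def by blast
  then obtain a where a: "\<And>n. (\<lambda>k. ?c k n) \<longlonglongrightarrow> a n" by metis
  have tail: "(\<Sum>n<N. (norm (?c k n - a n))\<^sup>2) \<le> e\<^sup>2"
    if e: "e > 0" and M: "\<And>k m. k \<ge> M \<Longrightarrow> m \<ge> M \<Longrightarrow> dist (X k) (X m) < e" and k: "k \<ge> M"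
    for e M k N
  proof (rule tendsto_upperbound)
    show "((\<lambda>m. \<Sum>n<N. (norm (?c k n - ?c m n))\<^sup>2) \<longlongrightarrow> (\<Sum>n<N. (norm (?c k n - a n))\<^sup>2)) sequentially"
      by (intro tendsto_intros a)
    show "eventually (\<lambda>m. (\<Sum>n<N. (norm (?c k n - ?c m n))\<^sup>2) \<le> e\<^sup>2) sequentially"
      using eventually_ge_at_top[of M]
    proof eventually_elim
      case (elim m)
      have "(\<Sum>n<N. (norm (taylor_coeff (X k - X m) n))\<^sup>2) \<le> (norm (X k - X m))\<^sup>2"
        by (rule taylor_coeff_norm_sum_le) simp
      also have "\<dots> \<le> e\<^sup>2"
        using M[OF k elim] by (intro power_mono) (auto simp: dist_norm)
      finally show ?case by (simp add: taylor_coeff_diff)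
    qed
  qed simp
  have bound: "summable (\<lambda>n. (norm (?c k n - a n))\<^sup>2) \<and> (\<Sum>n. (norm (?c k n - a n))\<^sup>2) \<le> e\<^sup>2"
    if e: "e > 0" and M: "\<And>k m. k \<ge> M \<Longrightarrow> m \<ge> M \<Longrightarrow> dist (X k) (X m) < e" and k: "k \<ge> M"
    for e M k
  proof -
    have s: "summable (\<lambda>n. (norm (?c k n - a n))\<^sup>2)"
      using tail[OF e M k] by (intro summableI_nonneg_bounded) auto
    then show ?thesis using tail[OF e M k] by (auto intro: suminf_le_const)
  qed
  have "square_summable a"
  proof -
    obtain M where M: "\<And>k m. k \<ge> M \<Longrightarrow> m \<ge> M \<Longrightarrow> dist (X k) (X m) < 1"
      using metric_CauchyD[OF X, of 1] by auto
    have "square_summable (\<lambda>n. ?c M n - a n)"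
      using bound[of 1 M M] M by (simp add: square_summable_def)
    from square_summable_diff[OF square_summable_taylor_coeff[of "X M"] this] show ?thesis by simp
  qed
  define f where "f = Abs_hardy (disc_series a)"
  have f: "taylor_coeff f = a"
    using taylor_coeff_Abs_hardy[OF \<open>square_summable a\<close>] by (simp add: f_def)
  have "X \<longlonglongrightarrow> f"
  proof (rule metric_LIMSEQ_I)
    fix e :: real
    assume e: "e > 0"
    then have e2: "e / 2 > 0" by simp
    from metric_CauchyD[OF X this]
    obtain M where M: "\<And>k m. k \<ge> M \<Longrightarrow> m \<ge> M \<Longrightarrow> dist (X k) (X m) < e / 2"
      by blast
    have "dist (X k) f < e" if "k \<ge> M" for k
    proof -
      have "(norm (X k - f))\<^sup>2 \<le> (e / 2)\<^sup>2"
        using bound[OF e2 M that] sums_unique[OF taylor_coeff_norm_sums[of "X k - f"]]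
        by (simp only: taylor_coeff_diff f)
      then have "norm (X k - f) \<le> e / 2" by (rule power2_le_imp_le) (use e in simp)
      then show ?thesis using e by (simp add: dist_norm)
    qed
    then show "\<exists>M. \<forall>k\<ge>M. dist (X k) f < e" by blast
  qed
  then show "convergent X" by (rule convergentI)
qed


lemma bounded_linear_scaleC_left: "bounded_linear (\<lambda>c. c *\<^sub>C (x::'a::complex_inner))"
proof (rule bounded_linear_intro)
  show "(r *\<^sub>R c) *\<^sub>C x = r *\<^sub>R (c *\<^sub>C x)" for r c
    by (simp only: scaleR_scaleC[where 'a='a] scaleC_scaleC scaleR_conv_of_real)
  show "norm (c *\<^sub>C x) \<le> norm c * norm x" for c
    by (simp add: norm_scaleC)
qed (rule scaleC_add_left)

text \<open>The monomial \<open>z\<^sup>n\<close>, multiplication by \<open>z\<close> on \<open>H\<^sup>2(\<D>)\<close>, and the elementary tensor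
  \<open>f \<otimes> v\<close>, which is the function \<open>z \<mapsto> f(z)v\<close>.\<close>

lift_definition hardy_monom :: "nat \<Rightarrow> complex hardy"
  is "\<lambda>n z. if cmod z < 1 then z ^ n else 0"
proof (intro exI conjI ext)
  fix n :: nat and z :: complex
  let ?a = "\<lambda>k. if k = n then 1 else 0 :: complex"
  have "(\<lambda>k. if k = n then (norm (?a k))\<^sup>2 else 0) sums (norm (?a n))\<^sup>2" by (rule sums_single)
  then show "square_summable ?a"
    unfolding square_summable_def by (rule sums_summable[THEN summable_cong[THEN iffD1, rotated]]) auto
  have "(\<lambda>k. if k = n then z ^ k else 0) sums z ^ n" by (rule sums_single)
  also have "(\<lambda>k. if k = n then z ^ k else 0) = (\<lambda>k. z ^ k *\<^sub>C ?a k)"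
    by (auto simp: scaleC_complex_def)
  finally show "(if cmod z < 1 then z ^ n else 0) = disc_series ?a z"
    by (simp add: disc_series_def sums_iff)
qed

lift_definition mult_z :: "complex hardy \<Rightarrow> complex hardy" is "\<lambda>f z. z * f z"
proof (elim exE conjE, intro exI conjI ext)
  fix f :: "complex \<Rightarrow> complex" and a z
  assume a: "square_summable a" and f: "f = disc_series a"
  let ?b = "case_nat 0 a"
  show b: "square_summable ?b"
    using a unfolding square_summable_def
    by (subst summable_Suc_iff[symmetric]) simp
  show "z * f z = disc_series ?b z"
  proof (cases "cmod z < 1")
    case True
    have "disc_series ?b z = (\<Sum>n. z ^ Suc n *\<^sub>C a n)"
      using suminf_split_head[OF square_summable_powser[OF b True]] True
      by (simp add: disc_series_def)
    also have "\<dots> = (\<Sum>n. z * (z ^ n *\<^sub>C a n))"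
      by (simp add: scaleC_complex_def mult.assoc)
    also have "\<dots> = z * (\<Sum>n. z ^ n *\<^sub>C a n)"
      by (rule suminf_mult[OF square_summable_powser[OF a True]])
    finally show ?thesis using True by (simp add: f disc_series_def)
  qed (simp add: f disc_series_def)
qed

lift_definition hardy_tensor :: "complex hardy \<Rightarrow> 'a::chilbert_space \<Rightarrow> 'a hardy"
  (infixl "\<otimes>" 70) is "\<lambda>f v z. f z *\<^sub>C v"
proof (elim exE conjE, intro exI conjI ext)
  fix f :: "complex \<Rightarrow> complex" and v :: 'a and a z
  assume a: "square_summable a" and f: "f = disc_series a"
  show "square_summable (\<lambda>n. a n *\<^sub>C v)"
    using a by (auto simp: square_summable_def norm_scaleC power_mult_distrib intro: summable_mult2)
  show "f z *\<^sub>C v = disc_series (\<lambda>n. a n *\<^sub>C v) z"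
  proof (cases "cmod z < 1")
    case True
    show ?thesis
      using bounded_linear.suminf[OF bounded_linear_scaleC_left square_summable_powser[OF a True], of v]
        True by (simp add: f disc_series_def scaleC_scaleC scaleC_complex_def)
  qed (simp add: f disc_series_def)
qed

lemma taylor_coeff_tensor: "taylor_coeff (f \<otimes> v) = (\<lambda>n. taylor_coeff f n *\<^sub>C v)"
proof (rule taylor_coeff_unique)
  show "square_summable (\<lambda>n. taylor_coeff f n *\<^sub>C v)"
    using square_summable_taylor_coeff[of f]
    by (auto simp: square_summable_def norm_scaleC power_mult_distrib intro: summable_mult2)
  show "hardy_apply (f \<otimes> v) = disc_series (\<lambda>n. taylor_coeff f n *\<^sub>C v)"
  proof
    fix z
    show "hardy_apply (f \<otimes> v) z = disc_series (\<lambda>n. taylor_coeff f n *\<^sub>C v) z"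
    proof (cases "cmod z < 1")
      case True
      show ?thesis
        using bounded_linear.suminf[OF bounded_linear_scaleC_left
            square_summable_powser[OF square_summable_taylor_coeff[of f] True], of v] True
        by (simp add: hardy_tensor.rep_eq hardy_apply_taylor_coeff[of f] disc_series_def
            scaleC_scaleC scaleC_complex_def)
    qed (simp add: hardy_tensor.rep_eq hardy_apply_taylor_coeff[of f] disc_series_def)
  qed
qed

text \<open>So \<open>\<otimes>\<close> is a realization of the Hilbert space tensor product:\<close>

lemma cinner_tensor: "cinner (f \<otimes> v) (g \<otimes> w) = cinner f g * cinner v w"
proof (rule sums_unique2[OF cinner_hardy_sums])
  have "(\<lambda>n. cinner (taylor_coeff f n) (taylor_coeff g n) * cinner v w) sums (cinner f g * cinner v w)"
    by (intro sums_mult2 cinner_hardy_sums)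
  then show "(\<lambda>n. cinner (taylor_coeff (f \<otimes> v) n) (taylor_coeff (g \<otimes> w) n)) sums
      (cinner f g * cinner v w)"
    by (simp add: taylor_coeff_tensor cinner_scaleC_left cinner_scaleC_right cinner_complex_def
        mult_ac)
qed


section \<open>Operators on closed subspaces\<close>

text \<open>The Hilbert spaces that occur are closed subspaces \<open>S\<close> of a type of class
  \<^class>\<open>chilbert_space\<close>. An operator on \<open>S\<close> is a function on the type, of which only the
  values on \<open>S\<close> matter.\<close>

definition csubspace :: "'a::complex_inner set \<Rightarrow> bool"
  where "csubspace S \<longleftrightarrow>
    0 \<in> S \<and> (\<forall>x\<in>S. \<forall>y\<in>S. x + y \<in> S) \<and> (\<forall>c. \<forall>x\<in>S. c *\<^sub>C x \<in> S)"

definition closed_csubspace :: "'a::complex_inner set \<Rightarrow> bool"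
  where "closed_csubspace S \<longleftrightarrow> csubspace S \<and> closed S"

definition clinear_on :: "'a::complex_inner set \<Rightarrow> ('a \<Rightarrow> 'b::complex_inner) \<Rightarrow> bool"
  where "clinear_on S T \<longleftrightarrow>
    (\<forall>x\<in>S. \<forall>y\<in>S. T (x + y) = T x + T y) \<and> (\<forall>c. \<forall>x\<in>S. T (c *\<^sub>C x) = c *\<^sub>C T x)"

definition bounded_op :: "'a::complex_inner set \<Rightarrow> ('a \<Rightarrow> 'a) \<Rightarrow> bool"
  where "bounded_op S T \<longleftrightarrow>
    T ` S \<subseteq> S \<and> clinear_on S T \<and> (\<exists>B. \<forall>x\<in>S. norm (T x) \<le> B * norm x)"

definition op_norm :: "'a::complex_inner set \<Rightarrow> ('a \<Rightarrow> 'a) \<Rightarrow> real"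
  where "op_norm S T = (SUP x\<in>{x\<in>S. norm x \<le> 1}. norm (T x))"

definition adj :: "'a::complex_inner set \<Rightarrow> ('a \<Rightarrow> 'a) \<Rightarrow> 'a \<Rightarrow> 'a"
  where "adj S T y =
    (if y \<in> S then THE z. z \<in> S \<and> (\<forall>x\<in>S. cinner (T x) y = cinner x z) else 0)"

definition comm :: "('a \<Rightarrow> 'a) \<Rightarrow> ('a \<Rightarrow> 'a) \<Rightarrow> 'a \<Rightarrow> 'a::complex_inner"
  where "comm S T = (\<lambda>x. S (T x) - T (S x))"

definition commuting :: "'a::complex_inner set \<Rightarrow> ('a \<Rightarrow> 'a) list \<Rightarrow> bool"
  where "commuting S Ts \<longleftrightarrow> (\<forall>T\<in>set Ts. \<forall>U\<in>set Ts. \<forall>x\<in>S. comm T U x = 0)"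

definition normal_op :: "'a::complex_inner set \<Rightarrow> ('a \<Rightarrow> 'a) \<Rightarrow> bool"
  where "normal_op S T \<longleftrightarrow> bounded_op S T \<and> (\<forall>x\<in>S. comm (adj S T) T x = 0)"

definition positive_op :: "'a::complex_inner set \<Rightarrow> ('a \<Rightarrow> 'a) \<Rightarrow> bool"
  where "positive_op S T \<longleftrightarrow> bounded_op S T \<and> (\<forall>x\<in>S. cinner (T x) x \<in> \<real>\<^sub>\<ge>\<^sub>0)"

definition isometric :: "'a::complex_inner set \<Rightarrow> 'b::complex_inner set \<Rightarrow> ('a \<Rightarrow> 'b) \<Rightarrow> bool"
  where "isometric S S' J \<longleftrightarrow>
    J ` S \<subseteq> S' \<and> clinear_on S J \<and> (\<forall>x\<in>S. norm (J x) = norm x)"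

definition joint_invariant :: "'a::complex_inner set \<Rightarrow> 'a set \<Rightarrow> ('a \<Rightarrow> 'a) list \<Rightarrow> bool"
  where "joint_invariant S M Ts \<longleftrightarrow>
    closed_csubspace M \<and> M \<subseteq> S \<and> (\<forall>T\<in>set Ts. T ` M \<subseteq> M)"

definition pure_isometry :: "'a::complex_inner set \<Rightarrow> ('a \<Rightarrow> 'a) \<Rightarrow> bool"
  where "pure_isometry S V \<longleftrightarrow> isometric S S V \<and>
    (\<forall>M. joint_invariant S M [V, adj S V] \<and> V ` M = M \<longrightarrow> M = {0})"

definition pure_coisometry :: "'a::complex_inner set \<Rightarrow> ('a \<Rightarrow> 'a) \<Rightarrow> bool"
  where "pure_coisometry S N \<longleftrightarrow> bounded_op S N \<and> pure_isometry S (adj S N)"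

text \<open>For a contraction \<open>T\<close>: \<open>D\<^sub>T = (I - T\<^sup>*T)\<^sup>1\<^sup>/\<^sup>2\<close> and the closure of its range.\<close>

definition defect_op :: "('a::complex_inner \<Rightarrow> 'a) \<Rightarrow> 'a \<Rightarrow> 'a"
  where "defect_op T =
    (THE D. positive_op UNIV D \<and> (\<forall>x. D (D x) = x - adj UNIV T (T x)))"

definition defect_space :: "('a::complex_inner \<Rightarrow> 'a) \<Rightarrow> 'a set"
  where "defect_space T = closure (range (defect_op T))"

definition fundamental_operators ::
    "('a::complex_inner \<Rightarrow> 'a) \<Rightarrow> ('a \<Rightarrow> 'a) \<Rightarrow> ('a \<Rightarrow> 'a) \<Rightarrow> ('a \<Rightarrow> 'a) \<Rightarrow> ('a \<Rightarrow> 'a) \<Rightarrow> bool"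
  where "fundamental_operators X1 X2 X3 F1 F2 \<longleftrightarrow>
    bounded_op (defect_space X3) F1 \<and> bounded_op (defect_space X3) F2 \<and>
    (\<forall>h. X1 h - adj UNIV X2 (X3 h) = defect_op X3 (F1 (defect_op X3 h))) \<and>
    (\<forall>h. X2 h - adj UNIV X1 (X3 h) = defect_op X3 (F2 (defect_op X3 h)))"

text \<open>\<open>H\<^sup>2(\<D>) \<otimes> E\<close> for a closed subspace \<open>E\<close>, and for operators \<open>T\<close> on \<open>H\<^sup>2(\<D>)\<close> and \<open>A\<close> on \<open>E\<close>
  the bounded operator \<open>T \<otimes> A\<close> on it.\<close>

definition hardy_space :: "'a::chilbert_space set \<Rightarrow> 'a hardy set"
  where "hardy_space E = closure (csubspace hull {f \<otimes> v |f v. v \<in> E})"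

definition tensor_op :: "'a::chilbert_space set \<Rightarrow> (complex hardy \<Rightarrow> complex hardy) \<Rightarrow>
    ('a \<Rightarrow> 'a) \<Rightarrow> 'a hardy \<Rightarrow> 'a hardy"
  where "tensor_op E T A =
    (THE R. bounded_op (hardy_space E) R \<and> (\<forall>f. \<forall>v\<in>E. R (f \<otimes> v) = T f \<otimes> A v) \<and>
      (\<forall>F. F \<notin> hardy_space E \<longrightarrow> R F = 0))"


section \<open>Taylor joint spectrum\<close>

text \<open>An element of \<open>S \<otimes> \<Lambda>(\<complex>\<^sup>n)\<close> is given by its coefficients \<open>f I\<close> at
  \<open>e\<^sub>I = e\<^bsub>i\<^sub>1\<^esub> \<and> \<dots> \<and> e\<^bsub>i\<^sub>p\<^esub>\<close>, \<open>I = {i\<^sub>1 < \<dots> < i\<^sub>p} \<subseteq> {..<n}\<close>, and the Koszul differential is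
  \<open>x \<otimes> e\<^sub>J \<mapsto> \<Sum>i. T\<^sub>i x \<otimes> (e\<^sub>i \<and> e\<^sub>J)\<close>. As it raises the degree by one, the Koszul complex is exact
  in every degree iff the range of the total differential is its kernel.\<close>

definition koszul_chains :: "'a::complex_inner set \<Rightarrow> nat \<Rightarrow> (nat set \<Rightarrow> 'a) set"
  where "koszul_chains S n =
    {f. (\<forall>I. I \<subseteq> {..<n} \<longrightarrow> f I \<in> S) \<and> (\<forall>I. \<not> I \<subseteq> {..<n} \<longrightarrow> f I = 0)}"

definition koszul_diff ::
    "('a::complex_inner \<Rightarrow> 'a) list \<Rightarrow> (nat set \<Rightarrow> 'a) \<Rightarrow> nat set \<Rightarrow> 'a"
  where "koszul_diff Ts f I =
    (if I \<subseteq> {..<length Ts}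
     then \<Sum>i\<in>I. (- 1) ^ card {j\<in>I. j < i} *\<^sub>R (Ts ! i) (f (I - {i})) else 0)"

definition taylor_nonsingular :: "'a::complex_inner set \<Rightarrow> ('a \<Rightarrow> 'a) list \<Rightarrow> bool"
  where "taylor_nonsingular S Ts \<longleftrightarrow>
    koszul_diff Ts ` koszul_chains S (length Ts) =
      {f \<in> koszul_chains S (length Ts). koszul_diff Ts f = (\<lambda>I. 0)}"

definition taylor_spectrum :: "'a::complex_inner set \<Rightarrow> ('a \<Rightarrow> 'a) list \<Rightarrow> complex list set"
  where "taylor_spectrum S Ts =
    {cs. length cs = length Ts \<and>
      \<not> taylor_nonsingular S (map2 (\<lambda>T c x. T x - c *\<^sub>C x) Ts cs)}"


section \<open>The hexablock\<close>

type_synonym 'a quad = "'a \<times> 'a \<times> 'a \<times> 'a"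

fun quad_list :: "'a quad \<Rightarrow> 'a list"
  where "quad_list (a, b, c, d) = [a, b, c, d]"

definition tetrablock :: "(complex \<times> complex \<times> complex) set"
  where "tetrablock = {(x1, x2, x3). \<forall>z1 z2. cmod z1 \<le> 1 \<longrightarrow> cmod z2 \<le> 1 \<longrightarrow>
    1 - x1 * z1 - x2 * z2 + x3 * z1 * z2 \<noteq> 0}"

definition hexablock :: "complex quad set"
  where "hexablock = {(a, x1, x2, x3). (x1, x2, x3) \<in> tetrablock \<and>
    (SUP (z1, z2) \<in> ball 0 1 \<times> ball 0 1.
      cmod (a * of_real (sqrt ((1 - (cmod z1)\<^sup>2) * (1 - (cmod z2)\<^sup>2))) /
        (1 - x1 * z1 - x2 * z2 + x3 * z1 * z2))) < 1}"

text \<open>The Frechet derivative at each point of the open set \<open>U\<close> is complex linear.\<close>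

definition holomorphic_quad :: "complex quad set \<Rightarrow> (complex quad \<Rightarrow> complex) \<Rightarrow> bool"
  where "holomorphic_quad U f \<longleftrightarrow> (\<forall>q\<in>U. \<exists>c0 c1 c2 c3.
    (f has_derivative (\<lambda>(a, x1, x2, x3). c0 * a + c1 * x1 + c2 * x2 + c3 * x3)) (at q))"

definition distinguished_boundary :: "complex quad set"
  where "distinguished_boundary =
    (LEAST K. closed K \<and> K \<subseteq> closure hexablock \<and>
      (\<forall>f. continuous_on (closure hexablock) f \<and> holomorphic_quad hexablock f \<longrightarrow>
        (\<exists>q\<in>K. \<forall>r\<in>closure hexablock. cmod (f r) \<le> cmod (f q))))"

text \<open>The polynomial with coefficients \<open>c\<close> on the finite set \<open>F\<close> of exponents.\<close>

fun poly4 :: "nat quad set \<Rightarrow> (nat quad \<Rightarrow> complex) \<Rightarrow> complex quad \<Rightarrow> complex"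
  where "poly4 F c (a, x1, x2, x3) =
    (\<Sum>(i, j, k, l)\<in>F. c (i, j, k, l) * (a ^ i * x1 ^ j * x2 ^ k * x3 ^ l))"

fun poly4_op :: "nat quad set \<Rightarrow> (nat quad \<Rightarrow> complex) \<Rightarrow> ('a \<Rightarrow> 'a) quad \<Rightarrow> 'a \<Rightarrow> 'a::complex_inner"
  where "poly4_op F c (A, X1, X2, X3) h =
    (\<Sum>(i, j, k, l)\<in>F. c (i, j, k, l) *\<^sub>C (A ^^ i) ((X1 ^^ j) ((X2 ^^ k) ((X3 ^^ l) h))))"

definition hexablock_contraction :: "'a::complex_inner set \<Rightarrow> ('a \<Rightarrow> 'a) quad \<Rightarrow> bool"
  where "hexablock_contraction S T \<longleftrightarrow>
    (\<forall>U\<in>set (quad_list T). bounded_op S U) \<and> commuting S (quad_list T) \<and>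
    (\<forall>F c. finite F \<longrightarrow>
      op_norm S (poly4_op F c T) \<le> (SUP q\<in>closure hexablock. cmod (poly4 F c q)))"

definition hexablock_unitary :: "'a::complex_inner set \<Rightarrow> ('a \<Rightarrow> 'a) quad \<Rightarrow> bool"
  where "hexablock_unitary S N \<longleftrightarrow>
    (\<forall>U\<in>set (quad_list N). normal_op S U) \<and> commuting S (quad_list N) \<and>
    taylor_spectrum S (quad_list N) \<subseteq> quad_list ` distinguished_boundary"

text \<open>HOL cannot quantify over the type of the Hilbert space \<open>L\<close> on which the unitary quadruple acts, so
  \<open>L\<close> ranges over the closed subspaces of \<open>H\<^sup>2(\<D>) \<otimes> 'a\<close>, up to the unitary identification \<open>J\<close> of \<open>S\<close>
  with the invariant subspace. This is no restriction: one may replace \<open>L\<close> by the smallest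
  reducing subspace \<open>L'\<close> containing \<open>J ` S\<close>, the closed span of the \<open>N\<^sup>*\<^sup>\<alpha> (J x)\<close> over the countably
  many multi-indices \<open>\<alpha>\<close>, and \<open>L'\<close> embeds isometrically into \<open>\<ell>\<^sup>2 \<otimes> S\<close>. (The Taylor spectrum
  of the restriction of a normal tuple to a reducing subspace does not grow.)\<close>

definition hexablock_isometry :: "'a::chilbert_space set \<Rightarrow> ('a \<Rightarrow> 'a) quad \<Rightarrow> bool"
  where "hexablock_isometry S V \<longleftrightarrow>
    (\<forall>U\<in>set (quad_list V). bounded_op S U) \<and>
    (\<exists>(L :: 'a hardy set) N J. closed_csubspace L \<and> hexablock_unitary L N \<and>
      isometric S L J \<and> joint_invariant L (J ` S) (quad_list N) \<and>
      (\<forall>i<4. \<forall>x\<in>S. (quad_list N ! i) (J x) = J ((quad_list V ! i) x)))"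

fun hexablock_coisometry :: "'a::chilbert_space set \<Rightarrow> ('a \<Rightarrow> 'a) quad \<Rightarrow> bool"
  where "hexablock_coisometry S (N, N1, N2, N3) \<longleftrightarrow>
    (\<forall>U\<in>set [N, N1, N2, N3]. bounded_op S U) \<and>
    hexablock_isometry S (adj S N, adj S N1, adj S N2, adj S N3)"

end

theory Submission
  imports Defs "HOL-Complex_Analysis.Complex_Analysis"
begin

text \<open>Let \<open>E\<close> be the defect space of \<open>X\<^sub>3\<close> and \<open>D\<close> the defect operator. There are two separate matters.

  The intertwining relations. As \<open>\<parallel>D h\<parallel>\<^sup>2 = \<parallel>h\<parallel>\<^sup>2 - \<parallel>X\<^sub>3 h\<parallel>\<^sup>2\<close>, the squares of the coefficients of \<open>W h\<close> telescope,
  and \<open>X\<^sub>3\<^sup>n \<rightarrow> 0\<close> makes \<open>W\<close> an isometry. The adjoints of the model operators act on the sequence of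
  coefficients by \<open>f\<^sub>n \<mapsto> A\<^sub>0\<^sup>* f\<^sub>n + A\<^sub>1\<^sup>* f\<^sub>n\<^sub>+\<^sub>1\<close> and so on, so \<open>N W = W A\<close> says \<open>D A = A\<^sub>0\<^sup>* D + A\<^sub>1\<^sup>* D X\<^sub>3\<close>, which is
  the hypothesis \<open>c11\<close> read for adjoints, and \<open>N\<^sub>1 W = W X\<^sub>1\<close> says \<open>D X\<^sub>1 = G\<^sub>1 D + G\<^sub>2\<^sup>* D X\<^sub>3\<close>. The latter holds for
  every pair of fundamental operators (\<open>fundamental_intertwining\<close>).

  The quadruple \<open>(V, V\<^sub>1, V\<^sub>2, V\<^sub>3)\<close> is a hexablock isometry. The distinguished boundary is
  \<open>{(a, x\<^sub>1, x\<^sub>2, x\<^sub>3). |x\<^sub>3| = 1, x\<^sub>1 = cnj x\<^sub>2 x\<^sub>3, |a|\<^sup>2 + |x\<^sub>1|\<^sup>2 = 1}\<close> (\<open>distinguished_boundary_eq\<close>): the hexablock is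
  a union of bidiscs, the images of \<open>(s, t)\<close> under the maps \<open>hexa_param \<alpha> \<beta>\<close>, whose tori lie in this
  set, so that functions attain their maximum modulus there; and every point of the set is a
  peak point of a polynomial of degree one. The hypotheses \<open>c1\<close> to \<open>c10\<close> say precisely that the operators of
  multiplication by \<open>A\<^sub>0 + z A\<^sub>1\<close>, \<open>G\<^sub>1\<^sup>* + z G\<^sub>2\<close>, \<open>G\<^sub>2\<^sup>* + z G\<^sub>1\<close>, \<open>z\<close> on the circle commute and satisfy the
  equations of this set (\<open>laurent_boundary_relations\<close>). These Laurent operators extend
  \<open>(V, V\<^sub>1, V\<^sub>2, V\<^sub>3)\<close> from \<open>H\<^sup>2\<close> to \<open>L\<^sup>2\<close>. The last three are normal. The first one, \<open>T\<^sub>0\<close>, satisfies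
  \<open>T\<^sub>0\<^sup>* T\<^sub>0 = 1 - T\<^sub>1\<^sup>* T\<^sub>1\<close> and hence is quasinormal, but it need not be normal: if \<open>G\<^sub>1 = G\<^sub>2 = A\<^sub>1 = 0\<close>, then \<open>A\<^sub>0\<close> may be
  any isometry. Therefore the space is doubled. The matrix with rows \<open>T\<^sub>0, C\<close> and \<open>0, T\<^sub>0\<^sup>*\<close>, where
  \<open>C\<^sup>2 = T\<^sub>0\<^sup>* T\<^sub>0 - T\<^sub>0 T\<^sub>0\<^sup>*\<close>, is a normal extension of \<open>T\<^sub>0\<close> that keeps all relations
  (\<open>boundary_relations.hexablock_isometry\<close>).

  For commuting normal operators obeying these equations, the Taylor spectrum lies in the boundary: at a
  point off it one of the equations bounds \<open>\<Sum>i. \<parallel>(T\<^sub>i - c\<^sub>i) x\<parallel>\<close> from below, so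
  \<open>Q = \<Sum>i. (T\<^sub>i - c\<^sub>i)\<^sup>* (T\<^sub>i - c\<^sub>i)\<close> is invertible, and the operators \<open>(T\<^sub>i - c\<^sub>i)\<^sup>* Q\<^sup>-\<^sup>1\<close> give a null
  homotopy of the Koszul complex (\<open>taylor_nonsingularI\<close>).\<close>

section \<open>Adjoints on closed subspaces\<close>

lemma cinner_minus_left: "cinner (- x) (y::'a::complex_inner) = - cinner x y"
  using cinner_scaleC_left[of "-1" x y] by (simp add: scaleC_minus_one)

lemma cinner_minus_right: "cinner x (- y::'a::complex_inner) = - cinner x y"
  using cinner_scaleC_right[of x "-1" y] by (simp add: scaleC_minus_one)

lemma cinner_diff_left: "cinner (x - y) (z::'a::complex_inner) = cinner x z - cinner y z"
  using cinner_add_left[of x "- y" z] by (simp add: cinner_minus_left)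

lemma cinner_diff_right: "cinner z (x - y::'a::complex_inner) = cinner z x - cinner z y"
  using cinner_add_right[of z x "- y"] by (simp add: cinner_minus_right)

lemma cinner_zero_right [simp]: "cinner (x::'a::complex_inner) 0 = 0"
  using cinner_add_right[of x 0 0] by simp

lemma scaleC_minus_right: "c *\<^sub>C (- x) = - (c *\<^sub>C (x::'a::complex_inner))"
  using scaleC_add_right[of c x "- x"] by (simp add: eq_neg_iff_add_eq_0 add.commute)

lemma scaleC_diff_right: "c *\<^sub>C (x - y) = c *\<^sub>C x - c *\<^sub>C (y::'a::complex_inner)"
  using scaleC_add_right[of c x "- y"] by (simp add: scaleC_minus_right)

lemmas cinner_simps = cinner_add_left cinner_add_right cinner_diff_left cinner_diff_right
  cinner_scaleC_left cinner_scaleC_right cinner_minus_left cinner_minus_right cinner_zero_left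

lemma cinner_eq_zero_commute: "cinner x y = 0 \<longleftrightarrow> cinner y (x::'a::complex_inner) = 0"
  by (metis cinner_commute complex_cnj_zero)

lemma cinner_self_eq_0: "cinner x x = 0 \<longleftrightarrow> x = (0::'a::complex_inner)"
  by (simp add: cinner_self)

lemma norm_eq_of_cinner_eq:
  "cinner x x = cinner y y \<Longrightarrow> norm (x::'a::complex_inner) = norm (y::'b::complex_inner)"
  by (simp add: cinner_self flip: of_real_power)

lemma tendsto_cinner_left:
  "(f \<longlongrightarrow> l) F \<Longrightarrow> ((\<lambda>n. cinner (f n) (y::'a::complex_inner)) \<longlongrightarrow> cinner l y) F"
  by (rule bounded_linear.tendsto[OF bounded_linear_cinner_left])

lemma tendsto_cinner_right:
  assumes "(f \<longlongrightarrow> l) F"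
  shows "((\<lambda>n. cinner (y::'a::complex_inner) (f n)) \<longlongrightarrow> cinner y l) F"
proof -
  have "((\<lambda>n. cnj (cinner (f n) y)) \<longlongrightarrow> cnj (cinner l y)) F"
    by (intro tendsto_cnj tendsto_cinner_left assms)
  then show ?thesis by (simp only: cinner_commute[symmetric])
qed

lemma csubspace_0: "csubspace S \<Longrightarrow> 0 \<in> S"
  and csubspace_add: "csubspace S \<Longrightarrow> x \<in> S \<Longrightarrow> y \<in> S \<Longrightarrow> x + y \<in> S"
  and csubspace_scaleC: "csubspace S \<Longrightarrow> x \<in> S \<Longrightarrow> c *\<^sub>C x \<in> S"
  by (simp_all add: csubspace_def)

lemma csubspace_scaleR: "csubspace S \<Longrightarrow> x \<in> S \<Longrightarrow> r *\<^sub>R x \<in> S"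
  by (simp add: csubspace_scaleC scaleR_scaleC)

lemma csubspace_minus: "csubspace S \<Longrightarrow> x \<in> S \<Longrightarrow> - x \<in> S"
  using csubspace_scaleC[of S x "-1"] by (simp add: scaleC_minus_one)

lemma csubspace_diff: "csubspace S \<Longrightarrow> x \<in> S \<Longrightarrow> y \<in> S \<Longrightarrow> x - y \<in> S"
  using csubspace_add[of S x "- y"] by (simp add: csubspace_minus)

lemma csubspace_sum: "csubspace S \<Longrightarrow> (\<And>i. i \<in> I \<Longrightarrow> f i \<in> S) \<Longrightarrow> sum f I \<in> S"
  by (induction I rule: infinite_finite_induct) (auto simp: csubspace_0 csubspace_add)

lemma closed_csubspaceD: "closed_csubspace S \<Longrightarrow> csubspace S" "closed_csubspace S \<Longrightarrow> closed S"
  by (simp_all add: closed_csubspace_def)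

lemma closed_csubspace_UNIV [simp]: "closed_csubspace UNIV"
  by (simp add: closed_csubspace_def csubspace_def)

lemma clinear_on_0: "clinear_on S T \<Longrightarrow> csubspace S \<Longrightarrow> T 0 = 0"
  unfolding clinear_on_def using csubspace_0 scaleC_zero_left by metis

lemma clinear_on_minus: "clinear_on S T \<Longrightarrow> x \<in> S \<Longrightarrow> T (- x) = - T x"
  unfolding clinear_on_def using scaleC_minus_one by metis

lemma clinear_on_diff: "clinear_on S T \<Longrightarrow> csubspace S \<Longrightarrow> x \<in> S \<Longrightarrow> y \<in> S \<Longrightarrow> T (x - y) = T x - T y"
  using clinear_on_minus[of S T y] csubspace_minus[of S y]
  by (simp only: clinear_on_def diff_conv_add_uminus)

lemma clinear_on_scaleR: "clinear_on S T \<Longrightarrow> x \<in> S \<Longrightarrow> T (r *\<^sub>R x) = r *\<^sub>R T x"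
  by (simp add: clinear_on_def scaleR_scaleC)

lemma clinear_on_sum:
  "clinear_on S T \<Longrightarrow> csubspace S \<Longrightarrow> (\<And>i. i \<in> I \<Longrightarrow> f i \<in> S) \<Longrightarrow> T (sum f I) = (\<Sum>i\<in>I. T (f i))"
proof (induction I rule: infinite_finite_induct)
  case (insert i I)
  have "sum f I \<in> S" "f i \<in> S" using insert by (auto intro: csubspace_sum)
  then show ?case using insert by (simp add: clinear_on_def)
qed (simp_all add: clinear_on_0)

lemma bounded_opD:
  assumes "bounded_op S T"
  shows bounded_op_in: "x \<in> S \<Longrightarrow> T x \<in> S"
    and bounded_op_add: "x \<in> S \<Longrightarrow> y \<in> S \<Longrightarrow> T (x + y) = T x + T y"
    and bounded_op_scaleC: "x \<in> S \<Longrightarrow> T (c *\<^sub>C x) = c *\<^sub>C T x"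
    and bounded_op_clinear: "clinear_on S T"
  using assms by (auto simp: bounded_op_def clinear_on_def)

lemma bounded_op_0: "bounded_op S T \<Longrightarrow> csubspace S \<Longrightarrow> T 0 = 0"
  by (rule clinear_on_0[OF bounded_op_clinear])

lemma bounded_op_diff:
  "bounded_op S T \<Longrightarrow> csubspace S \<Longrightarrow> x \<in> S \<Longrightarrow> y \<in> S \<Longrightarrow> T (x - y) = T x - T y"
  by (rule clinear_on_diff[OF bounded_op_clinear])

lemma bounded_op_bound:
  assumes "bounded_op S T"
  obtains B where "B > 0" "\<And>x. x \<in> S \<Longrightarrow> norm (T x) \<le> B * norm x"
proof -
  obtain B where B: "\<forall>x\<in>S. norm (T x) \<le> B * norm x" using assms by (auto simp: bounded_op_def)
  show thesis
  proof (rule that[of "max B 1"])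
    fix x assume "x \<in> S"
    then have "norm (T x) \<le> B * norm x" using B by simp
    also have "\<dots> \<le> max B 1 * norm x" by (intro mult_right_mono) auto
    finally show "norm (T x) \<le> max B 1 * norm x" .
  qed simp
qed

lemma bounded_opI:
  assumes "\<And>x. x \<in> S \<Longrightarrow> T x \<in> S"
    and "\<And>x y. x \<in> S \<Longrightarrow> y \<in> S \<Longrightarrow> T (x + y) = T x + T y"
    and "\<And>c x. x \<in> S \<Longrightarrow> T (c *\<^sub>C x) = c *\<^sub>C T x"
    and "\<And>x. x \<in> S \<Longrightarrow> norm (T x) \<le> B * norm x"
  shows "bounded_op S T"
  using assms by (auto simp: bounded_op_def clinear_on_def intro: exI[of _ B])

lemma bounded_op_cong:
  assumes "csubspace S" "\<And>x. x \<in> S \<Longrightarrow> T x = U x"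
  shows "bounded_op S T \<longleftrightarrow> bounded_op S U"
proof -
  have "x \<in> S \<Longrightarrow> y \<in> S \<Longrightarrow> T (x + y) = U (x + y)" "x \<in> S \<Longrightarrow> T (c *\<^sub>C x) = U (c *\<^sub>C x)" for x y c
    by (simp_all add: assms csubspace_add csubspace_scaleC)
  moreover have "T ` S = U ` S" using assms(2) by (rule image_cong[OF refl])
  ultimately show ?thesis unfolding bounded_op_def clinear_on_def
    by (simp add: assms(2) cong: ball_cong)
qed

lemma bounded_op_plus:
  assumes "csubspace S" "bounded_op S T" "bounded_op S U"
  shows "bounded_op S (\<lambda>x. T x + U x)"
proof -
  obtain B where B: "\<And>x. x \<in> S \<Longrightarrow> norm (T x) \<le> B * norm x" using bounded_op_bound[OF assms(2)] by blast
  obtain C where C: "\<And>x. x \<in> S \<Longrightarrow> norm (U x) \<le> C * norm x" using bounded_op_bound[OF assms(3)] by blast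
  show ?thesis
  proof (rule bounded_opI[where B = "B + C"])
    show "norm (T x + U x) \<le> (B + C) * norm x" if "x \<in> S" for x
      using norm_triangle_ineq[of "T x" "U x"] B[OF that] C[OF that] by (simp add: algebra_simps)
  qed (use assms in \<open>auto simp: bounded_op_in bounded_op_add bounded_op_scaleC csubspace_add scaleC_add_right\<close>)
qed

lemma bounded_op_scale:
  assumes "csubspace S" "bounded_op S T"
  shows "bounded_op S (\<lambda>x. c *\<^sub>C T x)"
proof -
  obtain B where B: "\<And>x. x \<in> S \<Longrightarrow> norm (T x) \<le> B * norm x" using bounded_op_bound[OF assms(2)] by blast
  show ?thesis
  proof (rule bounded_opI[where B = "cmod c * B"])
    show "norm (c *\<^sub>C T x) \<le> (cmod c * B) * norm x" if "x \<in> S" for x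
      using mult_left_mono[OF B[OF that] norm_ge_zero[of c]] by (simp add: norm_scaleC mult.assoc)
  qed (use assms in \<open>auto simp: bounded_op_in bounded_op_add bounded_op_scaleC csubspace_scaleC
    scaleC_add_right scaleC_scaleC mult.commute\<close>)
qed

lemma bounded_op_comp:
  assumes "bounded_op S T" "bounded_op S U"
  shows "bounded_op S (\<lambda>x. T (U x))"
proof -
  obtain B where B0: "B > 0" and B: "\<And>x. x \<in> S \<Longrightarrow> norm (T x) \<le> B * norm x"
    using bounded_op_bound[OF assms(1)] by blast
  obtain C where C: "\<And>x. x \<in> S \<Longrightarrow> norm (U x) \<le> C * norm x" using bounded_op_bound[OF assms(2)] by blast
  show ?thesis
  proof (rule bounded_opI[where B = "B * C"])
    show "norm (T (U x)) \<le> (B * C) * norm x" if "x \<in> S" for x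
    proof -
      have "norm (T (U x)) \<le> B * norm (U x)" by (rule B[OF bounded_op_in[OF assms(2) that]])
      also have "\<dots> \<le> B * (C * norm x)" using B0 C[OF that] by simp
      finally show ?thesis by (simp add: mult.assoc)
    qed
  qed (use assms in \<open>auto simp: bounded_op_in bounded_op_add bounded_op_scaleC\<close>)
qed

lemma bounded_op_ident: "bounded_op S (\<lambda>x. x)"
  by (rule bounded_opI[where B = 1]) auto

lemma bounded_op_minus:
  assumes "csubspace S" "bounded_op S T" "bounded_op S U"
  shows "bounded_op S (\<lambda>x. T x - U x)"
  using bounded_op_plus[OF assms(1,2) bounded_op_scale[OF assms(1,3), of "-1"]]
  by (simp add: scaleC_minus_one)

lemma bounded_op_tendsto:
  assumes S: "csubspace S" and T: "bounded_op S T" and f: "\<And>n. f n \<in> S" "l \<in> S" and l: "f \<longlonglongrightarrow> l"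
  shows "(\<lambda>n. T (f n)) \<longlonglongrightarrow> T l"
proof -
  obtain B where B: "\<And>x. x \<in> S \<Longrightarrow> norm (T x) \<le> B * norm x" using bounded_op_bound[OF T] by blast
  have "(\<lambda>n. B * norm (f n - l)) \<longlonglongrightarrow> B * 0"
    using l by (intro tendsto_intros) (simp add: LIM_zero_iff tendsto_norm_zero_iff)
  then have "(\<lambda>n. T (f n) - T l) \<longlonglongrightarrow> 0"
    by (intro Lim_null_comparison[OF always_eventually, of "\<lambda>n. T (f n) - T l" "\<lambda>n. B * norm (f n - l)"])
      (use B f S T in \<open>simp_all add: csubspace_diff bounded_op_diff[symmetric]\<close>)
  then show ?thesis by (simp add: LIM_zero_iff)
qed

lemma csubspace_eq_0I: "x \<in> S \<Longrightarrow> (\<And>y. y \<in> S \<Longrightarrow> cinner x y = 0) \<Longrightarrow> x = (0::'a::complex_inner)"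
  using cinner_self_eq_0 by blast

lemma csubspace_eqI:
  assumes "csubspace S" "x \<in> S" "x' \<in> S" "\<And>y. y \<in> S \<Longrightarrow> cinner x y = cinner x' y"
  shows "x = (x'::'a::complex_inner)"
  using csubspace_eq_0I[of "x - x'" S] csubspace_diff[OF assms(1-3)] assms(4)
  by (simp add: cinner_diff_left)

lemma csubspace_image:
  assumes S: "csubspace S" and T: "clinear_on S T"
  shows "csubspace (T ` S)"
  unfolding csubspace_def
proof (intro conjI ballI allI)
  show "0 \<in> T ` S" using clinear_on_0[OF T S] csubspace_0[OF S] by force
  fix u assume "u \<in> T ` S"
  then obtain x where x: "x \<in> S" "u = T x" by blast
  show "c *\<^sub>C u \<in> T ` S" for c
    using x T by (intro image_eqI[of _ _ "c *\<^sub>C x"]) (auto simp: clinear_on_def csubspace_scaleC[OF S])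
  fix v assume "v \<in> T ` S"
  then obtain y where y: "y \<in> S" "v = T y" by blast
  show "u + v \<in> T ` S"
    using x y T by (intro image_eqI[of _ _ "x + y"]) (auto simp: clinear_on_def csubspace_add[OF S])
qed

lemma closed_csubspace_closure:
  assumes A: "csubspace A"
  shows "closed_csubspace (closure A)"
proof -
  have "csubspace (closure A)"
    unfolding csubspace_def
  proof (intro conjI ballI allI)
    show "0 \<in> closure A" by (rule subsetD[OF closure_subset csubspace_0[OF A]])
    fix u assume "u \<in> closure A"
    then obtain f where f: "\<forall>n. f n \<in> A" "f \<longlonglongrightarrow> u" unfolding closure_sequential by blast
    have "(\<lambda>n. c *\<^sub>C f n) \<longlonglongrightarrow> c *\<^sub>C u" for c
      by (rule bounded_linear.tendsto[OF bounded_linear_scaleC_right f(2)])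
    then show "c *\<^sub>C u \<in> closure A" for c
      unfolding closure_sequential using f(1)
      by (intro exI[of _ "\<lambda>n. c *\<^sub>C f n"]) (simp add: csubspace_scaleC[OF A])
    fix v assume "v \<in> closure A"
    then obtain g where g: "\<forall>n. g n \<in> A" "g \<longlonglongrightarrow> v" unfolding closure_sequential by blast
    show "u + v \<in> closure A"
      unfolding closure_sequential using f(1) g(1) tendsto_add[OF f(2) g(2)]
      by (intro exI[of _ "\<lambda>n. f n + g n"]) (simp add: csubspace_add[OF A])
  qed
  then show ?thesis by (simp add: closed_csubspace_def)
qed

text \<open>A minimizing sequence for the distance to a closed subspace is Cauchy by the parallelogram law.\<close>

lemma nearest_point:
  fixes S :: "'a::chilbert_space set"
  assumes "closed_csubspace S"
  obtains p where "p \<in> S" "\<And>y. y \<in> S \<Longrightarrow> norm (x - p) \<le> norm (x - y)"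
proof -
  have S: "csubspace S" "closed S" using assms by (auto dest: closed_csubspaceD)
  define d where "d = (INF y\<in>S. (norm (x - y))\<^sup>2)"
  have bb: "bdd_below ((\<lambda>y. (norm (x - y))\<^sup>2) ` S)" by (rule bdd_belowI2[of _ 0]) simp
  have d: "d \<le> (norm (x - y))\<^sup>2" if "y \<in> S" for y
    unfolding d_def by (rule cINF_lower[OF bb that])
  have "\<exists>y\<in>S. (norm (x - y))\<^sup>2 < d + 1 / real (Suc n)" for n
  proof -
    have "(INF y\<in>S. (norm (x - y))\<^sup>2) < d + 1 / real (Suc n)" by (simp add: d_def)
    then show ?thesis using csubspace_0[OF S(1)] by (subst (asm) cINF_less_iff) (use bb in auto)
  qed
  then obtain y where y: "\<And>n. y n \<in> S" "\<And>n. (norm (x - y n))\<^sup>2 < d + 1 / real (Suc n)" by metis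
  have para: "(norm (u - v))\<^sup>2 \<le> 2 * (norm (x - u))\<^sup>2 + 2 * (norm (x - v))\<^sup>2 - 4 * d" if "u \<in> S" "v \<in> S" for u v
  proof -
    have "d \<le> (norm (x - (1/2) *\<^sub>R (u + v)))\<^sup>2"
      using that S by (intro d csubspace_scaleR csubspace_add)
    moreover have "4 * (norm (x - (1/2) *\<^sub>R (u + v)))\<^sup>2 + (norm (u - v))\<^sup>2 =
        2 * (norm (x - u))\<^sup>2 + 2 * (norm (x - v))\<^sup>2"
      by (simp add: power2_norm_eq_inner inner_simps inner_commute algebra_simps)
    ultimately show ?thesis by linarith
  qed
  have close: "norm (y m - y n) \<le> sqrt (4 / real (Suc N))" if "m \<ge> N" "n \<ge> N" for m n N
  proof -
    have le: "1 / real (Suc k) \<le> 1 / real (Suc N)" if "k \<ge> N" for k using that by (simp add: frac_le)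
    have "(norm (y m - y n))\<^sup>2 \<le> 4 / real (Suc N)"
      using para[OF y(1)[of m] y(1)[of n]] y(2)[of m] y(2)[of n] le[OF that(1)] le[OF that(2)] by linarith
    then show ?thesis by (rule real_le_rsqrt)
  qed
  have "Cauchy y"
  proof (rule metric_CauchyI)
    fix e :: real assume e: "e > 0"
    have "(\<lambda>N. sqrt (4 / real (Suc N))) \<longlonglongrightarrow> sqrt 0"
      by (intro tendsto_intros) real_asymp
    then have "eventually (\<lambda>N. sqrt (4 / real (Suc N)) < e) sequentially"
      using e by (auto intro: order_tendstoD)
    then obtain N where "sqrt (4 / real (Suc N)) < e" by (auto simp: eventually_sequentially)
    then show "\<exists>N. \<forall>m\<ge>N. \<forall>n\<ge>N. dist (y m) (y n) < e"
      using le_less_trans[OF close] unfolding dist_norm by blast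
  qed
  then obtain p where p: "y \<longlonglongrightarrow> p" using Cauchy_convergent convergent_def by blast
  have pS: "p \<in> S" by (rule closed_sequentially[OF S(2) y(1) p])
  have "(\<lambda>n. (norm (x - y n))\<^sup>2) \<longlonglongrightarrow> (norm (x - p))\<^sup>2" by (intro tendsto_intros p)
  moreover have "(\<lambda>n. d + 1 / real (Suc n)) \<longlonglongrightarrow> d" by real_asymp
  ultimately have "(norm (x - p))\<^sup>2 \<le> d"
    using y(2) by (intro LIMSEQ_le) (auto intro: less_imp_le)
  then have "norm (x - p) \<le> norm (x - z)" if "z \<in> S" for z
    using order_trans[OF _ d[OF that]] by (metis power2_le_imp_le norm_ge_zero)
  with pS show thesis by (rule that)
qed

text \<open>At a nearest point the derivative of the distance vanishes in every real direction of \<open>S\<close>; the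
  directions \<open>y\<close> and \<open>\<i> y\<close> give the real and the imaginary part.\<close>

lemma orthogonal_projection:
  fixes S :: "'a::chilbert_space set"
  assumes "closed_csubspace S"
  obtains p where "p \<in> S" "\<And>y. y \<in> S \<Longrightarrow> cinner (x - p) y = 0"
proof -
  have S: "csubspace S" using assms by (rule closed_csubspaceD)
  obtain p where p: "p \<in> S" "\<And>y. y \<in> S \<Longrightarrow> norm (x - p) \<le> norm (x - y)"
    using nearest_point[OF assms] by blast
  have re: "inner (x - p) y = 0" if "y \<in> S" for y
  proof (rule ccontr)
    assume *: "inner (x - p) y \<noteq> 0"
    then have y0: "inner y y > 0" by auto
    define t where "t = inner (x - p) y / inner y y"
    have "norm (x - p) \<le> norm (x - (p + t *\<^sub>R y))"
      using that p S by (intro p(2) csubspace_add csubspace_scaleR)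
    then have "inner (x - p) (x - p) \<le> inner (x - (p + t *\<^sub>R y)) (x - (p + t *\<^sub>R y))"
      by (simp add: norm_eq_sqrt_inner)
    also have "\<dots> = inner (x - p) (x - p) - 2 * t * inner (x - p) y + t * t * inner y y"
      by (simp add: inner_simps inner_commute algebra_simps)
    also have "t * t * inner y y = t * inner (x - p) y" using y0 by (simp add: t_def)
    finally have "t * inner (x - p) y \<le> 0" by simp
    then have "inner (x - p) y * inner (x - p) y \<le> 0" using y0 by (simp add: t_def divide_le_0_iff)
    then show False using * by (simp add: mult_le_0_iff) linarith
  qed
  have "cinner (x - p) y = 0" if "y \<in> S" for y
  proof -
    have "Re (cinner (x - p) y) = 0" using re[OF that] by (simp add: inner_eq_Re_cinner)
    moreover have "Re (cinner (x - p) (\<i> *\<^sub>C y)) = 0"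
      using re[OF csubspace_scaleC[OF S that]] by (simp add: inner_eq_Re_cinner)
    ultimately show ?thesis by (simp add: cinner_scaleC_right complex_eq_iff)
  qed
  with p(1) show thesis by (rule that)
qed

text \<open>The representing vector is a multiple of a vector orthogonal to the kernel.\<close>

lemma riesz_representation:
  fixes S :: "'a::chilbert_space set" and \<phi> :: "'a \<Rightarrow> complex"
  assumes S: "closed_csubspace S"
    and add: "\<And>x y. x \<in> S \<Longrightarrow> y \<in> S \<Longrightarrow> \<phi> (x + y) = \<phi> x + \<phi> y"
    and scale: "\<And>c x. x \<in> S \<Longrightarrow> \<phi> (c *\<^sub>C x) = c * \<phi> x"
    and bound: "\<And>x. x \<in> S \<Longrightarrow> cmod (\<phi> x) \<le> B * norm x"
  obtains z where "z \<in> S" "\<And>x. x \<in> S \<Longrightarrow> \<phi> x = cinner x z"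
proof (cases "\<forall>x\<in>S. \<phi> x = 0")
  case True
  then show thesis using that[of 0] csubspace_0 closed_csubspaceD[OF S] by auto
next
  case False
  then obtain w where w: "w \<in> S" "\<phi> w \<noteq> 0" by blast
  have S': "csubspace S" "closed S" using S by (auto dest: closed_csubspaceD)
  have diff: "\<phi> (x - y) = \<phi> x - \<phi> y" if "x \<in> S" "y \<in> S" for x y
    using add[OF csubspace_diff[OF S'(1) that] that(2)] by simp
  define N where "N = {x\<in>S. \<phi> x = 0}"
  have "closed N"
    unfolding closed_sequential_limits
  proof (intro allI impI, elim conjE)
    fix f l assume f: "\<forall>n. f n \<in> N" and l: "f \<longlonglongrightarrow> l"
    have lS: "l \<in> S" using closed_sequentially[OF S'(2) _ l] f by (simp add: N_def)
    have "(\<lambda>n. B * norm (l - f n)) \<longlonglongrightarrow> B * norm (l - l)" by (intro tendsto_intros l)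
    moreover have "cmod (\<phi> l) \<le> B * norm (l - f n)" for n
      using bound[of "l - f n"] f lS diff[of l "f n"] csubspace_diff[OF S'(1)] by (simp add: N_def)
    ultimately have "cmod (\<phi> l) \<le> 0" by (intro LIMSEQ_le_const) auto
    then show "l \<in> N" using lS by (simp add: N_def)
  qed
  moreover have "csubspace N"
    using S'(1) add scale scale[of 0 0] csubspace_0[OF S'(1)]
    unfolding csubspace_def N_def by auto
  ultimately have N: "closed_csubspace N" by (simp add: closed_csubspace_def)
  obtain p where p: "p \<in> N" "\<And>y. y \<in> N \<Longrightarrow> cinner (w - p) y = 0"
    using orthogonal_projection[OF N] by blast
  define v where "v = w - p"
  have v: "v \<in> S" "\<phi> v = \<phi> w" using p(1) w diff[of w p] csubspace_diff[OF S'(1)] by (auto simp: N_def v_def)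
  have v0: "cinner v v \<noteq> 0" using v w scale[of 0 0] csubspace_0[OF S'(1)] by (auto simp: cinner_self_eq_0)
  have orth: "cinner y v = 0" if "y \<in> N" for y
    using p(2)[OF that] by (simp add: v_def cinner_eq_zero_commute)
  define z where "z = (cnj (\<phi> v) / cinner v v) *\<^sub>C v"
  have cv: "cnj (cinner v v) = cinner v v" by (simp add: cinner_self)
  show thesis
  proof (rule that[of z])
    show "z \<in> S" using v S' by (simp add: z_def csubspace_scaleC)
    fix x assume x: "x \<in> S"
    have "x - (\<phi> x / \<phi> v) *\<^sub>C v \<in> N"
      using x v w S' by (simp add: N_def csubspace_diff csubspace_scaleC diff scale)
    from orth[OF this] have "cinner x v = \<phi> x / \<phi> v * cinner v v"
      by (simp add: cinner_simps)
    then show "\<phi> x = cinner x z" using v0 v w by (simp add: z_def cinner_scaleC_right cv)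
  qed
qed

text \<open>Most adjoints below are known explicitly. This predicate lets them be composed and added without
  the definite description in \<^const>\<open>adj\<close>.\<close>

definition adjoint_on :: "'a::complex_inner set \<Rightarrow> ('a \<Rightarrow> 'a) \<Rightarrow> ('a \<Rightarrow> 'a) \<Rightarrow> bool"
  where "adjoint_on S T T' \<longleftrightarrow> bounded_op S T \<and> bounded_op S T' \<and>
    (\<forall>x\<in>S. \<forall>y\<in>S. cinner (T x) y = cinner x (T' y))"

lemma adjoint_on_bounded: "adjoint_on S T T' \<Longrightarrow> bounded_op S T" "adjoint_on S T T' \<Longrightarrow> bounded_op S T'"
  by (auto simp: adjoint_on_def)

lemma adjoint_on_cinner: "adjoint_on S T T' \<Longrightarrow> x \<in> S \<Longrightarrow> y \<in> S \<Longrightarrow> cinner (T x) y = cinner x (T' y)"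
  by (auto simp: adjoint_on_def)

lemma adjoint_on_sym: "adjoint_on S T T' \<Longrightarrow> adjoint_on S T' T"
  unfolding adjoint_on_def by (metis cinner_commute)

lemma adjoint_on_cong:
  assumes "csubspace S" "\<And>x. x \<in> S \<Longrightarrow> T x = U x" "\<And>x. x \<in> S \<Longrightarrow> T' x = U' x" "adjoint_on S T T'"
  shows "adjoint_on S U U'"
  using assms bounded_op_cong[OF assms(1,2)] bounded_op_cong[OF assms(1,3)] by (simp add: adjoint_on_def)

lemma adj_eq:
  assumes "csubspace S" "adjoint_on S T T'" "y \<in> S"
  shows "adj S T y = T' y"
proof -
  have T': "T' y \<in> S" using assms by (simp add: adjoint_on_def bounded_op_in)
  have eq: "cinner (T x) y = cinner x (T' y)" if "x \<in> S" for x using assms that by (simp add: adjoint_on_def)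
  have "(THE z. z \<in> S \<and> (\<forall>x\<in>S. cinner (T x) y = cinner x z)) = T' y"
  proof (rule the_equality)
    fix z assume z: "z \<in> S \<and> (\<forall>x\<in>S. cinner (T x) y = cinner x z)"
    then have "cinner x z = cinner x (T' y)" if "x \<in> S" for x using eq that by simp
    then show "z = T' y" using z T' by (intro csubspace_eqI[OF assms(1)]) (metis cinner_commute)+
  qed (use T' eq in auto)
  then show ?thesis using assms(3) by (simp add: adj_def)
qed

lemma adjoint_on_adj:
  fixes S :: "'a::chilbert_space set"
  assumes S: "closed_csubspace S" and T: "bounded_op S T"
  shows "adjoint_on S T (adj S T)"
proof -
  have S': "csubspace S" using S by (rule closed_csubspaceD)
  obtain B where B0: "B > 0" and B: "\<And>x. x \<in> S \<Longrightarrow> norm (T x) \<le> B * norm x"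
    using bounded_op_bound[OF T] by blast
  have "\<exists>z. z \<in> S \<and> (\<forall>x\<in>S. cinner (T x) y = cinner x z)" if "y \<in> S" for y
  proof -
    have le: "cmod (cinner (T x) y) \<le> (B * norm y) * norm x" if "x \<in> S" for x
      using order_trans[OF norm_cinner_le mult_right_mono[OF B[OF that] norm_ge_zero[of y]]]
      by (simp add: mult.assoc mult.commute[of "norm x"])
    show ?thesis
      by (rule riesz_representation[OF S, of "\<lambda>x. cinner (T x) y" "B * norm y"])
        (auto simp: bounded_op_add[OF T] bounded_op_scaleC[OF T] cinner_simps le)
  qed
  then obtain T' where T': "\<And>y. y \<in> S \<Longrightarrow> T' y \<in> S"
      "\<And>x y. x \<in> S \<Longrightarrow> y \<in> S \<Longrightarrow> cinner (T x) y = cinner x (T' y)" by metis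
  have T'2: "cinner (T' y) x = cinner y (T x)" if "x \<in> S" "y \<in> S" for x y
    using T'(2)[OF that] by (metis cinner_commute)
  have "bounded_op S T'"
  proof (rule bounded_opI)
    fix x y assume xy: "x \<in> S" "y \<in> S"
    show "T' (x + y) = T' x + T' y"
      by (rule csubspace_eqI[OF S']) (use xy S' T' in \<open>simp_all add: csubspace_add T'2 cinner_simps\<close>)
  next
    fix c x assume x: "x \<in> S"
    show "T' (c *\<^sub>C x) = c *\<^sub>C T' x"
      by (rule csubspace_eqI[OF S']) (use x S' T' in \<open>simp_all add: csubspace_scaleC T'2 cinner_simps\<close>)
  next
    fix x assume x: "x \<in> S"
    have "(norm (T' x))\<^sup>2 = cmod (cinner (T (T' x)) x)"
      using T'(2)[OF T'(1)[OF x] x] by (simp add: cinner_self norm_power)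
    also have "\<dots> \<le> norm (T (T' x)) * norm x" by (rule norm_cinner_le)
    also have "\<dots> \<le> (B * norm (T' x)) * norm x" by (intro mult_right_mono B T' x) simp
    finally have "norm (T' x) * norm (T' x) \<le> norm (T' x) * (B * norm x)"
      by (simp add: power2_eq_square mult_ac)
    then show "norm (T' x) \<le> B * norm x"
      using B0 by (cases "T' x = 0") auto
  qed (rule T')
  with T T'(2) have ad: "adjoint_on S T T'" by (simp add: adjoint_on_def)
  show ?thesis by (rule adjoint_on_cong[OF S' refl _ ad]) (simp add: adj_eq[OF S' ad])
qed

lemma adjoint_on_ident: "adjoint_on S (\<lambda>x. x) (\<lambda>x. x)"
  by (simp add: adjoint_on_def bounded_op_ident)

lemma adjoint_on_comp: "adjoint_on S T T' \<Longrightarrow> adjoint_on S U U' \<Longrightarrow> adjoint_on S (\<lambda>x. T (U x)) (\<lambda>x. U' (T' x))"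
  unfolding adjoint_on_def by (simp add: bounded_op_comp[of S T U] bounded_op_comp[of S U' T'] bounded_op_in)

lemma adjoint_on_plus:
  "csubspace S \<Longrightarrow> adjoint_on S T T' \<Longrightarrow> adjoint_on S U U' \<Longrightarrow> adjoint_on S (\<lambda>x. T x + U x) (\<lambda>x. T' x + U' x)"
  unfolding adjoint_on_def by (auto intro: bounded_op_plus simp: cinner_simps)

lemma adjoint_on_minus:
  "csubspace S \<Longrightarrow> adjoint_on S T T' \<Longrightarrow> adjoint_on S U U' \<Longrightarrow> adjoint_on S (\<lambda>x. T x - U x) (\<lambda>x. T' x - U' x)"
  unfolding adjoint_on_def by (auto intro: bounded_op_minus simp: cinner_simps)

lemma adjoint_on_scale:
  "csubspace S \<Longrightarrow> adjoint_on S T T' \<Longrightarrow> adjoint_on S (\<lambda>x. c *\<^sub>C T x) (\<lambda>x. cnj c *\<^sub>C T' x)"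
  unfolding adjoint_on_def by (auto intro: bounded_op_scale simp: cinner_simps)

lemma adjoint_on_commute:
  assumes S: "csubspace S" and T: "adjoint_on S T T'" and U: "adjoint_on S U U'"
    and comm: "\<And>x. x \<in> S \<Longrightarrow> T (U x) = U (T x)" and x: "x \<in> S"
  shows "T' (U' x) = U' (T' x)"
proof -
  have b: "bounded_op S T" "bounded_op S U" "bounded_op S T'" "bounded_op S U'"
    using T U by (auto dest: adjoint_on_bounded)
  show ?thesis
    by (rule csubspace_eqI[OF S])
      (use x b comm in \<open>simp_all add: bounded_op_in adjoint_on_cinner[OF adjoint_on_sym[OF T]]
        adjoint_on_cinner[OF adjoint_on_sym[OF U]]\<close>)
qed

section \<open>Positive square roots\<close>

text \<open>By polarization: the form is real at \<open>x + y\<close> and at \<open>x + \<i> y\<close>.\<close>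

lemma positive_op_adjoint:
  assumes S: "csubspace S" and T: "positive_op S T"
  shows "adjoint_on S T T"
proof -
  have b: "bounded_op S T" and p: "\<And>x. x \<in> S \<Longrightarrow> Im (cinner (T x) x) = 0"
    using T by (auto simp: positive_op_def complex_nonneg_Reals_iff)
  have "cinner (T x) y = cinner x (T y)" if x: "x \<in> S" and y: "y \<in> S" for x y
  proof -
    have iy: "\<i> *\<^sub>C y \<in> S" using y S by (rule csubspace_scaleC[rotated])
    have "Im (cinner (T x) y) + Im (cinner (T y) x) = 0"
      using p[OF csubspace_add[OF S x y]] p[OF x] p[OF y] x y
      by (simp add: bounded_op_add[OF b] cinner_simps)
    moreover have "Re (cinner (T x) y) = Re (cinner (T y) x)"
      using p[OF csubspace_add[OF S x iy]] p[OF x] p[OF iy] x y iy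
      by (simp add: bounded_op_add[OF b] bounded_op_scaleC[OF b] cinner_simps)
    moreover have "cinner x (T y) = cnj (cinner (T y) x)" by (rule cinner_commute)
    ultimately show ?thesis by (simp add: complex_eq_iff)
  qed
  with b show ?thesis by (simp add: adjoint_on_def)
qed

text \<open>Perturbing \<open>y\<close> in the direction \<open>B y\<close> would otherwise make the quadratic form negative.\<close>

lemma positive_op_form_eq_0:
  assumes S: "csubspace S" and B: "positive_op S B" and y: "y \<in> S" and 0: "cinner (B y) y = 0"
  shows "B y = 0"
proof -
  have b: "bounded_op S B" and pos: "\<And>x. x \<in> S \<Longrightarrow> 0 \<le> Re (cinner (B x) x)"
    using B by (auto simp: positive_op_def complex_nonneg_Reals_iff)
  have By: "B y \<in> S" using b y by (rule bounded_op_in)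
  define n where "n = Re (cinner (B y) (B y))"
  define c where "c = Re (cinner (B (B y)) (B y))"
  have c: "c \<ge> 0" using pos[OF By] by (simp add: c_def)
  define t where "t = - n / (c + 1)"
  have sa: "cinner (B (B y)) y = cinner (B y) (B y)"
    using positive_op_adjoint[OF S B] By y by (rule adjoint_on_cinner)
  have tBy: "t *\<^sub>R B y \<in> S" using S By by (rule csubspace_scaleR)
  have "0 \<le> Re (cinner (B (y + t *\<^sub>R B y)) (y + t *\<^sub>R B y))"
    by (intro pos csubspace_add S y tBy)
  also have "\<dots> = 2 * t * n + t * t * c"
    using 0 y By tBy by (simp add: bounded_op_add[OF b] bounded_op_scaleC[OF b]
        cinner_simps sa n_def c_def scaleR_scaleC
        csubspace_scaleC[OF S] algebra_simps)
  finally have "0 \<le> (2 * t * n + t * t * c) * (c + 1)\<^sup>2" by simp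
  moreover have "t * (c + 1) = - n" using c by (simp add: t_def)
  then have "(2 * t * n + t * t * c) * (c + 1)\<^sup>2 = - (n * n * (c + 2))" by algebra
  ultimately have "n * n * (c + 2) \<le> 0" by simp
  then have "n = 0" using c by (simp add: mult_le_0_iff) linarith
  then show ?thesis by (simp add: n_def cinner_self)
qed

text \<open>With \<open>y = B x - D x\<close>, the sum of the nonnegative numbers \<open>\<langle>B y, y\<rangle>\<close> and \<open>\<langle>D y, y\<rangle>\<close> is
  \<open>\<langle>(B\<^sup>2 - D\<^sup>2) x, y\<rangle> = 0\<close>, so \<open>B\<close> and \<open>D\<close> both annihilate \<open>y\<close>.\<close>

lemma positive_sqrt_unique:
  assumes S: "csubspace S" and B: "positive_op S B" and D: "positive_op S D"
    and comm: "\<And>x. x \<in> S \<Longrightarrow> B (D x) = D (B x)" and sq: "\<And>x. x \<in> S \<Longrightarrow> B (B x) = D (D x)"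
    and x: "x \<in> S"
  shows "B x = D x"
proof -
  have b: "bounded_op S B" "bounded_op S D" using B D by (auto simp: positive_op_def)
  have in_S: "B z \<in> S" "D z \<in> S" if "z \<in> S" for z using that b by (simp_all add: bounded_op_in)
  define y where "y = B x - D x"
  have y: "y \<in> S" unfolding y_def by (intro csubspace_diff S in_S x)
  have "B y + D y = 0"
    using x by (simp add: y_def bounded_op_diff[OF b(1) S] bounded_op_diff[OF b(2) S] in_S comm sq)
  then have "cinner (B y) y + cinner (D y) y = 0"
    by (simp only: cinner_add_left[symmetric] cinner_zero_left)
  moreover have "Re (cinner (B y) y) \<ge> 0" "Im (cinner (B y) y) = 0"
      "Re (cinner (D y) y) \<ge> 0" "Im (cinner (D y) y) = 0"
    using B D y by (auto simp: positive_op_def complex_nonneg_Reals_iff)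
  ultimately have "cinner (B y) y = 0" "cinner (D y) y = 0"
    by (auto simp: complex_eq_iff)
  then have z: "B y = 0" "D y = 0"
    using positive_op_form_eq_0[OF S B y] positive_op_form_eq_0[OF S D y] by auto
  have "cinner y y = cinner x (B y) - cinner x (D y)"
    using adjoint_on_cinner[OF positive_op_adjoint[OF S B] x y]
      adjoint_on_cinner[OF positive_op_adjoint[OF S D] x y]
    unfolding y_def by (simp only: cinner_diff_left)
  then have "y = 0" by (simp add: z cinner_self_eq_0)
  then show ?thesis by (simp add: y_def)
qed

text \<open>The Taylor coefficients of \<open>(1 - y)\<^sup>1\<^sup>/\<^sup>2\<close>.\<close>

definition sqrt_coeff :: "nat \<Rightarrow> real"
  where "sqrt_coeff n = ((1/2) gchoose n) * (- 1) ^ n"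

lemma sqrt_coeff_0 [simp]: "sqrt_coeff 0 = 1"
  by (simp add: sqrt_coeff_def)

lemma sqrt_coeff_Suc_nonpos: "sqrt_coeff (Suc n) \<le> 0"
proof -
  have "sqrt_coeff (Suc n) = pochhammer (- (1/2)) (Suc n) / fact (Suc n)"
    by (simp add: sqrt_coeff_def gbinomial_pochhammer flip: power_mult_distrib)
  also have "pochhammer (- (1/2) :: real) (Suc n) = - (1/2) * pochhammer (1/2) n"
    by (simp add: pochhammer_rec)
  finally show ?thesis using pochhammer_nonneg[of "1/2::real" n] by (simp add: divide_nonpos_pos)
qed

text \<open>The sum of the first coefficients of \<open>(1 - y)\<^sup>1\<^sup>/\<^sup>2\<close> is a coefficient of \<open>(1 - y)\<^sup>1\<^sup>/\<^sup>2 / (1 - y)\<close>, hence nonnegative,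
  and only the constant coefficient \<open>1\<close> is positive.\<close>

lemma sum_abs_sqrt_coeff_Suc: "(\<Sum>n<m. \<bar>sqrt_coeff (Suc n)\<bar>) \<le> 1"
proof -
  have "(\<Sum>n\<le>m. sqrt_coeff n) = pochhammer (1/2) m / fact m"
    using gbinomial_sum_lower_neg[of "1/2::real" m]
    by (simp add: sqrt_coeff_def gbinomial_pochhammer flip: power_mult_distrib)
  also have "\<dots> \<ge> 0" using pochhammer_nonneg[of "1/2::real" m] by simp
  finally have "0 \<le> 1 + (\<Sum>n<m. sqrt_coeff (Suc n))"
    by (simp add: sum.atMost_shift)
  moreover have "(\<Sum>n<m. \<bar>sqrt_coeff (Suc n)\<bar>) = - (\<Sum>n<m. sqrt_coeff (Suc n))"
    by (simp add: sqrt_coeff_Suc_nonpos abs_of_nonpos sum_negf)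
  ultimately show ?thesis by simp
qed

lemma summable_abs_sqrt_coeff: "summable (\<lambda>n. \<bar>sqrt_coeff n\<bar>)"
proof -
  have "summable (\<lambda>n. \<bar>sqrt_coeff (Suc n)\<bar>)"
    by (rule summableI_nonneg_bounded[where x = 1]) (simp_all add: sum_abs_sqrt_coeff_Suc)
  then show ?thesis by (simp add: summable_Suc_iff[of "\<lambda>n. \<bar>sqrt_coeff n\<bar>"])
qed

lemma sqrt_coeff_convolution:
  "(\<Sum>i\<le>n. sqrt_coeff i * sqrt_coeff (n - i)) = (if n = 0 then 1 else if n = 1 then - 1 else 0)"
proof -
  have "(\<Sum>i\<le>n. sqrt_coeff i * sqrt_coeff (n - i)) =
      (\<Sum>i=0..n. ((1/2) gchoose i) * ((1/2) gchoose (n - i))) * (- 1) ^ n"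
    unfolding sum_distrib_right atMost_atLeast0
  proof (rule sum.cong[OF refl])
    fix i assume "i \<in> {0..n}"
    then have "(- 1 :: real) ^ i * (- 1) ^ (n - i) = (- 1) ^ n" by (simp flip: power_add)
    then show "sqrt_coeff i * sqrt_coeff (n - i) =
        ((1/2) gchoose i) * ((1/2) gchoose (n - i)) * (- 1) ^ n"
      unfolding sqrt_coeff_def by (simp only: mult_ac flip: \<open>(- 1 :: real) ^ i * (- 1) ^ (n - i) = (- 1) ^ n\<close>)
  qed
  also have "\<dots> = (1 gchoose n) * (- 1 :: real) ^ n"
    by (simp add: gbinomial_Vandermonde)
  also have "(1 gchoose n) = (of_nat (1 choose n) :: real)"
    using binomial_gbinomial[of 1 n, where 'a = real] by (simp only: of_nat_1)
  finally show ?thesis by (cases n) (auto simp: binomial_eq_0)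
qed

text \<open>The Cauchy square of the series \<open>\<Sum>n. b\<^sub>n Y\<^sup>n\<close> applied to a vector \<open>x\<close>, where \<open>v n = Y\<^sup>n x\<close>.\<close>

lemma cauchy_product_shift:
  fixes v :: "nat \<Rightarrow> 'a::banach"
  assumes b: "summable (\<lambda>n. \<bar>b n\<bar>)" and v: "\<And>n. norm (v n) \<le> M"
  shows "(\<Sum>i. b i *\<^sub>R (\<Sum>j. b j *\<^sub>R v (i + j))) = (\<Sum>n. (\<Sum>i\<le>n. b i * b (n - i)) *\<^sub>R v n)"
proof -
  define f where "f = (\<lambda>(i, j). (b i * b j) *\<^sub>R v (i + j))"
  have b': "((\<lambda>n. \<bar>b n\<bar>) has_sum (\<Sum>n. \<bar>b n\<bar>)) UNIV"
    using b by (intro sums_nonneg_imp_has_sum) auto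
  have "(\<lambda>(i, j). \<bar>b i\<bar> * (\<bar>b j\<bar> * M)) summable_on Sigma UNIV (\<lambda>_. UNIV)"
  proof (rule summable_on_SigmaI[where g = "\<lambda>i. \<bar>b i\<bar> * ((\<Sum>n. \<bar>b n\<bar>) * M)"])
    show "((\<lambda>j. case (i, j) of (i, j) \<Rightarrow> \<bar>b i\<bar> * (\<bar>b j\<bar> * M)) has_sum \<bar>b i\<bar> * ((\<Sum>n. \<bar>b n\<bar>) * M)) UNIV" for i
      unfolding case_prod_conv by (intro has_sum_cmult_right has_sum_cmult_left b')
    show "(\<lambda>i. \<bar>b i\<bar> * ((\<Sum>n. \<bar>b n\<bar>) * M)) summable_on UNIV"
      using b' by (intro summable_on_cmult_left) (auto simp: summable_on_def)
    show "0 \<le> (case (i, j) of (i, j) \<Rightarrow> \<bar>b i\<bar> * (\<bar>b j\<bar> * M))" for i j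
      using order_trans[OF norm_ge_zero v[of 0]] by simp
  qed
  then have "(\<lambda>p. norm (f p)) summable_on Sigma UNIV (\<lambda>_. UNIV)"
    by (rule Infinite_Sum.abs_summable_on_comparison_test')
      (auto simp: f_def abs_mult mult.assoc intro!: mult_left_mono v)
  then have f: "f summable_on Sigma UNIV (\<lambda>_. UNIV)" by (rule abs_summable_summable)
  have inner: "infsum (\<lambda>j. f (i, j)) UNIV = b i *\<^sub>R (\<Sum>j. b j *\<^sub>R v (i + j))" for i
  proof -
    have s: "summable (\<lambda>j. \<bar>b j\<bar> * M)" by (intro summable_mult2 b)
    have n: "summable (\<lambda>j. norm (b j *\<^sub>R v (i + j)))"
      by (rule summable_comparison_test'[OF s]) (simp add: mult_left_mono v)
    have "((\<lambda>j. b j *\<^sub>R v (i + j)) has_sum (\<Sum>j. b j *\<^sub>R v (i + j))) UNIV"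
      by (rule norm_summable_imp_has_sum[OF n summable_sums[OF summable_norm_cancel[OF n]]])
    then have "((\<lambda>j. b i *\<^sub>R (b j *\<^sub>R v (i + j))) has_sum b i *\<^sub>R (\<Sum>j. b j *\<^sub>R v (i + j))) UNIV"
      by (rule has_sum_scaleR)
    then show ?thesis by (simp add: f_def infsumI)
  qed
  have to_suminf: "infsum g UNIV = (\<Sum>n. g n)" if "g summable_on UNIV" for g :: "nat \<Rightarrow> 'a"
    using that by (metis has_sum_imp_sums has_sum_infsum sums_unique)
  let ?T = "Sigma UNIV (\<lambda>n. {..n::nat})"
  let ?h = "\<lambda>(n, i). (i, n - i) :: nat \<times> nat"
  have bij: "bij_betw ?h ?T (Sigma UNIV (\<lambda>_. UNIV))"
    by (rule bij_betw_byWitness[where f' = "\<lambda>(i, j). (i + j, i)"]) auto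
  have fh: "(\<lambda>p. f (?h p)) summable_on ?T"
    using summable_on_reindex_bij_betw[OF bij] f by blast
  have "(\<Sum>i. b i *\<^sub>R (\<Sum>j. b j *\<^sub>R v (i + j))) = infsum (\<lambda>i. infsum (\<lambda>j. f (i, j)) UNIV) UNIV"
    unfolding inner[symmetric]
    using summable_on_Sigma_banach[of "\<lambda>i j. f (i, j)", of UNIV "\<lambda>_. UNIV"] f
    by (intro to_suminf[symmetric]) (simp add: case_prod_unfold)
  also have "\<dots> = infsum f (Sigma UNIV (\<lambda>_. UNIV))" by (rule infsum_Sigma_banach[OF f])
  also have "\<dots> = infsum (\<lambda>p. f (?h p)) ?T" by (rule infsum_reindex_bij_betw[OF bij, symmetric])
  also have "\<dots> = infsum (\<lambda>n. infsum (\<lambda>i. f (?h (n, i))) {..n}) UNIV"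
    by (rule infsum_Sigma_banach[OF fh, symmetric])
  also have "\<dots> = (\<Sum>n. infsum (\<lambda>i. f (?h (n, i))) {..n})"
    using summable_on_Sigma_banach[of "\<lambda>n i. f (?h (n, i))", of UNIV "\<lambda>n. {..n}"] fh
    by (intro to_suminf) (simp add: case_prod_unfold)
  also have "\<dots> = (\<Sum>n. (\<Sum>i\<le>n. b i * b (n - i)) *\<^sub>R v n)"
    by (simp add: f_def scaleR_sum_left)
  finally show ?thesis .
qed

lemma bounded_op_sums:
  assumes S: "csubspace S" and T: "bounded_op S T" and f: "\<And>n. f n \<in> S" "l \<in> S" and l: "f sums l"
  shows "(\<lambda>n. T (f n)) sums T l"
proof -
  have "(\<lambda>n. T (sum f {..<n})) \<longlonglongrightarrow> T l"
    using l f by (intro bounded_op_tendsto[OF S T] csubspace_sum[OF S]) (auto simp: sums_def)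
  then show ?thesis
    using f by (simp add: sums_def clinear_on_sum[OF bounded_op_clinear[OF T] S])
qed

lemma csubspace_suminf:
  assumes "closed_csubspace S" "\<And>n. f n \<in> S" "summable f"
  shows "suminf f \<in> S"
  by (rule closed_sequentially[of S "\<lambda>n. sum f {..<n}"])
    (use assms summable_LIMSEQ in \<open>auto intro: csubspace_sum dest: closed_csubspaceD\<close>)

text \<open>The square root of \<open>1 - Y\<close> is the binomial series of \<open>(1 - y)\<^sup>1\<^sup>/\<^sup>2\<close> in \<open>Y\<close>. Apart from the constant
  term its coefficients are nonpositive with sum at least \<open>-1\<close>. This makes the series converge for a
  contraction \<open>Y\<close>, and its sum positive.\<close>

lemma positive_sqrt_exists:
  fixes S :: "'a::chilbert_space set"
  assumes S: "closed_csubspace S" and Y: "adjoint_on S Y Y" and contr: "\<And>x. x \<in> S \<Longrightarrow> norm (Y x) \<le> norm x"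
  obtains B where "positive_op S B" "\<And>x. x \<in> S \<Longrightarrow> B (B x) = x - Y x"
    "\<And>T x. bounded_op S T \<Longrightarrow> (\<And>x. x \<in> S \<Longrightarrow> T (Y x) = Y (T x)) \<Longrightarrow> x \<in> S \<Longrightarrow> T (B x) = B (T x)"
proof -
  have S': "csubspace S" "closed S" using S by (auto dest: closed_csubspaceD)
  have bY: "bounded_op S Y" using Y by (rule adjoint_on_bounded)
  have bYn: "bounded_op S (Y ^^ n)" for n
    by (induction n) (use bounded_op_comp[OF bY] bounded_op_ident[of S] in \<open>auto simp: o_def id_def\<close>)
  have Yn: "norm ((Y ^^ n) x) \<le> norm x" if "x \<in> S" for n x
  proof (induction n)
    case (Suc n)
    have "norm (Y ((Y ^^ n) x)) \<le> norm ((Y ^^ n) x)" by (rule contr[OF bounded_op_in[OF bYn that]])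
    with Suc show ?case by simp
  qed simp
  define B where "B x = (\<Sum>n. sqrt_coeff n *\<^sub>R (Y ^^ n) x)" for x
  have term_S: "sqrt_coeff n *\<^sub>R (Y ^^ n) x \<in> S" if "x \<in> S" for n x
    by (rule csubspace_scaleR[OF S'(1) bounded_op_in[OF bYn that]])
  have nsum: "summable (\<lambda>n. norm (sqrt_coeff n *\<^sub>R (Y ^^ n) x))" if "x \<in> S" for x
    by (rule summable_comparison_test'[OF summable_mult2[OF summable_abs_sqrt_coeff, of "norm x"]])
      (use Yn[OF that] in \<open>simp add: mult_left_mono\<close>)
  have sums: "(\<lambda>n. sqrt_coeff n *\<^sub>R (Y ^^ n) x) sums B x" if "x \<in> S" for x
    unfolding B_def by (rule summable_sums[OF summable_norm_cancel[OF nsum[OF that]]])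
  have B_S: "B x \<in> S" if "x \<in> S" for x
    unfolding B_def by (rule csubspace_suminf[OF S term_S[OF that] sums_summable[OF sums[OF that]]])
  have bB: "bounded_op S B"
  proof (rule bounded_opI)
    fix x y assume "x \<in> S" "y \<in> S"
    then show "B (x + y) = B x + B y"
      using sums_add[OF sums sums, of x y] sums[of "x + y"] csubspace_add[OF S'(1)]
      by (simp add: bounded_op_add[OF bYn] scaleR_add_right sums_iff)
  next
    fix c x assume x: "x \<in> S"
    show "B (c *\<^sub>C x) = c *\<^sub>C B x"
      using bounded_linear.sums[OF bounded_linear_scaleC_right sums[OF x], of c]
        sums[OF csubspace_scaleC[OF S'(1) x, of c]] x
      by (simp add: bounded_op_scaleC[OF bYn] scaleR_scaleC scaleC_scaleC mult.commute sums_iff)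
  next
    fix x assume x: "x \<in> S"
    have "norm (B x) \<le> (\<Sum>n. norm (sqrt_coeff n *\<^sub>R (Y ^^ n) x))"
      unfolding B_def by (rule summable_norm[OF nsum[OF x]])
    also have "\<dots> \<le> (\<Sum>n. \<bar>sqrt_coeff n\<bar> * norm x)"
      by (rule suminf_le[OF _ nsum[OF x] summable_mult2[OF summable_abs_sqrt_coeff]])
        (simp add: mult_left_mono Yn[OF x])
    also have "\<dots> = (\<Sum>n. \<bar>sqrt_coeff n\<bar>) * norm x"
      by (rule suminf_mult2[symmetric, OF summable_abs_sqrt_coeff])
    finally show "norm (B x) \<le> (\<Sum>n. \<bar>sqrt_coeff n\<bar>) * norm x" .
  qed (rule B_S)
  have sa: "cinner ((Y ^^ n) x) y = cinner x ((Y ^^ n) y)" if "x \<in> S" "y \<in> S" for n x y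
    using that
  proof (induction n arbitrary: y)
    case (Suc n)
    have "cinner ((Y ^^ Suc n) x) y = cinner ((Y ^^ n) x) (Y y)"
      using adjoint_on_cinner[OF Y bounded_op_in[OF bYn Suc.prems(1)] Suc.prems(2)] by simp
    also have "\<dots> = cinner x ((Y ^^ n) (Y y))"
      by (rule Suc.IH[OF Suc.prems(1) bounded_op_in[OF bY Suc.prems(2)]])
    finally show ?case by (simp add: funpow_swap1)
  qed simp
  have pos: "positive_op S B"
    unfolding positive_op_def
  proof (intro conjI ballI)
    fix x assume x: "x \<in> S"
    have "cinner ((Y ^^ n) x) x \<in> \<real>" for n
      using sa[OF x x, of n] cinner_commute[of x "(Y ^^ n) x"] by (simp add: complex_is_Real_iff complex_eq_iff)
    then have im: "Im (cinner ((Y ^^ n) x) x) = 0" for n by (simp add: complex_is_Real_iff)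
    have s: "(\<lambda>n. cinner (sqrt_coeff n *\<^sub>R (Y ^^ n) x) x) sums cinner (B x) x"
      by (rule bounded_linear.sums[OF bounded_linear_cinner_left sums[OF x]])
    have "(\<lambda>n. 0) sums Im (cinner (B x) x)"
      using sums_Im[OF s] by (simp add: scaleR_scaleC cinner_scaleC_left im)
    then have "Im (cinner (B x) x) = 0" using sums_0 sums_unique2 by blast
    moreover have "0 \<le> Re (cinner (B x) x)"
    proof -
      have "(\<lambda>n. sqrt_coeff n * Re (cinner ((Y ^^ n) x) x)) sums Re (cinner (B x) x)"
        using sums_Re[OF s] by (simp add: scaleR_scaleC cinner_scaleC_left)
      then have s': "(\<lambda>n. sqrt_coeff (Suc n) * Re (cinner ((Y ^^ Suc n) x) x)) sums
          (Re (cinner (B x) x) - (norm x)\<^sup>2)"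
        using sums_split_initial_segment[of "\<lambda>n. sqrt_coeff n * Re (cinner ((Y ^^ n) x) x)" _ 1]
        by (simp add: cinner_self)
      have "- ((norm x)\<^sup>2) \<le> Re (cinner (B x) x) - (norm x)\<^sup>2"
      proof (rule Lim_bounded2)
        show "(\<lambda>m. \<Sum>n<m. sqrt_coeff (Suc n) * Re (cinner ((Y ^^ Suc n) x) x)) \<longlonglongrightarrow>
            Re (cinner (B x) x) - (norm x)\<^sup>2"
          using s' by (simp only: sums_def)
        show "\<forall>m\<ge>0. - ((norm x)\<^sup>2) \<le> (\<Sum>n<m. sqrt_coeff (Suc n) * Re (cinner ((Y ^^ Suc n) x) x))"
        proof (intro allI impI)
          fix m
          have "\<bar>sqrt_coeff (Suc n) * Re (cinner ((Y ^^ Suc n) x) x)\<bar> \<le> \<bar>sqrt_coeff (Suc n)\<bar> * (norm x)\<^sup>2" for n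
          proof -
            have "\<bar>Re (cinner ((Y ^^ Suc n) x) x)\<bar> \<le> norm ((Y ^^ Suc n) x) * norm x"
              using abs_Re_le_cmod norm_cinner_le order_trans by blast
            also have "\<dots> \<le> (norm x)\<^sup>2"
              unfolding power2_eq_square by (intro mult_right_mono Yn[OF x]) simp
            finally show ?thesis by (simp add: abs_mult mult_left_mono)
          qed
          then have "\<bar>\<Sum>n<m. sqrt_coeff (Suc n) * Re (cinner ((Y ^^ Suc n) x) x)\<bar>
              \<le> (\<Sum>n<m. \<bar>sqrt_coeff (Suc n)\<bar> * (norm x)\<^sup>2)"
            by (rule order_trans[OF sum_abs sum_mono])
          also have "\<dots> \<le> 1 * (norm x)\<^sup>2"
            unfolding sum_distrib_right[symmetric] by (intro mult_right_mono sum_abs_sqrt_coeff_Suc) simp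
          finally show "- ((norm x)\<^sup>2) \<le> (\<Sum>n<m. sqrt_coeff (Suc n) * Re (cinner ((Y ^^ Suc n) x) x))"
            by simp
        qed
      qed
      then show ?thesis by simp
    qed
    ultimately show "cinner (B x) x \<in> \<real>\<^sub>\<ge>\<^sub>0" by (simp add: complex_nonneg_Reals_iff)
  qed (rule bB)
  have comm: "T (B x) = B (T x)"
    if T: "bounded_op S T" and c: "\<And>x. x \<in> S \<Longrightarrow> T (Y x) = Y (T x)" and x: "x \<in> S" for T x
  proof -
    have "T ((Y ^^ n) x) = (Y ^^ n) (T x)" for n
      by (induction n) (simp_all add: c bounded_op_in[OF bYn x])
    then have "(\<lambda>n. sqrt_coeff n *\<^sub>R (Y ^^ n) (T x)) sums T (B x)"
      using bounded_op_sums[OF S'(1) T term_S[OF x] B_S[OF x] sums[OF x]]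
      by (simp add: clinear_on_scaleR[OF bounded_op_clinear[OF T] bounded_op_in[OF bYn x]])
    then show ?thesis using sums[OF bounded_op_in[OF T x]] by (simp add: sums_iff)
  qed
  have sq: "B (B x) = x - Y x" if x: "x \<in> S" for x
  proof -
    have "(Y ^^ i) (B x) = (\<Sum>j. sqrt_coeff j *\<^sub>R (Y ^^ (i + j)) x)" for i
      using bounded_op_sums[OF S'(1) bYn term_S[OF x] B_S[OF x] sums[OF x], of i]
      by (simp add: clinear_on_scaleR[OF bounded_op_clinear[OF bYn] bounded_op_in[OF bYn x]] funpow_add sums_iff)
    then have "B (B x) = (\<Sum>i. sqrt_coeff i *\<^sub>R (\<Sum>j. sqrt_coeff j *\<^sub>R (Y ^^ (i + j)) x))"
      by (simp add: B_def[of "B x"])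
    also have "\<dots> = (\<Sum>n. (\<Sum>i\<le>n. sqrt_coeff i * sqrt_coeff (n - i)) *\<^sub>R (Y ^^ n) x)"
      using summable_abs_sqrt_coeff Yn[OF x] by (rule cauchy_product_shift)
    also have "\<dots> = (\<Sum>n\<in>{0, 1}. (\<Sum>i\<le>n. sqrt_coeff i * sqrt_coeff (n - i)) *\<^sub>R (Y ^^ n) x)"
      by (rule suminf_finite) (auto simp: sqrt_coeff_convolution)
    also have "\<dots> = x - Y x" by (simp add: sqrt_coeff_convolution)
    finally show ?thesis .
  qed
  show thesis by (rule that[OF pos sq comm])
qed

text \<open>Any other positive root commutes with its square \<open>1 - T\<^sup>* T\<close>, hence with the root given by the series, so
  the two agree and the definite description is meaningful.\<close>

lemma defect_op:
  fixes T :: "'a::chilbert_space \<Rightarrow> 'a"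
  assumes T: "bounded_op UNIV T" and contr: "\<And>x. norm (T x) \<le> norm x"
  shows positive_defect_op: "positive_op UNIV (defect_op T)"
    and defect_op_square: "defect_op T (defect_op T x) = x - adj UNIV T (T x)"
proof -
  have S: "csubspace (UNIV :: 'a set)" by (rule closed_csubspaceD) simp
  let ?Y = "\<lambda>x. adj UNIV T (T x)"
  have ad: "adjoint_on UNIV T (adj UNIV T)" using T by (simp add: adjoint_on_adj)
  have Y: "adjoint_on UNIV ?Y ?Y" by (rule adjoint_on_comp[OF adjoint_on_sym[OF ad] ad])
  have contr': "norm (adj UNIV T x) \<le> norm x" for x
  proof -
    have "(norm (adj UNIV T x))\<^sup>2 = cmod (cinner (T (adj UNIV T x)) x)"
      using adjoint_on_cinner[OF ad, of "adj UNIV T x" x] by (simp add: cinner_self norm_power)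
    also have "\<dots> \<le> norm (T (adj UNIV T x)) * norm x" by (rule norm_cinner_le)
    also have "\<dots> \<le> norm (adj UNIV T x) * norm x" by (intro mult_right_mono contr) simp
    finally have "norm (adj UNIV T x) * norm (adj UNIV T x) \<le> norm (adj UNIV T x) * norm x"
      by (simp add: power2_eq_square)
    then show ?thesis by (cases "adj UNIV T x = 0") auto
  qed
  have "norm (?Y x) \<le> norm x" for x using contr'[of "T x"] contr[of x] by simp
  then obtain B where B: "positive_op UNIV B" "\<And>x. B (B x) = x - ?Y x"
    "\<And>U x. bounded_op UNIV U \<Longrightarrow> (\<And>x. U (?Y x) = ?Y (U x)) \<Longrightarrow> U (B x) = B (U x)"
    by (rule positive_sqrt_exists[OF closed_csubspace_UNIV Y]) auto
  have "\<exists>!D. positive_op UNIV D \<and> (\<forall>x. D (D x) = x - ?Y x)"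
  proof (rule ex1I[of _ B], use B in blast)
    fix D assume D: "positive_op UNIV D \<and> (\<forall>x. D (D x) = x - ?Y x)"
    have bD: "bounded_op UNIV D" using D by (simp add: positive_op_def)
    have eq: "?Y x = x - D (D x)" for x using D by simp
    have comm: "D (B x) = B (D x)" for x
      by (rule B(3)[OF bD]) (simp add: eq bounded_op_diff[OF bD S])
    have "D x = B x" for x
      by (rule positive_sqrt_unique[OF S conjunct1[OF D] B(1) comm _ UNIV_I])
        (simp only: B(2) spec[OF conjunct2[OF D]])
    then show "D = B" by blast
  qed
  from theI'[OF this] show "positive_op UNIV (defect_op T)" "defect_op T (defect_op T x) = x - adj UNIV T (T x)"
    unfolding defect_op_def by auto
qed

section \<open>The distinguished boundary of the hexablock\<close>

text \<open>The explicit form of the distinguished boundary. Its points are the \<open>(u\<^sub>2\<^sub>1, u\<^sub>1\<^sub>1, u\<^sub>2\<^sub>2, det u)\<close> for unitary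
  \<open>2 \<times> 2\<close> matrices \<open>u\<close>.\<close>

definition hexa_boundary :: "complex quad set"
  where "hexa_boundary = {(a, x1, x2, x3). cmod x3 = 1 \<and> x1 = cnj x2 * x3 \<and> (cmod a)\<^sup>2 + (cmod x1)\<^sup>2 = 1}"

text \<open>For fixed \<open>\<alpha>, \<beta>\<close> in the unit disc, \<open>(s, t)\<close> ranges over a bidisc through which the maximum principle is applied.
  For \<open>\<alpha> = \<beta> = 0\<close> it consists of the points \<open>(s, 0, 0, t)\<close>.\<close>

definition hexa_param :: "complex \<Rightarrow> complex \<Rightarrow> complex \<Rightarrow> complex \<Rightarrow> complex quad"
  where "hexa_param \<alpha> \<beta> s t =
    (s * of_real (sqrt ((1 - (cmod \<alpha>)\<^sup>2) * (1 - (cmod \<beta>)\<^sup>2))) / (1 + t * \<alpha> * \<beta>),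
     (cnj \<alpha> + t * \<beta>) / (1 + t * \<alpha> * \<beta>), (cnj \<beta> + t * \<alpha>) / (1 + t * \<alpha> * \<beta>),
     (cnj \<alpha> * cnj \<beta> + t) / (1 + t * \<alpha> * \<beta>))"

text \<open>Cauchy--Schwarz for the form of signature \<open>(1, 1)\<close>, on its positive cone.\<close>

lemma sqrt_diff_squares_mult_le:
  fixes P Q U V :: real
  assumes "0 \<le> U" "U \<le> P" "0 \<le> V" "V \<le> Q"
  shows "sqrt ((P\<^sup>2 - U\<^sup>2) * (Q\<^sup>2 - V\<^sup>2)) \<le> P * Q - U * V"
proof (rule real_le_lsqrt)
  show "0 \<le> P * Q - U * V" using mult_mono[of U P V Q] assms by simp
  have "(P * Q - U * V)\<^sup>2 - (P\<^sup>2 - U\<^sup>2) * (Q\<^sup>2 - V\<^sup>2) = (P * V - Q * U)\<^sup>2" by algebra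
  also have "\<dots> \<ge> 0" by simp
  finally show "(P\<^sup>2 - U\<^sup>2) * (Q\<^sup>2 - V\<^sup>2) \<le> (P * Q - U * V)\<^sup>2" by simp
qed

lemma moebius_norm_identity:
  "(cmod (1 - cnj \<alpha> * z))\<^sup>2 - (cmod (z - \<alpha>))\<^sup>2 = (1 - (cmod \<alpha>)\<^sup>2) * (1 - (cmod z)\<^sup>2)"
proof -
  have "complex_of_real ((cmod (1 - cnj \<alpha> * z))\<^sup>2 - (cmod (z - \<alpha>))\<^sup>2) =
      complex_of_real ((1 - (cmod \<alpha>)\<^sup>2) * (1 - (cmod z)\<^sup>2))"
    unfolding of_real_diff of_real_mult complex_norm_square by (simp add: algebra_simps)
  then show ?thesis by (simp only: of_real_eq_iff)
qed

lemma moebius_norm_le: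
  assumes "cmod \<alpha> < 1" "cmod z \<le> 1"
  shows "cmod (z - \<alpha>) \<le> cmod (1 - cnj \<alpha> * z)"
proof (rule power2_le_imp_le)
  have "0 \<le> (1 - (cmod \<alpha>)\<^sup>2) * (1 - (cmod z)\<^sup>2)"
    using assms by (intro mult_nonneg_nonneg) (auto simp: power_le_one)
  then show "(cmod (z - \<alpha>))\<^sup>2 \<le> (cmod (1 - cnj \<alpha> * z))\<^sup>2"
    using moebius_norm_identity[of \<alpha> z] by linarith
qed simp

lemma one_minus_cnj_mult_neq_0:
  assumes "cmod \<alpha> < 1" "cmod z \<le> 1"
  shows "1 - cnj \<alpha> * z \<noteq> 0"
proof
  assume "1 - cnj \<alpha> * z = 0"
  then have "cmod (cnj \<alpha> * z) = 1" by (metis norm_one right_minus_eq)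
  moreover have "cmod (cnj \<alpha> * z) \<le> cmod \<alpha> * 1"
    unfolding norm_mult complex_mod_cnj by (rule mult_left_mono) (use assms in auto)
  ultimately show False using assms by simp
qed

lemma hexa_denom_neq_0:
  assumes "cmod \<alpha> < 1" "cmod \<beta> < 1" "cmod t \<le> 1"
  shows "1 + t * \<alpha> * \<beta> \<noteq> 0"
proof
  assume "1 + t * \<alpha> * \<beta> = 0"
  then have "t * \<alpha> * \<beta> = - 1" by (simp add: add_eq_0_iff)
  then have "cmod (t * \<alpha> * \<beta>) = 1" by simp
  moreover have "cmod (t * \<alpha> * \<beta>) \<le> 1 * cmod \<alpha> * 1"
    unfolding norm_mult using assms by (intro mult_mono) auto
  ultimately show False using assms by simp
qed

text \<open>After clearing denominators the linear fractional polynomial of \<open>hexa_param\<close> is that of the point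
  \<open>(s, 0, 0, t)\<close>, transformed by the Moebius maps vanishing at \<open>\<alpha>\<close> and \<open>\<beta>\<close>.\<close>

lemma hexa_param_in:
  assumes ab: "cmod \<alpha> < 1" "cmod \<beta> < 1" and st: "cmod s < 1" "cmod t < 1"
  shows "hexa_param \<alpha> \<beta> s t \<in> hexablock"
proof -
  define k where "k = 1 + t * \<alpha> * \<beta>"
  have k: "k \<noteq> 0" unfolding k_def by (rule hexa_denom_neq_0) (use ab st in auto)
  define x1 where "x1 = (cnj \<alpha> + t * \<beta>) / k"
  define x2 where "x2 = (cnj \<beta> + t * \<alpha>) / k"
  define x3 where "x3 = (cnj \<alpha> * cnj \<beta> + t) / k"
  define r where "r = sqrt ((1 - (cmod \<alpha>)\<^sup>2) * (1 - (cmod \<beta>)\<^sup>2))"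
  define a where "a = s * of_real r / k"
  let ?P = "\<lambda>z w. 1 - x1 * z - x2 * w + x3 * z * w"
  have eq: "hexa_param \<alpha> \<beta> s t = (a, x1, x2, x3)"
    by (simp add: hexa_param_def a_def x1_def x2_def x3_def k_def r_def)
  have P: "k * ?P z w = (1 - cnj \<alpha> * z) * (1 - cnj \<beta> * w) + t * (z - \<alpha>) * (w - \<beta>)" for z w
  proof -
    have "k * x1 = cnj \<alpha> + t * \<beta>" "k * x2 = cnj \<beta> + t * \<alpha>" "k * x3 = cnj \<alpha> * cnj \<beta> + t"
      using k by (simp_all add: x1_def x2_def x3_def)
    moreover have "k * ?P z w = k - (k * x1) * z - (k * x2) * w + (k * x3) * z * w"
      by (simp add: algebra_simps)
    ultimately have "k * ?P z w = k - (cnj \<alpha> + t * \<beta>) * z - (cnj \<beta> + t * \<alpha>) * w + (cnj \<alpha> * cnj \<beta> + t) * z * w"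
      by simp
    also have "\<dots> = (1 - cnj \<alpha> * z) * (1 - cnj \<beta> * w) + t * (z - \<alpha>) * (w - \<beta>)"
      unfolding k_def by algebra
    finally show ?thesis .
  qed
  have lower: "cmod (1 - cnj \<alpha> * z) * cmod (1 - cnj \<beta> * w) - cmod (z - \<alpha>) * cmod (w - \<beta>) * cmod t \<le> cmod (k * ?P
      z w)" for z w
    unfolding P using norm_diff_ineq[of "(1 - cnj \<alpha> * z) * (1 - cnj \<beta> * w)" "t * (z - \<alpha>) * (w - \<beta>)"]
    by (simp add: norm_mult mult_ac)
  have "(x1, x2, x3) \<in> tetrablock"
    unfolding tetrablock_def
  proof (clarify)
    fix z w assume z: "cmod z \<le> 1" and w: "cmod w \<le> 1" and 0: "?P z w = 0"
    have "cmod (z - \<alpha>) * cmod (w - \<beta>) * cmod t \<le> cmod (1 - cnj \<alpha> * z) * cmod (1 - cnj \<beta> * w) * cmod t"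
      by (intro mult_right_mono mult_mono moebius_norm_le ab z w) auto
    also have "\<dots> < cmod (1 - cnj \<alpha> * z) * cmod (1 - cnj \<beta> * w) * 1"
      by (rule mult_strict_left_mono)
        (use one_minus_cnj_mult_neq_0[OF ab(1) z] one_minus_cnj_mult_neq_0[OF ab(2) w] st in auto)
    finally show False using lower[of z w] 0 by simp
  qed
  moreover have "(SUP (z1, z2) \<in> ball 0 1 \<times> ball 0 1.
      cmod (a * of_real (sqrt ((1 - (cmod z1)\<^sup>2) * (1 - (cmod z2)\<^sup>2))) / ?P z1 z2)) \<le> cmod s"
  proof (rule cSUP_least)
    show "ball (0::complex) 1 \<times> ball (0::complex) 1 \<noteq> {}" by simp
    fix p :: "complex \<times> complex" assume "p \<in> ball 0 1 \<times> ball 0 1"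
    then obtain z w where p: "p = (z, w)" and z: "cmod z < 1" and w: "cmod w < 1" by auto
    have nn: "0 \<le> 1 - (cmod u)\<^sup>2" if "cmod u < 1" for u using that by (simp add: power_le_one)
    have "r * sqrt ((1 - (cmod z)\<^sup>2) * (1 - (cmod w)\<^sup>2)) =
        sqrt (((cmod (1 - cnj \<alpha> * z))\<^sup>2 - (cmod (z - \<alpha>))\<^sup>2) * ((cmod (1 - cnj \<beta> * w))\<^sup>2 - (cmod (w - \<beta>))\<^sup>2))"
      unfolding moebius_norm_identity r_def by (simp add: real_sqrt_mult mult_ac)
    also have "\<dots> \<le> cmod (1 - cnj \<alpha> * z) * cmod (1 - cnj \<beta> * w) - cmod (z - \<alpha>) * cmod (w - \<beta>)"
      by (intro sqrt_diff_squares_mult_le moebius_norm_le ab) (use z w in auto)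
    also have "\<dots> \<le> cmod (1 - cnj \<alpha> * z) * cmod (1 - cnj \<beta> * w) - cmod (z - \<alpha>) * cmod (w - \<beta>) * cmod t"
      using st by (simp add: mult_left_le)
    also have "\<dots> \<le> cmod (k * ?P z w)" by (rule lower)
    finally have le: "r * sqrt ((1 - (cmod z)\<^sup>2) * (1 - (cmod w)\<^sup>2)) \<le> cmod (k * ?P z w)" .
    have r0: "r \<ge> 0" unfolding r_def using ab nn by simp
    have "cmod (a * of_real (sqrt ((1 - (cmod z)\<^sup>2) * (1 - (cmod w)\<^sup>2))) / ?P z w) =
        cmod s * (r * sqrt ((1 - (cmod z)\<^sup>2) * (1 - (cmod w)\<^sup>2)) / cmod (k * ?P z w))"
      using r0 nn[OF z] nn[OF w] by (simp add: a_def norm_mult norm_divide mult_ac)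
    also have "\<dots> \<le> cmod s * 1"
    proof (rule mult_left_mono)
      show "r * sqrt ((1 - (cmod z)\<^sup>2) * (1 - (cmod w)\<^sup>2)) / cmod (k * ?P z w) \<le> 1"
        using le by (simp add: divide_le_eq_1) linarith?
    qed simp
    finally show "(case p of (z1, z2) \<Rightarrow>
        cmod (a * of_real (sqrt ((1 - (cmod z1)\<^sup>2) * (1 - (cmod z2)\<^sup>2))) / ?P z1 z2)) \<le> cmod s"
      by (simp add: p)
  qed
  ultimately show ?thesis using st unfolding eq hexablock_def by simp
qed

text \<open>If \<open>y \<noteq> 0\<close>, a small step in the direction \<open>\<zeta> = c * cnj y\<close> decreases \<open>|c - y \<zeta>|\<^sup>2\<close> to first order, but
  \<open>1 - |\<zeta>|\<^sup>2\<close> only to second order.\<close>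

lemma linear_coeff_eq_0_of_minimal:
  fixes c y :: complex
  assumes c: "c \<noteq> 0" and min: "\<And>\<zeta>. cmod \<zeta> < 1 \<Longrightarrow> (1 - (cmod \<zeta>)\<^sup>2) * (cmod c)\<^sup>2 \<le> (cmod (c - y * \<zeta>))\<^sup>2"
  shows "y = 0"
proof (rule ccontr)
  assume y: "y \<noteq> 0"
  define Y where "Y = (cmod y)\<^sup>2"
  define C where "C = (cmod c)\<^sup>2"
  have pos: "Y > 0" "C > 0" using y c by (auto simp: Y_def C_def)
  define e where "e = 1 / (1 + Y + C)"
  have e: "e > 0" "e * (1 + Y + C) = 1" using pos by (auto simp: e_def)
  define z where "z = e *\<^sub>R (c * cnj y)"
  have z2: "(cmod z)\<^sup>2 = e * e * (C * Y)"
    using e by (simp add: z_def norm_mult Y_def C_def power_mult_distrib power2_eq_square)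
  have "e * e * (C * Y) < e * e * ((1 + Y + C) * (1 + Y + C))"
  proof -
    have "C * Y < (1 + Y + C) * (1 + Y + C)" using pos by (simp add: algebra_simps add_pos_pos)
    then show ?thesis using e by simp
  qed
  also have "\<dots> = 1" using e(2) by algebra
  finally have "(cmod z)\<^sup>2 < 1" using z2 by simp
  then have "cmod z < 1" by (simp add: power_less_one_iff abs_square_less_1)
  from min[OF this] have m: "(1 - e * e * (C * Y)) * C \<le> (cmod (c - y * z))\<^sup>2" by (simp add: z2 C_def)
  have yz: "y * z = of_real (e * Y) * c"
    using complex_norm_square[of y] by (simp add: z_def Y_def scaleR_conv_of_real mult_ac)
  have "c - y * z = of_real (1 - e * Y) * c" by (simp add: yz algebra_simps)
  then have "(cmod (c - y * z))\<^sup>2 = (1 - e * Y)\<^sup>2 * C"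
    by (simp add: norm_mult power_mult_distrib C_def del: of_real_diff of_real_mult)
  with m have "(1 - e * e * (C * Y)) * C \<le> (1 - e * Y)\<^sup>2 * C" by simp
  then have "1 - e * e * (C * Y) \<le> (1 - e * Y)\<^sup>2" using pos by simp
  then have "2 * (e * Y) \<le> (e * Y) * (e * (Y + C))" by (simp add: power2_eq_square algebra_simps)
  then have "2 \<le> e * (Y + C)" using e pos by (simp add: mult.commute[of 2])
  moreover have "e * (Y + C) = 1 - e" using e(2) by (simp add: algebra_simps)
  ultimately show False using e by simp
qed


lemma moebius_preimage:
  assumes "cmod \<alpha> < 1" "cmod \<zeta> \<le> 1"
  obtains z where "cmod z \<le> 1" "z - \<alpha> = \<zeta> * (1 - cnj \<alpha> * z)"
proof -
  have n0: "1 + cnj \<alpha> * \<zeta> \<noteq> 0"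
    using one_minus_cnj_mult_neq_0[of "- \<alpha>" \<zeta>] assms by simp
  have "cmod (\<zeta> - (- \<alpha>)) \<le> cmod (1 - cnj (- \<alpha>) * \<zeta>)"
    by (rule moebius_norm_le) (use assms in auto)
  then have "cmod ((\<zeta> + \<alpha>) / (1 + cnj \<alpha> * \<zeta>)) \<le> 1"
    using n0 by (simp add: norm_divide divide_le_eq_1)
  moreover have "(\<zeta> + \<alpha>) / (1 + cnj \<alpha> * \<zeta>) - \<alpha> = \<zeta> * (1 - cnj \<alpha> * ((\<zeta> + \<alpha>) / (1 + cnj \<alpha> * \<zeta>)))"
    using n0 by (simp add: field_simps)
  ultimately show thesis by (rule that)
qed

text \<open>The substitution \<open>\<zeta> = (z - \<alpha>) / (1 - cnj \<alpha> * z)\<close> moves the maximum of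
  \<open>(1 - |z|\<^sup>2) / |P z|\<^sup>2\<close> from \<open>\<alpha>\<close> to the origin.\<close>

lemma moebius_coeff_eq_0_of_maximal:
  fixes P :: "complex \<Rightarrow> complex"
  assumes \<alpha>: "cmod \<alpha> < 1" and c: "c \<noteq> 0"
    and P: "\<And>z. (1 - \<alpha> * cnj \<alpha>) * P z = c * (1 - cnj \<alpha> * z) - y * (z - \<alpha>)"
    and max: "\<And>z. cmod z \<le> 1 \<Longrightarrow> (1 - (cmod z)\<^sup>2) * (cmod c)\<^sup>2 \<le> (1 - (cmod \<alpha>)\<^sup>2) * (cmod (P z))\<^sup>2"
  shows "y = 0"
proof (rule linear_coeff_eq_0_of_minimal[OF c])
  fix \<zeta> :: complex assume "cmod \<zeta> < 1"
  then obtain z where z: "cmod z \<le> 1" "z - \<alpha> = \<zeta> * (1 - cnj \<alpha> * z)" using moebius_preimage[OF \<alpha>, of \<zeta>] by auto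
  define u where "u = 1 - cnj \<alpha> * z"
  define d where "d = 1 - (cmod \<alpha>)\<^sup>2"
  have u: "u \<noteq> 0" unfolding u_def by (rule one_minus_cnj_mult_neq_0[OF \<alpha> z(1)])
  have d: "d > 0" using \<alpha> by (simp add: d_def abs_square_less_1)
  have dz: "d * (1 - (cmod z)\<^sup>2) = (1 - (cmod \<zeta>)\<^sup>2) * (cmod u)\<^sup>2"
    using moebius_norm_identity[of \<alpha> z] unfolding z(2) u_def[symmetric] norm_mult power_mult_distrib d_def by algebra
  have "complex_of_real d = 1 - \<alpha> * cnj \<alpha>" unfolding d_def of_real_diff complex_norm_square by simp
  then have "of_real d * P z = u * (c - y * \<zeta>)"
    using P[of z] unfolding z(2) u_def[symmetric] by algebra
  then have "(cmod (of_real d * P z))\<^sup>2 = (cmod (u * (c - y * \<zeta>)))\<^sup>2" by (rule arg_cong)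
  then have "d * (d * (cmod (P z))\<^sup>2) = (cmod u)\<^sup>2 * (cmod (c - y * \<zeta>))\<^sup>2"
    by (simp add: norm_mult power_mult_distrib power2_eq_square[of d])
  moreover have "d * ((1 - (cmod z)\<^sup>2) * (cmod c)\<^sup>2) \<le> d * (d * (cmod (P z))\<^sup>2)"
    using max[OF z(1)] d by (intro mult_left_mono) (simp_all add: d_def)
  moreover have "d * ((1 - (cmod z)\<^sup>2) * (cmod c)\<^sup>2) = (cmod u)\<^sup>2 * ((1 - (cmod \<zeta>)\<^sup>2) * (cmod c)\<^sup>2)"
    using dz by algebra
  ultimately have "(cmod u)\<^sup>2 * ((1 - (cmod \<zeta>)\<^sup>2) * (cmod c)\<^sup>2) \<le> (cmod u)\<^sup>2 * (cmod (c - y * \<zeta>))\<^sup>2" by simp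
  then show "(1 - (cmod \<zeta>)\<^sup>2) * (cmod c)\<^sup>2 \<le> (cmod (c - y * \<zeta>))\<^sup>2" using u by simp
qed

text \<open>The point \<open>(\<alpha>, \<beta>)\<close> maximizes \<open>(1 - |z\<^sub>1|\<^sup>2) (1 - |z\<^sub>2|\<^sup>2) / |1 - x\<^sub>1 z\<^sub>1 - x\<^sub>2 z\<^sub>2 + x\<^sub>3 z\<^sub>1 z\<^sub>2|\<^sup>2\<close> over the closed
  bidisc. After the Moebius maps moving it to the origin, criticality says that the linear terms of
  the polynomial vanish.\<close>

lemma hexa_param_surj:
  assumes q: "q \<in> hexablock"
  obtains \<alpha> \<beta> s t where "cmod \<alpha> < 1" "cmod \<beta> < 1" "cmod s < 1" "cmod t < 1" "q = hexa_param \<alpha> \<beta> s t"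
proof -
  obtain a x1 x2 x3 where q_eq: "q = (a, x1, x2, x3)" by (cases q)
  define P where "P z w = 1 - x1 * z - x2 * w + x3 * z * w" for z w
  define d where "d = (\<lambda>z. 1 - (cmod z)\<^sup>2)"
  define R where "R = (\<lambda>(z, w). cmod (a * of_real (sqrt (d z * d w)) / P z w))"
  have P0: "P z w \<noteq> 0" if "cmod z \<le> 1" "cmod w \<le> 1" for z w
    using q that by (auto simp: q_eq hexablock_def tetrablock_def P_def)
  have sup: "(SUP p\<in>ball 0 1 \<times> ball 0 1. R p) < 1"
    using q by (simp add: q_eq hexablock_def R_def d_def P_def case_prod_unfold)
  define B where "B = cball (0::complex) 1 \<times> cball (0::complex) 1"
  have cB: "compact B" unfolding B_def by (intro compact_Times compact_cball)
  have P0B: "P (fst p) (snd p) \<noteq> 0" if "p \<in> B" for p using that by (auto simp: B_def P0)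
  have contP: "continuous_on B (\<lambda>p. P (fst p) (snd p))"
    unfolding P_def by (intro continuous_intros)
  have bdd: "bdd_above (R ` (ball 0 1 \<times> ball 0 1))"
  proof (rule bdd_above_mono)
    have "continuous_on B (\<lambda>p. cmod (a * of_real (sqrt (d (fst p) * d (snd p))) / P (fst p) (snd p)))"
      unfolding d_def by (intro continuous_intros contP) (use P0B in auto)
    then have "continuous_on B R" by (simp add: R_def case_prod_unfold)
    then show "bdd_above (R ` B)"
      by (intro bounded_imp_bdd_above compact_imp_bounded compact_continuous_image cB)
  qed (auto simp: B_def)
  define g where "g = (\<lambda>p. d (fst p) * d (snd p) / (cmod (P (fst p) (snd p)))\<^sup>2)"
  have "continuous_on B g"
    unfolding g_def d_def by (intro continuous_intros contP) (use P0B in auto)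
  moreover have "B \<noteq> {}" by (simp add: B_def)
  ultimately obtain p where p: "p \<in> B" and pmax: "\<And>p'. p' \<in> B \<Longrightarrow> g p' \<le> g p"
    using continuous_attains_sup[OF cB] by blast
  obtain \<alpha> \<beta> where p_eq: "p = (\<alpha>, \<beta>)" by (cases p)
  have "g (0, 0) \<le> g p" by (rule pmax) (simp add: B_def)
  then have g1: "1 \<le> g p" by (simp add: g_def d_def P_def)
  have "cmod \<alpha> \<noteq> 1" "cmod \<beta> \<noteq> 1" using g1 by (auto simp: g_def d_def p_eq)
  then have ab: "cmod \<alpha> < 1" "cmod \<beta> < 1" using p by (auto simp: B_def p_eq)
  define c where "c = P \<alpha> \<beta>"
  have c: "c \<noteq> 0" unfolding c_def using ab by (intro P0) auto
  have dpos: "d z > 0" if "cmod z < 1" for z using that by (simp add: d_def abs_square_less_1)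
  have max: "d z * d w * (cmod c)\<^sup>2 \<le> d \<alpha> * d \<beta> * (cmod (P z w))\<^sup>2" if "cmod z \<le> 1" "cmod w \<le> 1" for z w
  proof -
    have "g (z, w) \<le> g p" by (rule pmax) (use that in \<open>simp add: B_def\<close>)
    then show ?thesis using c P0[OF that] by (simp add: g_def p_eq c_def[symmetric] field_simps)
  qed
  define y1 where "y1 = x1 + x2 * cnj \<alpha> * \<beta> - x3 * \<beta> - cnj \<alpha>"
  define y2 where "y2 = x2 + x1 * \<alpha> * cnj \<beta> - x3 * \<alpha> - cnj \<beta>"
  define y3 where "y3 = cnj \<alpha> * cnj \<beta> - x1 * cnj \<beta> - x2 * cnj \<alpha> + x3"
  have dC: "complex_of_real (d z) = 1 - z * cnj z" for z
    unfolding d_def of_real_diff complex_norm_square by simp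
  have expand: "(1 - \<alpha> * cnj \<alpha>) * (1 - \<beta> * cnj \<beta>) * P z w = c * (1 - cnj \<alpha> * z) * (1 - cnj \<beta> * w)
      - y1 * (z - \<alpha>) * (1 - cnj \<beta> * w) - y2 * (1 - cnj \<alpha> * z) * (w - \<beta>) + y3 * (z - \<alpha>) * (w - \<beta>)" for z w
    unfolding P_def c_def y1_def y2_def y3_def by algebra
  have nz: "1 - z * cnj z \<noteq> 0" if "cmod z < 1" for z
    using dpos[OF that] dC[of z] by (metis of_real_eq_0_iff less_irrefl)
  have y1: "y1 = 0"
  proof (rule moebius_coeff_eq_0_of_maximal[OF ab(1) c, of "\<lambda>z. P z \<beta>"])
    fix z
    show "(1 - \<alpha> * cnj \<alpha>) * P z \<beta> = c * (1 - cnj \<alpha> * z) - y1 * (z - \<alpha>)"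
      unfolding P_def c_def y1_def by algebra
    assume z: "cmod z \<le> 1"
    have "d \<beta> * (d z * (cmod c)\<^sup>2) \<le> d \<beta> * (d \<alpha> * (cmod (P z \<beta>))\<^sup>2)"
      using max[of z \<beta>] z ab by (simp add: mult_ac)
    then show "(1 - (cmod z)\<^sup>2) * (cmod c)\<^sup>2 \<le> (1 - (cmod \<alpha>)\<^sup>2) * (cmod (P z \<beta>))\<^sup>2"
      using dpos[OF ab(2)] by (simp add: d_def)
  qed
  have y2: "y2 = 0"
  proof (rule moebius_coeff_eq_0_of_maximal[OF ab(2) c, of "P \<alpha>"])
    fix w
    show "(1 - \<beta> * cnj \<beta>) * P \<alpha> w = c * (1 - cnj \<beta> * w) - y2 * (w - \<beta>)"
      unfolding P_def c_def y2_def by algebra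
    assume w: "cmod w \<le> 1"
    have "d \<alpha> * (d w * (cmod c)\<^sup>2) \<le> d \<alpha> * (d \<beta> * (cmod (P \<alpha> w))\<^sup>2)"
      using max[of \<alpha> w] w ab by (simp add: mult_ac)
    then show "(1 - (cmod w)\<^sup>2) * (cmod c)\<^sup>2 \<le> (1 - (cmod \<beta>)\<^sup>2) * (cmod (P \<alpha> w))\<^sup>2"
      using dpos[OF ab(1)] by (simp add: d_def)
  qed
  define t where "t = y3 / c"
  have y3: "y3 = t * c" using c by (simp add: t_def)
  have t: "cmod t < 1"
  proof (rule ccontr)
    assume *: "\<not> cmod t < 1"
    then have t0: "t \<noteq> 0" by auto
    \<comment> \<open>At these values of the Moebius maps \<open>1 + t \<zeta>\<^sub>1 \<zeta>\<^sub>2\<close> vanishes.\<close>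
    have "cmod (- 1 / t) \<le> 1" using * t0 by (simp add: norm_divide divide_le_eq_1)
    then obtain z where z: "cmod z \<le> 1" "z - \<alpha> = (- 1 / t) * (1 - cnj \<alpha> * z)"
      by (rule moebius_preimage[OF ab(1)])
    obtain w where w: "cmod w \<le> 1" "w - \<beta> = 1 * (1 - cnj \<beta> * w)"
      by (rule moebius_preimage[OF ab(2), of 1]) auto
    have "(1 - \<alpha> * cnj \<alpha>) * (1 - \<beta> * cnj \<beta>) * P z w = 0"
      unfolding expand y1 y2 y3 z(2) w(2) using t0 by (simp add: field_simps)
    then show False using P0[OF z(1) w(1)] nz[OF ab(1)] nz[OF ab(2)] by simp
  qed
  define k where "k = 1 + t * \<alpha> * \<beta>"
  have k: "k \<noteq> 0" unfolding k_def by (rule hexa_denom_neq_0) (use ab t in auto)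
  define M where "M = (1 - \<alpha> * cnj \<alpha>) * (1 - \<beta> * cnj \<beta>)"
  have Mr: "M = of_real (d \<alpha> * d \<beta>)" by (simp add: M_def dC)
  have M: "M = c * k"
    using expand[of 0 0] unfolding y1 y2 y3 M_def[symmetric] by (simp add: P_def k_def algebra_simps)
  have M0: "M \<noteq> 0" using c k M by simp
  have ceq: "c = 1 - x1 * \<alpha> - x2 * \<beta> + x3 * \<alpha> * \<beta>" by (simp add: c_def P_def)
  have y1': "x1 + x2 * cnj \<alpha> * \<beta> - x3 * \<beta> - cnj \<alpha> = 0" using y1 by (simp add: y1_def)
  have y2': "x2 + x1 * \<alpha> * cnj \<beta> - x3 * \<alpha> - cnj \<beta> = 0" using y2 by (simp add: y2_def)
  have y3': "cnj \<alpha> * cnj \<beta> - x1 * cnj \<beta> - x2 * cnj \<alpha> + x3 = t * c" using y3 by (simp add: y3_def)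
  have "M * x1 = c * (cnj \<alpha> + t * \<beta>)"
    unfolding M_def using ceq y1' y2' y3' by algebra
  then have "k * x1 = (cnj \<alpha> + t * \<beta>)" using c by (simp add: M mult.assoc)
  then have x1: "x1 = (cnj \<alpha> + t * \<beta>) / k" using k by (simp add: eq_divide_eq mult.commute)
  have "M * x2 = c * (cnj \<beta> + t * \<alpha>)"
    unfolding M_def using ceq y1' y2' y3' by algebra
  then have "k * x2 = (cnj \<beta> + t * \<alpha>)" using c by (simp add: M mult.assoc)
  then have x2: "x2 = (cnj \<beta> + t * \<alpha>) / k" using k by (simp add: eq_divide_eq mult.commute)
  have "M * x3 = c * (cnj \<alpha> * cnj \<beta> + t)"
    unfolding M_def using ceq y1' y2' y3' by algebra
  then have "k * x3 = (cnj \<alpha> * cnj \<beta> + t)" using c by (simp add: M mult.assoc)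
  then have x3: "x3 = (cnj \<alpha> * cnj \<beta> + t) / k" using k by (simp add: eq_divide_eq mult.commute)
  define r where "r = sqrt (d \<alpha> * d \<beta>)"
  have r: "r > 0" "r * r = d \<alpha> * d \<beta>" using dpos[OF ab(1)] dpos[OF ab(2)] by (auto simp: r_def)
  define s where "s = a * k / of_real r"
  have "R p < 1"
    using ab by (intro le_less_trans[OF cSUP_upper[OF _ bdd] sup]) (simp add: p_eq)
  then have "cmod a * r / cmod c < 1"
    using r by (simp add: R_def p_eq c_def[symmetric] r_def[symmetric] norm_mult norm_divide)
  moreover have "cmod s = cmod a * r / cmod c"
  proof -
    have "cmod c * cmod k = r * r" using M Mr r by (metis norm_mult norm_of_real abs_of_pos mult_pos_pos)
    then have "cmod k / r = r / cmod c" using r c by (simp add: field_simps)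
    moreover have "cmod s = cmod a * (cmod k / r)" using r by (simp add: s_def norm_mult norm_divide)
    ultimately show ?thesis by simp
  qed
  ultimately have s: "cmod s < 1" by simp
  have a: "a = s * of_real r / k" using r k by (simp add: s_def)
  show thesis
    by (rule that[OF ab s t]) (simp add: q_eq hexa_param_def a x1 x2 x3 k_def r_def d_def)
qed


lemma hexa_param_swap: "hexa_param \<alpha> \<beta> s t = (a, x1, x2, x3) \<Longrightarrow> hexa_param \<beta> \<alpha> s t = (a, x2, x1, x3)"
  by (auto simp: hexa_param_def mult_ac)

lemma hexa_param_norms:
  assumes ab: "cmod \<alpha> < 1" "cmod \<beta> < 1" and t1: "cmod t \<le> 1" and q: "hexa_param \<alpha> \<beta> s t = (a, x1, x2, x3)"
  defines "k \<equiv> 1 + t * \<alpha> * \<beta>"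
  shows "(cmod k)\<^sup>2 * (1 - (cmod a)\<^sup>2 - (cmod x1)\<^sup>2) =
      (1 - (cmod \<alpha>)\<^sup>2) * ((1 - (cmod t)\<^sup>2 * (cmod \<beta>)\<^sup>2) - (cmod s)\<^sup>2 * (1 - (cmod \<beta>)\<^sup>2))"
    and "(cmod k)\<^sup>2 * (1 - (cmod x3)\<^sup>2) = (1 - (cmod \<alpha> * cmod \<beta>)\<^sup>2) * (1 - (cmod t)\<^sup>2)"
proof -
  have k: "k \<noteq> 0" unfolding k_def by (rule hexa_denom_neq_0[OF ab t1])
  have nn: "0 \<le> (1 - (cmod \<alpha>)\<^sup>2) * (1 - (cmod \<beta>)\<^sup>2)" using ab by (simp add: power_le_one)
  have a: "(cmod k)\<^sup>2 * (cmod a)\<^sup>2 = (cmod s)\<^sup>2 * ((1 - (cmod \<alpha>)\<^sup>2) * (1 - (cmod \<beta>)\<^sup>2))"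
    using q k nn by (auto simp: hexa_param_def k_def[symmetric] norm_mult norm_divide power_mult_distrib power_divide)
  have x1: "(cmod k)\<^sup>2 * (cmod x1)\<^sup>2 = (cmod (cnj \<alpha> + t * \<beta>))\<^sup>2"
    using q k by (auto simp: hexa_param_def k_def[symmetric] norm_divide power_divide)
  have x3: "(cmod k)\<^sup>2 * (cmod x3)\<^sup>2 = (cmod (cnj \<alpha> * cnj \<beta> + t))\<^sup>2"
    using q k by (auto simp: hexa_param_def k_def[symmetric] norm_divide power_divide)
  have "- (t * \<beta>) - cnj \<alpha> = - (cnj \<alpha> + t * \<beta>)" by simp
  then have "cmod (- (t * \<beta>) - cnj \<alpha>) = cmod (cnj \<alpha> + t * \<beta>)" by (simp only: norm_minus_cancel)
  then have "(cmod k)\<^sup>2 - (cmod (cnj \<alpha> + t * \<beta>))\<^sup>2 = (1 - (cmod \<alpha>)\<^sup>2) * (1 - (cmod t)\<^sup>2 * (cmod \<beta>)\<^sup>2)"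
    using moebius_norm_identity[of "cnj \<alpha>" "- (t * \<beta>)"]
    by (simp add: k_def norm_mult power_mult_distrib mult_ac)
  then show "(cmod k)\<^sup>2 * (1 - (cmod a)\<^sup>2 - (cmod x1)\<^sup>2) =
      (1 - (cmod \<alpha>)\<^sup>2) * ((1 - (cmod t)\<^sup>2 * (cmod \<beta>)\<^sup>2) - (cmod s)\<^sup>2 * (1 - (cmod \<beta>)\<^sup>2))"
    using a x1 by algebra
  have "(cmod k)\<^sup>2 - (cmod (cnj \<alpha> * cnj \<beta> + t))\<^sup>2 = (1 - (cmod \<alpha> * cmod \<beta>)\<^sup>2) * (1 - (cmod t)\<^sup>2)"
    using moebius_norm_identity[of "- (cnj \<alpha> * cnj \<beta>)" t]
    by (simp add: k_def norm_mult mult_ac add.commute)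
  then show "(cmod k)\<^sup>2 * (1 - (cmod x3)\<^sup>2) = (1 - (cmod \<alpha> * cmod \<beta>)\<^sup>2) * (1 - (cmod t)\<^sup>2)"
    using x3 by algebra
qed

text \<open>These bounds on the coordinates make the linear peak functions below work.\<close>

lemma hexablock_bounds:
  assumes "(a, x1, x2, x3) \<in> hexablock"
  shows "(cmod a)\<^sup>2 + (cmod x1)\<^sup>2 \<le> 1" "(cmod a)\<^sup>2 + (cmod x2)\<^sup>2 \<le> 1" "cmod x3 \<le> 1"
proof -
  obtain \<alpha> \<beta> s t where ab: "cmod \<alpha> < 1" "cmod \<beta> < 1" and st: "cmod s < 1" "cmod t < 1"
    and q: "hexa_param \<alpha> \<beta> s t = (a, x1, x2, x3)"
    using hexa_param_surj[OF assms] by metis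
  define k where "k = 1 + t * \<alpha> * \<beta>"
  have k: "(cmod k)\<^sup>2 > 0" using hexa_denom_neq_0[of \<alpha> \<beta> t] ab st by (simp add: k_def)
  have le1: "(cmod z)\<^sup>2 \<le> 1" if "cmod z < 1" for z using that by (simp add: power_le_one)
  have main: "0 \<le> (1 - (cmod u)\<^sup>2) * ((1 - (cmod t)\<^sup>2 * (cmod v)\<^sup>2) - (cmod s)\<^sup>2 * (1 - (cmod v)\<^sup>2))"
    if "cmod u < 1" "cmod v < 1" for u v
  proof -
    have "(cmod s)\<^sup>2 * (1 - (cmod v)\<^sup>2) \<le> 1 * (1 - (cmod v)\<^sup>2)"
      by (intro mult_right_mono le1 st) (use le1[OF that(2)] in simp)
    moreover have "(cmod t)\<^sup>2 * (cmod v)\<^sup>2 \<le> 1 * (cmod v)\<^sup>2" by (intro mult_right_mono le1 st) simp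
    ultimately show ?thesis using le1[OF that(1)] by (intro mult_nonneg_nonneg) auto
  qed
  note n = hexa_param_norms[OF ab less_imp_le[OF st(2)] q]
    and n' = hexa_param_norms[OF ab(2,1) less_imp_le[OF st(2)] hexa_param_swap[OF q]]
  have "0 \<le> (cmod k)\<^sup>2 * (1 - (cmod a)\<^sup>2 - (cmod x1)\<^sup>2)"
    unfolding k_def n(1) by (rule main[OF ab])
  then show "(cmod a)\<^sup>2 + (cmod x1)\<^sup>2 \<le> 1" using k by (simp add: zero_le_mult_iff)
  have "k = 1 + t * \<beta> * \<alpha>" by (simp add: k_def mult_ac)
  then have "0 \<le> (cmod k)\<^sup>2 * (1 - (cmod a)\<^sup>2 - (cmod x2)\<^sup>2)"
    using main[OF ab(2,1)] n'(1) by simp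
  then show "(cmod a)\<^sup>2 + (cmod x2)\<^sup>2 \<le> 1" using k by (simp add: zero_le_mult_iff)
  have "cmod \<alpha> * cmod \<beta> \<le> 1" using ab by (intro mult_le_one) auto
  then have "0 \<le> (1 - (cmod \<alpha> * cmod \<beta>)\<^sup>2) * (1 - (cmod t)\<^sup>2)"
    using le1[OF st(2)] by (intro mult_nonneg_nonneg) (simp_all add: power_le_one)
  then have "0 \<le> 1 - (cmod x3)\<^sup>2"
    using k unfolding n(2)[folded k_def, symmetric] by (simp only: zero_le_mult_iff) linarith
  then show "cmod x3 \<le> 1" by (simp add: abs_square_le_1)
qed

lemma closure_hexablock_bounds:
  assumes "(a, x1, x2, x3) \<in> closure hexablock"
  shows "(cmod a)\<^sup>2 + (cmod x1)\<^sup>2 \<le> 1" "(cmod a)\<^sup>2 + (cmod x2)\<^sup>2 \<le> 1" "cmod x3 \<le> 1"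
proof -
  let ?C = "{q. (cmod (fst q))\<^sup>2 + (cmod (fst (snd q)))\<^sup>2 \<le> 1} \<inter>
    {q. (cmod (fst q))\<^sup>2 + (cmod (fst (snd (snd q))))\<^sup>2 \<le> 1} \<inter> {q :: complex quad. cmod (snd (snd (snd q))) \<le> 1}"
  have "closed ?C" by (intro closed_Int closed_Collect_le continuous_intros)
  moreover have "hexablock \<subseteq> ?C" using hexablock_bounds by auto
  ultimately have "closure hexablock \<subseteq> ?C" by (rule closure_minimal[rotated])
  then show "(cmod a)\<^sup>2 + (cmod x1)\<^sup>2 \<le> 1" "(cmod a)\<^sup>2 + (cmod x2)\<^sup>2 \<le> 1" "cmod x3 \<le> 1"
    using assms by auto
qed

lemma hexa_param_torus:
  assumes ab: "cmod \<alpha> < 1" "cmod \<beta> < 1" and st: "cmod s = 1" "cmod t = 1"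
  shows "hexa_param \<alpha> \<beta> s t \<in> hexa_boundary"
proof -
  obtain a x1 x2 x3 where q: "hexa_param \<alpha> \<beta> s t = (a, x1, x2, x3)" by (cases "hexa_param \<alpha> \<beta> s t")
  define k where "k = 1 + t * \<alpha> * \<beta>"
  have k: "k \<noteq> 0" using hexa_denom_neq_0[of \<alpha> \<beta> t] ab st by (simp add: k_def)
  note n = hexa_param_norms[OF ab eq_refl[OF st(2)] q, folded k_def]
  have "1 - (cmod a)\<^sup>2 - (cmod x1)\<^sup>2 = 0" using n(1) k st by simp
  then have 1: "(cmod a)\<^sup>2 + (cmod x1)\<^sup>2 = 1" by simp
  have "1 - (cmod x3)\<^sup>2 = 0" using n(2) k st by simp
  then have 3: "cmod x3 = 1" by (simp add: power2_eq_1_iff) (use norm_ge_zero[of x3] in linarith)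
  have tt: "t * cnj t = 1" using st complex_norm_square[of t] by simp
  have ck: "cnj k = 1 + cnj t * cnj \<alpha> * cnj \<beta>" by (simp add: k_def)
  have "(\<beta> + cnj t * cnj \<alpha>) * (cnj \<alpha> * cnj \<beta> + t) = (cnj \<alpha> + t * \<beta>) * cnj k"
    unfolding ck using tt by algebra
  moreover have "x1 = (cnj \<alpha> + t * \<beta>) / k" "cnj x2 = (\<beta> + cnj t * cnj \<alpha>) / cnj k" "x3 = (cnj \<alpha> * cnj \<beta> + t) / k"
    using q by (auto simp: hexa_param_def k_def)
  ultimately have "x1 = cnj x2 * x3" using k by simp
  with 1 3 show ?thesis by (simp add: q hexa_boundary_def)
qed

text \<open>A point of the set with \<open>|x\<^sub>1| < 1\<close> is \<open>hexa_param (cnj x\<^sub>1) 0 s x\<^sub>3\<close> with \<open>|s| = 1\<close>. Shrinking the three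
    parameters by
  \<open>r < 1\<close> gives points of the hexablock, which converge to it as \<open>r \<rightarrow> 1\<close>, also when \<open>|x\<^sub>1| = 1\<close>.\<close>

lemma hexa_boundary_subset_closure: "hexa_boundary \<subseteq> closure hexablock"
proof
  fix p assume "p \<in> hexa_boundary"
  then obtain a x1 x2 x3 where p: "p = (a, x1, x2, x3)" and x3: "cmod x3 = 1"
    and x1: "x1 = cnj x2 * x3" and a: "(cmod a)\<^sup>2 + (cmod x1)\<^sup>2 = 1"
    by (auto simp: hexa_boundary_def)
  define r where "r n = 1 - 1 / real (n + 2)" for n
  have r: "0 < r n" "r n < 1" for n by (auto simp: r_def field_simps)
  have rl: "r \<longlonglongrightarrow> 1" unfolding r_def by real_asymp
  have le1: "cmod x1 \<le> 1"
  proof (rule power2_le_imp_le)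
    show "(cmod x1)\<^sup>2 \<le> 1\<^sup>2" unfolding one_power2 using a zero_le_power2[of "cmod a"] by linarith
  qed simp
  have lt: "cmod (of_real (r n) * z) < 1" if "cmod z \<le> 1" for n z
  proof -
    have "cmod (of_real (r n) * z) = r n * cmod z" using r(1)[of n] by (simp add: norm_mult)
    also have "\<dots> \<le> r n * 1" using that r(1)[of n] by (intro mult_left_mono) auto
    also have "\<dots> < 1" using r(2) by simp
    finally show ?thesis .
  qed
  have sg: "cmod (sgn a) \<le> 1" by (simp add: norm_sgn)
  define q where "q n = hexa_param (cnj (of_real (r n) * x1)) 0 (of_real (r n) * sgn a) (of_real (r n) * x3)" for n
  have "q n \<in> hexablock" for n
    unfolding q_def by (rule hexa_param_in) (use lt sg le1 x3 in auto)
  then have qc: "q n \<in> closure hexablock" for n by (rule subsetD[OF closure_subset])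
  have "q = (\<lambda>n. (of_real (r n) * sgn a * of_real (sqrt (1 - (cmod (of_real (r n) * x1))\<^sup>2)),
      of_real (r n) * x1, of_real (r n) * x3 * cnj (of_real (r n) * x1), of_real (r n) * x3))"
    by (rule ext) (simp add: q_def hexa_param_def norm_mult)
  also have "\<dots> \<longlonglongrightarrow> (of_real 1 * sgn a * of_real (sqrt (1 - (cmod (of_real 1 * x1))\<^sup>2)),
      of_real 1 * x1, of_real 1 * x3 * cnj (of_real 1 * x1), of_real 1 * x3)"
    by (intro tendsto_intros rl)
  also have "(of_real 1 * sgn a * of_real (sqrt (1 - (cmod (of_real 1 * x1))\<^sup>2)),
      of_real 1 * x1, of_real 1 * x3 * cnj (of_real 1 * x1), of_real 1 * x3) = p"
  proof -
    have "1 - (cmod x1)\<^sup>2 = (cmod a)\<^sup>2" using a by simp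
    then have "sgn a * of_real (sqrt (1 - (cmod x1)\<^sup>2)) = a"
      by (simp add: sgn_eq)
    moreover have "x3 * cnj x1 = x2"
      using complex_norm_square[of x3] x3 by (simp add: x1 mult.left_commute mult.commute[of x3])
    ultimately show ?thesis by (simp add: p)
  qed
  finally show "p \<in> closure hexablock" using qc by (rule closed_sequentially[OF closed_closure, rotated])
qed

lemma compact_hexa_boundary: "compact hexa_boundary"
proof -
  have eq: "hexa_boundary = {q. cmod (snd (snd (snd q))) = 1} \<inter>
      {q. fst (snd q) = cnj (fst (snd (snd q))) * snd (snd (snd q))} \<inter>
      {q. (cmod (fst q))\<^sup>2 + (cmod (fst (snd q)))\<^sup>2 = 1}"
    by (auto simp: hexa_boundary_def)
  have "closed hexa_boundary"
    unfolding eq by (intro closed_Int closed_Collect_eq continuous_intros)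
  moreover have "hexa_boundary \<subseteq> cball 0 1 \<times> cball 0 1 \<times> cball 0 1 \<times> cball 0 1"
  proof
    fix q assume "q \<in> hexa_boundary"
    then obtain a x1 x2 x3 where q: "q = (a, x1, x2, x3)" "(a, x1, x2, x3) \<in> hexa_boundary"
      by (cases q) auto
    note b = closure_hexablock_bounds[OF subsetD[OF hexa_boundary_subset_closure q(2)]]
    have "(cmod a)\<^sup>2 \<le> 1" "(cmod x1)\<^sup>2 \<le> 1" "(cmod x2)\<^sup>2 \<le> 1"
      using b(1,2) zero_le_power2[of "cmod a"] zero_le_power2[of "cmod x1"] zero_le_power2[of "cmod x2"] by linarith+
    then show "q \<in> cball 0 1 \<times> cball 0 1 \<times> cball 0 1 \<times> cball 0 1"
      using b(3) q(1) by (simp add: abs_square_le_1)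
  qed
  then have "bounded hexa_boundary" by (rule bounded_subset[rotated]) (intro bounded_Times bounded_cball)
  ultimately show ?thesis by (simp add: compact_eq_bounded_closed)
qed

text \<open>Holomorphy is available only in the open bidisc. So the one-variable principle is applied on the circles of
  radius \<open>r < 1\<close>, where uniform continuity bounds \<open>F\<close> by its values on the torus up to an error.\<close>

lemma bidisc_maximum_modulus:
  fixes F :: "complex \<times> complex \<Rightarrow> complex"
  assumes cont: "continuous_on (cball 0 1 \<times> cball 0 1) F"
    and hol1: "\<And>t. cmod t < 1 \<Longrightarrow> (\<lambda>s. F (s, t)) holomorphic_on ball 0 1"
    and hol2: "\<And>s. cmod s < 1 \<Longrightarrow> (\<lambda>t. F (s, t)) holomorphic_on ball 0 1"
    and torus: "\<And>s t. cmod s = 1 \<Longrightarrow> cmod t = 1 \<Longrightarrow> cmod (F (s, t)) \<le> M"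
    and st: "cmod s < 1" "cmod t < 1"
  shows "cmod (F (s, t)) \<le> M"
proof (rule field_le_epsilon)
  fix e :: real assume e: "e > 0"
  have "uniformly_continuous_on (cball 0 1 \<times> cball 0 1) F"
    by (intro compact_uniformly_continuous cont compact_Times compact_cball)
  then obtain \<delta> where \<delta>: "\<delta> > 0" "\<And>p p'. p \<in> cball 0 1 \<times> cball 0 1 \<Longrightarrow> p' \<in> cball 0 1 \<times> cball 0 1 \<Longrightarrow>
      dist p' p < \<delta> \<Longrightarrow> dist (F p') (F p) < e"
    using e unfolding uniformly_continuous_on_def by metis
  define m where "m = max (max (cmod s) (cmod t)) (1 - \<delta> / 4)"
  have m: "m < 1" using st \<delta> by (simp add: m_def)
  define r where "r = (max m 0 + 1) / 2"
  have r: "0 < r" "r < 1" "cmod s < r" "cmod t < r" "1 - \<delta> / 4 < r"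
    using m st \<delta> by (auto simp: r_def m_def)
  have small: "cmod (F (s', t')) \<le> M + e" if "cmod s' = r" "cmod t' = r" for s' t'
  proof -
    let ?s = "s' / of_real r" and ?t = "t' / of_real r"
    have n: "cmod ?s = 1" "cmod ?t = 1" using that r by (auto simp: norm_divide)
    have d1: "dist (of_real r * u) u \<le> \<delta> / 4" if "cmod u = 1" for u :: complex
    proof -
      have "of_real r * u - u = of_real (r - 1) * u" by (simp add: algebra_simps)
      then have "dist (of_real r * u) u = \<bar>r - 1\<bar> * cmod u" by (simp only: dist_norm norm_mult norm_of_real)
      then show ?thesis using that r by simp
    qed
    have "dist (s', t') (?s, ?t) \<le> dist s' ?s + dist t' ?t"
      unfolding dist_Pair_Pair by (rule sqrt_sum_squares_le_sum) auto
    also have "\<dots> \<le> \<delta> / 4 + \<delta> / 4" using d1[OF n(1)] d1[OF n(2)] r by (intro add_mono) auto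
    also have "\<dots> < \<delta>" using \<delta> by simp
    finally have "dist (F (s', t')) (F (?s, ?t)) < e" by (intro \<delta>(2)) (use n that r in auto)
    then show ?thesis using torus[OF n] norm_triangle_ineq2[of "F (s', t')" "F (?s, ?t)"] by (simp add: dist_norm)
  qed
  have sub: "ball 0 r \<subseteq> ball (0::complex) 1" "cball 0 r \<subseteq> ball (0::complex) 1" using r by auto
  have 1: "cmod (F (s', t)) \<le> M + e" if "cmod s' = r" for s'
  proof (rule maximum_modulus_frontier[of "\<lambda>t. F (s', t)" "cball 0 r" "M + e" t])
    have h: "(\<lambda>t. F (s', t)) holomorphic_on ball 0 1" by (rule hol2) (use that r in simp)
    then show "(\<lambda>t. F (s', t)) holomorphic_on interior (cball 0 r)"
      using sub by (auto intro: holomorphic_on_subset)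
    show "continuous_on (closure (cball 0 r)) (\<lambda>t. F (s', t))"
      using holomorphic_on_imp_continuous_on[OF h] sub by (auto intro: continuous_on_subset)
  qed (use small that r in auto)
  show "cmod (F (s, t)) \<le> M + e"
  proof (rule maximum_modulus_frontier[of "\<lambda>s. F (s, t)" "cball 0 r" "M + e" s])
    have h: "(\<lambda>s. F (s, t)) holomorphic_on ball 0 1" by (rule hol1[OF st(2)])
    then show "(\<lambda>s. F (s, t)) holomorphic_on interior (cball 0 r)"
      using sub by (auto intro: holomorphic_on_subset)
    show "continuous_on (closure (cball 0 r)) (\<lambda>s. F (s, t))"
      using holomorphic_on_imp_continuous_on[OF h] sub by (auto intro: continuous_on_subset)
  qed (use 1 r in auto)
qed

lemma holomorphic_quad_compose:
  assumes f: "holomorphic_quad U f" and in_U: "(g0 z, g1 z, g2 z, g3 z) \<in> U"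
    and g: "g0 field_differentiable at z" "g1 field_differentiable at z" "g2 field_differentiable at z"
        "g3 field_differentiable at z"
  shows "(\<lambda>z. f (g0 z, g1 z, g2 z, g3 z)) field_differentiable at z"
proof -
  obtain c0 c1 c2 c3 where c: "(f has_derivative (\<lambda>(a, x1, x2, x3). c0 * a + c1 * x1 + c2 * x2 + c3 * x3))
      (at (g0 z, g1 z, g2 z, g3 z))"
    using f in_U unfolding holomorphic_quad_def by blast
  obtain d0 d1 d2 d3 where d: "(g0 has_field_derivative d0) (at z)" "(g1 has_field_derivative d1) (at z)"
      "(g2 has_field_derivative d2) (at z)" "(g3 has_field_derivative d3) (at z)"
    using g unfolding field_differentiable_def by blast
  have "((\<lambda>z. (g0 z, g1 z, g2 z, g3 z)) has_derivative (\<lambda>h. (d0 * h, d1 * h, d2 * h, d3 * h))) (at z)"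
    using d unfolding has_field_derivative_def by (intro has_derivative_Pair)
  from has_derivative_compose[OF this c]
  have "((\<lambda>z. f (g0 z, g1 z, g2 z, g3 z)) has_derivative (\<lambda>h. c0 * (d0 * h) + c1 * (d1 * h) + c2 * (d2 * h) + c3
      * (d3 * h))) (at z)"
    by simp
  also have "(\<lambda>h. c0 * (d0 * h) + c1 * (d1 * h) + c2 * (d2 * h) + c3 * (d3 * h)) =
      (\<lambda>h. (c0 * d0 + c1 * d1 + c2 * d2 + c3 * d3) * h)"
    by (auto simp: algebra_simps)
  finally show ?thesis unfolding field_differentiable_def has_field_derivative_def by blast
qed

text \<open>Every point of the hexablock lies on a bidisc whose torus is in \<open>hexa_boundary\<close>.\<close>

lemma hexa_boundary_maximum_modulus:
  assumes cont: "continuous_on (closure hexablock) f" and hol: "holomorphic_quad hexablock f"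
    and M: "\<And>q. q \<in> hexa_boundary \<Longrightarrow> cmod (f q) \<le> M" and q: "q \<in> hexablock"
  shows "cmod (f q) \<le> M"
proof -
  obtain \<alpha> \<beta> s t where ab: "cmod \<alpha> < 1" "cmod \<beta> < 1" and st: "cmod s < 1" "cmod t < 1"
    and q_eq: "q = hexa_param \<alpha> \<beta> s t"
    using hexa_param_surj[OF q] by metis
  define F where "F = (\<lambda>p. f (hexa_param \<alpha> \<beta> (fst p) (snd p)))"
  have k0: "1 + t * \<alpha> * \<beta> \<noteq> 0" if "cmod t \<le> 1" for t by (rule hexa_denom_neq_0[OF ab that])
  let ?B = "cball (0::complex) 1 \<times> cball (0::complex) 1"
  have contp: "continuous_on ?B (\<lambda>p. hexa_param \<alpha> \<beta> (fst p) (snd p))"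
    unfolding hexa_param_def by (intro continuous_intros) (auto simp: k0)
  have "closure (ball (0::complex) 1 \<times> ball (0::complex) 1) = ?B" by (simp add: closure_Times)
  moreover have "(\<lambda>p. hexa_param \<alpha> \<beta> (fst p) (snd p)) ` (ball 0 1 \<times> ball 0 1) \<subseteq> closure hexablock"
  proof (rule image_subsetI)
    fix p :: "complex \<times> complex" assume "p \<in> ball 0 1 \<times> ball 0 1"
    then have "hexa_param \<alpha> \<beta> (fst p) (snd p) \<in> hexablock" by (intro hexa_param_in ab) auto
    then show "hexa_param \<alpha> \<beta> (fst p) (snd p) \<in> closure hexablock" by (rule subsetD[OF closure_subset])
  qed
  ultimately have "(\<lambda>p. hexa_param \<alpha> \<beta> (fst p) (snd p)) ` ?B \<subseteq> closure hexablock"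
    using image_closure_subset[of "ball 0 1 \<times> ball 0 1" "\<lambda>p. hexa_param \<alpha> \<beta> (fst p) (snd p)" "closure hexablock"]
      contp by simp
  then have "continuous_on ?B F"
    unfolding F_def by (rule continuous_on_compose2[OF cont contp])
  moreover have "(\<lambda>s. F (s, t)) holomorphic_on ball 0 1" if "cmod t < 1" for t
    unfolding holomorphic_on_def
  proof
    fix s :: complex assume s: "s \<in> ball 0 1"
    have "(\<lambda>s. F (s, t)) field_differentiable at s"
      unfolding F_def hexa_param_def fst_conv snd_conv
      by (rule holomorphic_quad_compose[OF hol])
        (use hexa_param_in[OF ab _ that, of s] s in \<open>auto simp: hexa_param_def k0 that less_imp_le intro!:
            derivative_intros\<close>)
    then show "(\<lambda>s. F (s, t)) field_differentiable at s within ball 0 1"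
      by (rule field_differentiable_at_within)
  qed
  moreover have "(\<lambda>t. F (s, t)) holomorphic_on ball 0 1" if "cmod s < 1" for s
    unfolding holomorphic_on_def
  proof
    fix t :: complex assume t: "t \<in> ball 0 1"
    have "(\<lambda>t. F (s, t)) field_differentiable at t"
      unfolding F_def hexa_param_def fst_conv snd_conv
      by (rule holomorphic_quad_compose[OF hol])
        (use hexa_param_in[OF ab that, of t] t in \<open>auto simp: hexa_param_def k0 that less_imp_le intro!:
            derivative_intros\<close>)
    then show "(\<lambda>t. F (s, t)) field_differentiable at t within ball 0 1"
      by (rule field_differentiable_at_within)
  qed
  moreover have "cmod (F (s, t)) \<le> M" if "cmod s = 1" "cmod t = 1" for s t
    unfolding F_def by (rule M) (simp add: hexa_param_torus ab that)
  ultimately have "cmod (F (s, t)) \<le> M" by (rule bidisc_maximum_modulus) (use st in auto)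
  then show ?thesis by (simp add: F_def q_eq)
qed

lemma re_cinner2_le:
  fixes a x b y :: complex
  assumes "(cmod a)\<^sup>2 + (cmod x)\<^sup>2 \<le> 1" "(cmod b)\<^sup>2 + (cmod y)\<^sup>2 = 1"
  shows "cmod (cnj b * a + cnj y * x) \<le> 1"
    and "Re (cnj b * a + cnj y * x) = 1 \<Longrightarrow> a = b \<and> x = y"
proof -
  have "cmod (cnj b * a + cnj y * x) \<le> cmod b * cmod a + cmod y * cmod x"
    using norm_triangle_ineq[of "cnj b * a" "cnj y * x"] by (simp add: norm_mult)
  moreover have "2 * (cmod b * cmod a) \<le> (cmod a)\<^sup>2 + (cmod b)\<^sup>2" "2 * (cmod y * cmod x) \<le> (cmod x)\<^sup>2 + (cmod y)\<^sup>2"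
    using sum_squares_bound[of "cmod a" "cmod b"] sum_squares_bound[of "cmod x" "cmod y"] by (simp_all add: mult_ac)
  ultimately show "cmod (cnj b * a + cnj y * x) \<le> 1" using assms by linarith
  assume re: "Re (cnj b * a + cnj y * x) = 1"
  have "(cmod (a - b))\<^sup>2 + (cmod (x - y))\<^sup>2 =
      ((cmod a)\<^sup>2 + (cmod x)\<^sup>2) + ((cmod b)\<^sup>2 + (cmod y)\<^sup>2) - 2 * Re (cnj b * a + cnj y * x)"
    by (simp only: cmod_power2 complex_cnj minus_complex.simps plus_complex.simps times_complex.simps cnj.simps)
      (simp add: power2_eq_square algebra_simps)
  then have "(cmod (a - b))\<^sup>2 + (cmod (x - y))\<^sup>2 \<le> 0" using assms re by simp
  then have "(cmod (a - b))\<^sup>2 = 0" "(cmod (x - y))\<^sup>2 = 0"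
    using zero_le_power2[of "cmod (a - b)"] zero_le_power2[of "cmod (x - y)"] by linarith+
  then show "a = b \<and> x = y" by simp
qed

text \<open>Each point \<open>(b, y\<^sub>1, y\<^sub>2, y\<^sub>3)\<close> of the set is the unique peak of a polynomial of degree one: a sum of
  inner products of unit vectors \<open>(b, y\<^sub>1)\<close>, \<open>(b, y\<^sub>2)\<close>, \<open>y\<^sub>3\<close> with vectors of norm at most one.\<close>

lemma hexa_boundary_peak:
  assumes p: "p \<in> hexa_boundary"
  obtains f where "continuous_on UNIV f" "holomorphic_quad hexablock f"
    "\<And>q. q \<in> closure hexablock \<Longrightarrow> cmod (f p) \<le> cmod (f q) \<Longrightarrow> q = p"
proof -
  obtain b y1 y2 y3 where p_eq: "p = (b, y1, y2, y3)" and y3: "cmod y3 = 1"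
    and y1: "y1 = cnj y2 * y3" and b1: "(cmod b)\<^sup>2 + (cmod y1)\<^sup>2 = 1"
    using p by (auto simp: hexa_boundary_def)
  have b2: "(cmod b)\<^sup>2 + (cmod y2)\<^sup>2 = 1" using b1 y3 by (simp add: y1 norm_mult)
  define g where "g = (\<lambda>(a, x1, x2, x3). (cnj b * a + cnj y1 * x1) + (cnj b * a + cnj y2 * x2) + cnj y3 * x3)"
  define f where "f = (\<lambda>q. 3 + g q)"
  have f_eq: "f = (\<lambda>(a, x1, x2, x3). 3 + ((cnj b * a + cnj y1 * x1) + (cnj b * a + cnj y2 * x2) + cnj y3 * x3))"
    by (auto simp: f_def g_def)
  have "continuous_on UNIV f"
    unfolding f_eq case_prod_unfold by (intro continuous_intros)
  moreover have "holomorphic_quad hexablock f"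
    unfolding holomorphic_quad_def
  proof (intro ballI exI)
    fix q
    show "(f has_derivative (\<lambda>(a, x1, x2, x3). (2 * cnj b) * a + cnj y1 * x1 + cnj y2 * x2 + cnj y3 * x3)) (at q)"
      unfolding f_eq case_prod_unfold
      by (auto intro!: derivative_eq_intros simp: algebra_simps)
  qed
  moreover have "q = p" if q: "q \<in> closure hexablock" and le: "cmod (f p) \<le> cmod (f q)" for q
  proof -
    obtain a x1 x2 x3 where q_eq: "q = (a, x1, x2, x3)" by (cases q)
    note bd = closure_hexablock_bounds[OF q[unfolded q_eq]]
    let ?u = "cnj b * a + cnj y1 * x1" and ?v = "cnj b * a + cnj y2 * x2" and ?w = "cnj y3 * x3"
    have u: "cmod ?u \<le> 1" by (rule re_cinner2_le(1)[OF bd(1) b1])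
    have v: "cmod ?v \<le> 1" by (rule re_cinner2_le(1)[OF bd(2) b2])
    have w: "cmod ?w \<le> 1" using bd(3) y3 by (simp add: norm_mult)
    have "f p = 6"
    proof -
      have "complex_of_real ((cmod b)\<^sup>2 + (cmod y1)\<^sup>2) = 1" "complex_of_real ((cmod b)\<^sup>2 + (cmod y2)\<^sup>2) = 1"
          "complex_of_real ((cmod y3)\<^sup>2) = 1"
        using b1 b2 y3 by simp_all
      moreover have "f p = 3 + ((cnj b * b + cnj y1 * y1) + (cnj b * b + cnj y2 * y2) + cnj y3 * y3)"
        by (simp add: f_eq p_eq)
      ultimately show ?thesis unfolding of_real_add complex_norm_square by algebra
    qed
    then have 6: "6 \<le> cmod (3 + (?u + ?v + ?w))" using le by (simp add: f_eq q_eq)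
    have n: "cmod (?u + ?v + ?w) \<le> 3"
      using norm_triangle_ineq[of "?u + ?v" ?w] norm_triangle_ineq[of ?u ?v] u v w by linarith
    define G where "G = ?u + ?v + ?w"
    have "36 \<le> (cmod (3 + G))\<^sup>2" using 6 power_mono[of 6 "cmod (3 + G)" 2] by (simp add: G_def)
    moreover have "(cmod (3 + G))\<^sup>2 = 9 + 6 * Re G + (cmod G)\<^sup>2"
      unfolding cmod_power2 by (simp add: power2_eq_square algebra_simps)
    moreover have "(cmod G)\<^sup>2 \<le> 3\<^sup>2" using n by (intro power_mono) (auto simp: G_def)
    ultimately have "3 \<le> Re G" by simp
    moreover have "Re G = Re ?u + Re ?v + Re ?w" by (simp add: G_def)
    moreover have "Re ?u \<le> 1" "Re ?v \<le> 1" "Re ?w \<le> 1"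
      using u v w complex_Re_le_cmod order_trans by blast+
    ultimately have "Re ?u = 1" "Re ?v = 1" "Re ?w = 1" by linarith+
    moreover have "x3 = y3" if "Re ?w = 1"
      using re_cinner2_le(2)[of 0 x3 0 y3] bd(3) y3 that by (simp add: power_le_one)
    ultimately show ?thesis
      using re_cinner2_le(2)[OF bd(1) b1] re_cinner2_le(2)[OF bd(2) b2] by (simp add: p_eq q_eq)
  qed
  ultimately show thesis by (rule that)
qed

text \<open>Maximum modulus makes the set a boundary; peak functions force it into every boundary.\<close>

theorem distinguished_boundary_eq: "distinguished_boundary = hexa_boundary"
  unfolding distinguished_boundary_def
proof (rule Least_equality)
  show "closed hexa_boundary \<and> hexa_boundary \<subseteq> closure hexablock \<and>
      (\<forall>f. continuous_on (closure hexablock) f \<and> holomorphic_quad hexablock f \<longrightarrow>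
        (\<exists>q\<in>hexa_boundary. \<forall>r\<in>closure hexablock. cmod (f r) \<le> cmod (f q)))"
  proof (intro conjI allI impI hexa_boundary_subset_closure compact_imp_closed[OF compact_hexa_boundary], elim conjE)
    fix f assume cont: "continuous_on (closure hexablock) f" and hol: "holomorphic_quad hexablock f"
    have "(1, 0, 0, 1) \<in> hexa_boundary" by (simp add: hexa_boundary_def)
    moreover have "continuous_on hexa_boundary (\<lambda>q. cmod (f q))"
      by (intro continuous_on_norm continuous_on_subset[OF cont] hexa_boundary_subset_closure)
    ultimately obtain q where q: "q \<in> hexa_boundary" "\<And>r. r \<in> hexa_boundary \<Longrightarrow> cmod (f r) \<le> cmod (f q)"
      using continuous_attains_sup[OF compact_hexa_boundary] by blast
    have "cmod (f r) \<le> cmod (f q)" if r: "r \<in> closure hexablock" for r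
    proof (rule continuous_le_on_closure[of hexablock "\<lambda>r. cmod (f r)", OF _ r])
      show "continuous_on (closure hexablock) (\<lambda>r. cmod (f r))" by (intro continuous_on_norm cont)
    qed (rule hexa_boundary_maximum_modulus[OF cont hol q(2)])
    with q(1) show "\<exists>q\<in>hexa_boundary. \<forall>r\<in>closure hexablock. cmod (f r) \<le> cmod (f q)" by blast
  qed
next
  fix K :: "complex quad set"
  assume K: "closed K \<and> K \<subseteq> closure hexablock \<and>
      (\<forall>f. continuous_on (closure hexablock) f \<and> holomorphic_quad hexablock f \<longrightarrow>
        (\<exists>q\<in>K. \<forall>r\<in>closure hexablock. cmod (f r) \<le> cmod (f q)))"
  show "hexa_boundary \<subseteq> K"
  proof
    fix p assume p: "p \<in> hexa_boundary"
    obtain f where f: "continuous_on UNIV f" "holomorphic_quad hexablock f"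
      "\<And>q. q \<in> closure hexablock \<Longrightarrow> cmod (f p) \<le> cmod (f q) \<Longrightarrow> q = p"
      using hexa_boundary_peak[OF p] by blast
    have "continuous_on (closure hexablock) f" by (rule continuous_on_subset[OF f(1)]) simp
    then obtain q where q: "q \<in> K" "\<forall>r\<in>closure hexablock. cmod (f r) \<le> cmod (f q)"
      using K f(2) by blast
    then have "q = p" using K p hexa_boundary_subset_closure by (intro f(3)) auto
    with q(1) show "p \<in> K" by simp
  qed
qed

section \<open>Exactness of the Koszul complex\<close>

text \<open>The sign of moving \<open>e\<^sub>i\<close> to its place in \<open>e\<^sub>I\<close>. The next lemmas express that \<open>e\<^sub>i\<close> and \<open>e\<^sub>j\<close> anticommute, and
  that \<open>e\<^sub>i\<close> anticommutes with the contraction against \<open>e\<^sub>j\<close> for \<open>i \<noteq> j\<close>.\<close>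

definition koszul_sign :: "nat \<Rightarrow> nat set \<Rightarrow> real"
  where "koszul_sign i I = (- 1) ^ card {j\<in>I. j < i}"

lemma koszul_sign_square [simp]: "koszul_sign i I * koszul_sign i I = 1"
  by (simp add: koszul_sign_def flip: power_mult_distrib)

lemma koszul_sign_insert:
  assumes "finite I" "k \<notin> I"
  shows "koszul_sign i (insert k I) = (if k < i then - koszul_sign i I else koszul_sign i I)"
proof (cases "k < i")
  case True
  have "{j \<in> insert k I. j < i} = insert k {j\<in>I. j < i}" using True by auto
  then show ?thesis using assms True by (simp add: koszul_sign_def)
next
  case False
  then have "{j \<in> insert k I. j < i} = {j\<in>I. j < i}" by auto
  then show ?thesis using False by (simp add: koszul_sign_def)
qed

lemma koszul_sign_swap:
  assumes "finite I" "i \<in> I" "j \<in> I" "i \<noteq> j"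
  shows "koszul_sign j I * koszul_sign i (I - {j}) = - (koszul_sign i I * koszul_sign j (I - {i}))"
proof -
  define J where "J = I - {i, j}"
  have J: "finite J" "i \<notin> J" "j \<notin> J" "I = insert i (insert j J)" "I - {i} = insert j J" "I - {j} = insert i J"
    using assms by (auto simp: J_def)
  have n: "i \<notin> insert j J" using J assms by simp
  show ?thesis unfolding J(5,6) unfolding J(4)
    using J(1-3) n assms(4) by (auto simp: koszul_sign_insert)
qed

lemma koszul_sign_move:
  assumes "finite I" "i \<in> I" "j \<notin> I"
  shows "koszul_sign i I * koszul_sign j (insert j (I - {i})) =
    - (koszul_sign j (insert j I) * koszul_sign i (insert j I))"
proof -
  define J where "J = I - {i}"
  have J: "finite J" "i \<notin> J" "j \<notin> J" "I = insert i J" "i \<noteq> j" using assms by (auto simp: J_def)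
  have n: "j \<notin> insert i J" using J by simp
  have "insert i J - {i} = J" using J by auto
  then show ?thesis unfolding J(4) using J(1-3,5) n by (auto simp: koszul_sign_insert)
qed

lemma koszul_diff_eq:
  "I \<subseteq> {..<length Ts} \<Longrightarrow> koszul_diff Ts f I = (\<Sum>i\<in>I. koszul_sign i I *\<^sub>R (Ts ! i) (f (I - {i})))"
  by (simp add: koszul_diff_def koszul_sign_def)

lemma koszul_diff_in_chains:
  assumes S: "csubspace S" and T: "\<And>i x. i < length Ts \<Longrightarrow> x \<in> S \<Longrightarrow> (Ts ! i) x \<in> S"
    and f: "f \<in> koszul_chains S (length Ts)"
  shows "koszul_diff Ts f \<in> koszul_chains S (length Ts)"
proof -
  have "koszul_diff Ts f I \<in> S" if I: "I \<subseteq> {..<length Ts}" for I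
    unfolding koszul_diff_eq[OF I]
  proof (intro csubspace_sum[OF S] csubspace_scaleR[OF S] T)
    fix i assume "i \<in> I"
    then show "i < length Ts" using I by auto
    have "I - {i} \<subseteq> {..<length Ts}" using I by auto
    then show "f (I - {i}) \<in> S" using f by (simp add: koszul_chains_def)
  qed
  then show ?thesis by (simp add: koszul_chains_def koszul_diff_def)
qed

text \<open>In the double sum the terms of \<open>(i, j)\<close> and \<open>(j, i)\<close> cancel.\<close>

lemma koszul_diff_diff:
  assumes S: "csubspace S" and T: "\<And>i x. i < length Ts \<Longrightarrow> x \<in> S \<Longrightarrow> (Ts ! i) x \<in> S"
    and lin: "\<And>i. i < length Ts \<Longrightarrow> clinear_on S (Ts ! i)"
    and comm: "\<And>i j x. i < length Ts \<Longrightarrow> j < length Ts \<Longrightarrow> x \<in> S \<Longrightarrow> (Ts ! i) ((Ts ! j) x) = (Ts ! j) ((Ts ! i) x)"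
    and f: "f \<in> koszul_chains S (length Ts)"
  shows "koszul_diff Ts (koszul_diff Ts f) = (\<lambda>I. 0)"
proof
  fix I
  show "koszul_diff Ts (koszul_diff Ts f) I = 0"
  proof (cases "I \<subseteq> {..<length Ts}")
    case I: True
    have fin: "finite I" using I finite_subset by blast
    have fS: "f J \<in> S" if "J \<subseteq> I" for J using f I that by (auto simp: koszul_chains_def)
    have lt: "i < length Ts" if "i \<in> I" for i using I that by auto
    define g where "g i j = (if i = j then 0 else
      (koszul_sign i I * koszul_sign j (I - {i})) *\<^sub>R (Ts ! i) ((Ts ! j) (f (I - {i, j}))))" for i j
    have "koszul_diff Ts (koszul_diff Ts f) I = (\<Sum>i\<in>I. \<Sum>j\<in>I. g i j)"
      unfolding koszul_diff_eq[OF I]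
    proof (rule sum.cong[OF refl])
      fix i assume i: "i \<in> I"
      have sub: "I - {i} \<subseteq> {..<length Ts}" using I by auto
      have in_S: "koszul_sign j (I - {i}) *\<^sub>R (Ts ! j) (f (I - {i} - {j})) \<in> S" if "j \<in> I - {i}" for j
        using that by (intro csubspace_scaleR[OF S] T lt fS) auto
      have "koszul_sign i I *\<^sub>R (Ts ! i) (koszul_diff Ts f (I - {i})) =
          (\<Sum>j\<in>I - {i}. koszul_sign i I *\<^sub>R (Ts ! i) (koszul_sign j (I - {i}) *\<^sub>R (Ts ! j) (f (I - {i} - {j}))))"
        unfolding koszul_diff_eq[OF sub] scaleR_sum_right[symmetric]
        by (rule arg_cong[of _ _ "(*\<^sub>R) _"], rule clinear_on_sum[OF lin[OF lt[OF i]] S in_S])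
      also have "\<dots> = (\<Sum>j\<in>I - {i}. g i j)"
      proof (rule sum.cong[OF refl])
        fix j assume j: "j \<in> I - {i}"
        have "(Ts ! j) (f (I - {i} - {j})) \<in> S" using j by (intro T lt fS) auto
        moreover have "I - {i} - {j} = I - {i, j}" by auto
        ultimately show "koszul_sign i I *\<^sub>R (Ts ! i) (koszul_sign j (I - {i}) *\<^sub>R (Ts ! j) (f (I - {i} - {j}))) =
            g i j"
          using j clinear_on_scaleR[OF lin[OF lt[OF i]]] by (auto simp: g_def)
      qed
      also have "\<dots> = (\<Sum>j\<in>I. g i j)"
        using fin i by (intro sum.mono_neutral_left) (auto simp: g_def)
      finally show "koszul_sign i I *\<^sub>R (Ts ! i) (koszul_diff Ts f (I - {i})) = (\<Sum>j\<in>I. g i j)" .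
    qed
    moreover have "(\<Sum>i\<in>I. \<Sum>j\<in>I. g i j) = - (\<Sum>i\<in>I. \<Sum>j\<in>I. g i j)"
    proof -
      have "(\<Sum>i\<in>I. \<Sum>j\<in>I. g i j) = (\<Sum>j\<in>I. \<Sum>i\<in>I. g i j)" by (rule sum.swap)
      also have "\<dots> = (\<Sum>j\<in>I. \<Sum>i\<in>I. - g j i)"
      proof (intro sum.cong refl)
        fix i j assume ij: "i \<in> I" "j \<in> I"
        have "f (I - {i, j}) \<in> S" by (rule fS) auto
        moreover have "{i, j} = {j, i}" by auto
        ultimately show "g i j = - g j i"
          using koszul_sign_swap[OF fin ij] comm[OF lt[OF ij(1)] lt[OF ij(2)], of "f (I - {i, j})"]
          by (auto simp: g_def)
      qed
      finally show ?thesis by (simp add: sum_negf)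
    qed
    ultimately have "koszul_diff Ts (koszul_diff Ts f) I = - koszul_diff Ts (koszul_diff Ts f) I"
      by (simp only:)
    then have "2 *\<^sub>R koszul_diff Ts (koszul_diff Ts f) I = 0"
      unfolding scaleR_2 by (simp add: eq_neg_iff_add_eq_0)
    then show ?thesis by simp
  qed (simp add: koszul_diff_def)
qed

text \<open>Contraction against the \<open>R\<^sub>i\<close> is a null homotopy of the complex when \<open>\<Sum>i. T\<^sub>i R\<^sub>i = 1\<close>.\<close>

lemma taylor_nonsingularI:
  assumes S: "csubspace S" and n: "n = length Ts"
    and T: "\<And>i x. i < n \<Longrightarrow> x \<in> S \<Longrightarrow> (Ts ! i) x \<in> S"
    and R: "\<And>i x. i < n \<Longrightarrow> x \<in> S \<Longrightarrow> R i x \<in> S"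
    and linT: "\<And>i. i < n \<Longrightarrow> clinear_on S (Ts ! i)"
    and linR: "\<And>i. i < n \<Longrightarrow> clinear_on S (R i)"
    and comm: "\<And>i j x. i < n \<Longrightarrow> j < n \<Longrightarrow> x \<in> S \<Longrightarrow> (Ts ! i) ((Ts ! j) x) = (Ts ! j) ((Ts ! i) x)"
    and commR: "\<And>i j x. i < n \<Longrightarrow> j < n \<Longrightarrow> x \<in> S \<Longrightarrow> (Ts ! i) (R j x) = R j ((Ts ! i) x)"
    and one: "\<And>x. x \<in> S \<Longrightarrow> (\<Sum>i<n. (Ts ! i) (R i x)) = x"
  shows "taylor_nonsingular S Ts"
  unfolding taylor_nonsingular_def
proof (intro subset_antisym subsetI)
  fix f assume "f \<in> koszul_diff Ts ` koszul_chains S (length Ts)"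
  then show "f \<in> {f \<in> koszul_chains S (length Ts). koszul_diff Ts f = (\<lambda>I. 0)}"
    using koszul_diff_in_chains[OF S T] koszul_diff_diff[OF S T linT comm] unfolding n by auto
next
  fix f assume "f \<in> {f \<in> koszul_chains S (length Ts). koszul_diff Ts f = (\<lambda>I. 0)}"
  then have f: "f \<in> koszul_chains S n" and df: "\<And>I. koszul_diff Ts f I = 0" unfolding n by (auto simp: fun_eq_iff)
  have fS: "f I \<in> S" if "I \<subseteq> {..<n}" for I using f that by (simp add: koszul_chains_def)
  define g where "g I = (if I \<subseteq> {..<n} then \<Sum>j\<in>{..<n} - I. koszul_sign j (insert j I) *\<^sub>R R j (f (insert j I))
      else 0)" for I
  have gterm: "koszul_sign j (insert j I) *\<^sub>R R j (f (insert j I)) \<in> S" if "I \<subseteq> {..<n}" "j < n" for I j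
    using that by (intro csubspace_scaleR[OF S] R fS) auto
  have g: "g \<in> koszul_chains S n"
    unfolding koszul_chains_def by (auto simp: g_def intro!: csubspace_sum[OF S] gterm)
  have "koszul_diff Ts g = f"
  proof
    fix I
    show "koszul_diff Ts g I = f I"
    proof (cases "I \<subseteq> {..<n}")
      case I: True
      have fin: "finite I" using I finite_subset by blast
      have lt: "i < n" if "i \<in> I" for i using I that by auto
      define h where "h i j = (koszul_sign j (insert j I) * koszul_sign i (insert j I)) *\<^sub>R
        R j ((Ts ! i) (f (insert j I - {i})))" for i j
      have dg: "koszul_sign i I *\<^sub>R (Ts ! i) (g (I - {i})) = (Ts ! i) (R i (f I)) - (\<Sum>j\<in>{..<n} - I. h i j)"
        if i: "i \<in> I" for i
      proof -
        have sub: "I - {i} \<subseteq> {..<n}" using I by auto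
        have split: "{..<n} - (I - {i}) = insert i ({..<n} - I)" using i lt by auto
        have ins: "insert i (I - {i}) = I" using i by auto
        have "(Ts ! i) (g (I - {i})) =
            (\<Sum>j\<in>{..<n} - (I - {i}). (Ts ! i) (koszul_sign j (insert j (I - {i})) *\<^sub>R R j (f (insert j (I - {i})))))"
          unfolding g_def if_P[OF sub]
          by (rule clinear_on_sum[OF linT[OF lt[OF i]] S], rule gterm[OF sub]) simp
        also have "\<dots> = (\<Sum>j\<in>{..<n} - (I - {i}). koszul_sign j (insert j (I - {i})) *\<^sub>R (Ts ! i) (R j (f (insert j
            (I - {i})))))"
        proof (intro sum.cong refl clinear_on_scaleR[OF linT[OF lt[OF i]]])
          fix j assume "j \<in> {..<n} - (I - {i})"
          then show "R j (f (insert j (I - {i}))) \<in> S" using I by (intro R fS) auto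
        qed
        also have "\<dots> = koszul_sign i I *\<^sub>R (Ts ! i) (R i (f I)) +
            (\<Sum>j\<in>{..<n} - I. koszul_sign j (insert j (I - {i})) *\<^sub>R (Ts ! i) (R j (f (insert j (I - {i})))))"
          unfolding split using i ins by simp
        finally have "koszul_sign i I *\<^sub>R (Ts ! i) (g (I - {i})) = (Ts ! i) (R i (f I)) +
            (\<Sum>j\<in>{..<n} - I. (koszul_sign i I * koszul_sign j (insert j (I - {i}))) *\<^sub>R (Ts ! i) (R j (f (insert j
                (I - {i})))))"
          by (simp add: scaleR_add_right scaleR_sum_right)
        also have "(\<Sum>j\<in>{..<n} - I. (koszul_sign i I * koszul_sign j (insert j (I - {i}))) *\<^sub>R (Ts ! i) (R j (f
            (insert j (I - {i}))))) =
            (\<Sum>j\<in>{..<n} - I. - h i j)"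
        proof (rule sum.cong[OF refl])
          fix j assume j: "j \<in> {..<n} - I"
          have "insert j I - {i} = insert j (I - {i})" using i j by auto
          moreover have "f (insert j (I - {i})) \<in> S" using I j by (intro fS) auto
          ultimately show "(koszul_sign i I * koszul_sign j (insert j (I - {i}))) *\<^sub>R (Ts ! i) (R j (f (insert j
              (I - {i})))) = - h i j"
            using koszul_sign_move[OF fin i, of j] commR[OF lt[OF i], of j "f (insert j (I - {i}))"] j
                by (simp add: h_def)
        qed
        finally show ?thesis by (simp add: sum_negf)
      qed
      have hsum: "(\<Sum>i\<in>I. h i j) = - R j ((Ts ! j) (f I))" if j: "j \<in> {..<n} - I" for j
      proof -
        have jn: "j < n" using j by simp
        have sub: "insert j I \<subseteq> {..<length Ts}" using I j n by auto
        have in_S: "koszul_sign i (insert j I) *\<^sub>R (Ts ! i) (f (insert j I - {i})) \<in> S" if "i \<in> insert j I" for i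
          using that I j by (intro csubspace_scaleR[OF S] T fS) auto
        have Rlin: "R j (koszul_sign i (insert j I) *\<^sub>R (Ts ! i) (f (insert j I - {i}))) =
            koszul_sign i (insert j I) *\<^sub>R R j ((Ts ! i) (f (insert j I - {i})))" if "i \<in> insert j I" for i
          using that I j by (intro clinear_on_scaleR[OF linR[OF jn]] T fS) auto
        have "0 = koszul_sign j (insert j I) *\<^sub>R R j (koszul_diff Ts f (insert j I))"
          by (simp add: df clinear_on_0[OF linR[OF jn] S])
        also have "\<dots> = koszul_sign j (insert j I) *\<^sub>R
            (\<Sum>i\<in>insert j I. R j (koszul_sign i (insert j I) *\<^sub>R (Ts ! i) (f (insert j I - {i}))))"
          unfolding koszul_diff_eq[OF sub]
          by (rule arg_cong[of _ _ "(*\<^sub>R) _"], rule clinear_on_sum[OF linR[OF jn] S in_S])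
        also have "\<dots> = (\<Sum>i\<in>insert j I. h i j)"
          unfolding scaleR_sum_right by (rule sum.cong[OF refl]) (simp add: Rlin h_def)
        also have "\<dots> = R j ((Ts ! j) (f I)) + (\<Sum>i\<in>I. h i j)"
          using fin j by (simp add: h_def)
        finally show ?thesis by (simp add: eq_neg_iff_add_eq_0 add.commute)
      qed
      have "koszul_diff Ts g I = (\<Sum>i\<in>I. (Ts ! i) (R i (f I)) - (\<Sum>j\<in>{..<n} - I. h i j))"
        unfolding koszul_diff_eq[OF I[unfolded n]] by (rule sum.cong[OF refl dg])
      also have "\<dots> = (\<Sum>i\<in>I. (Ts ! i) (R i (f I))) - (\<Sum>j\<in>{..<n} - I. \<Sum>i\<in>I. h i j)"
        unfolding sum_subtractf by (subst sum.swap) simp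
      also have "(\<Sum>j\<in>{..<n} - I. \<Sum>i\<in>I. h i j) = (\<Sum>j\<in>{..<n} - I. - (Ts ! j) (R j (f I)))"
        by (intro sum.cong refl) (simp add: hsum commR fS[OF I])
      also have "(\<Sum>i\<in>I. (Ts ! i) (R i (f I))) - \<dots> = (\<Sum>i<n. (Ts ! i) (R i (f I)))"
        using sum.subset_diff[OF I, of "\<lambda>i. (Ts ! i) (R i (f I))"] by (simp add: sum_negf)
      also have "\<dots> = f I" by (rule one[OF fS[OF I]])
      finally show ?thesis .
    next
      case False
      then show ?thesis using f unfolding n by (simp add: koszul_diff_def koszul_chains_def)
    qed
  qed
  then show "f \<in> koszul_diff Ts ` koszul_chains S (length Ts)" using g unfolding n by blast
qed

section \<open>Coefficientwise operators on the Hardy space\<close>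

definition of_coeffs :: "(nat \<Rightarrow> 'a::chilbert_space) \<Rightarrow> 'a hardy"
  where "of_coeffs a = Abs_hardy (disc_series a)"

lemma taylor_coeff_of_coeffs: "square_summable a \<Longrightarrow> taylor_coeff (of_coeffs a) = a"
  unfolding of_coeffs_def by (rule taylor_coeff_Abs_hardy)

lemma of_coeffs_taylor_coeff [simp]: "of_coeffs (taylor_coeff f) = f"
  by (intro hardy_eqI) (simp add: taylor_coeff_of_coeffs square_summable_taylor_coeff)

lemma norm_of_coeffs_sums: "square_summable a \<Longrightarrow> (\<lambda>n. (norm (a n))\<^sup>2) sums (norm (of_coeffs a))\<^sup>2"
  using taylor_coeff_norm_sums[of "of_coeffs a"] by (simp add: taylor_coeff_of_coeffs)

lemma taylor_coeff_hardy_monom: "taylor_coeff (hardy_monom n) = (\<lambda>k. if k = n then 1 else 0)"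
proof (rule taylor_coeff_unique)
  let ?a = "\<lambda>k. if k = n then 1 else 0 :: complex"
  show "square_summable ?a"
    unfolding square_summable_def by (rule summable_finite[of "{n}"]) auto
  show "hardy_apply (hardy_monom n) = disc_series ?a"
  proof
    fix z :: complex
    have "(\<lambda>k. if k = n then z ^ k else 0) sums z ^ n" by (rule sums_single)
    also have "(\<lambda>k. if k = n then z ^ k else 0) = (\<lambda>k. z ^ k *\<^sub>C ?a k)"
      by (auto simp: scaleC_complex_def)
    finally show "hardy_apply (hardy_monom n) z = disc_series ?a z"
      by (simp add: hardy_monom.rep_eq disc_series_def sums_iff)
  qed
qed

lemma taylor_coeff_monom_tensor: "taylor_coeff (hardy_monom n \<otimes> v) k = (if k = n then v else 0)"
  by (simp add: taylor_coeff_tensor taylor_coeff_hardy_monom)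

lemma taylor_coeff_mult_z: "taylor_coeff (mult_z f) = case_nat 0 (taylor_coeff f)"
proof (rule taylor_coeff_unique)
  let ?b = "case_nat 0 (taylor_coeff f)"
  show b: "square_summable ?b"
    using square_summable_taylor_coeff[of f] unfolding square_summable_def
    by (subst summable_Suc_iff[symmetric]) simp
  show "hardy_apply (mult_z f) = disc_series ?b"
  proof
    fix z
    show "hardy_apply (mult_z f) z = disc_series ?b z"
    proof (cases "cmod z < 1")
      case True
      have "disc_series ?b z = (\<Sum>n. z ^ Suc n *\<^sub>C taylor_coeff f n)"
        using suminf_split_head[OF square_summable_powser[OF b True]] True
        by (simp add: disc_series_def)
      also have "\<dots> = (\<Sum>n. z * (z ^ n *\<^sub>C taylor_coeff f n))"
        by (simp add: scaleC_complex_def mult.assoc)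
      also have "\<dots> = z * (\<Sum>n. z ^ n *\<^sub>C taylor_coeff f n)"
        by (rule suminf_mult[OF square_summable_powser[OF square_summable_taylor_coeff True]])
      finally show ?thesis using True by (simp add: mult_z.rep_eq hardy_apply_taylor_coeff[of f] disc_series_def)
    qed (simp add: mult_z.rep_eq hardy_apply_taylor_coeff[of f] disc_series_def)
  qed
qed

lemma taylor_coeff_sum: "taylor_coeff (sum F I) n = (\<Sum>i\<in>I. taylor_coeff (F i) n)"
  by (induction I rule: infinite_finite_induct) (auto simp: taylor_coeff_zero taylor_coeff_add)

lemma hardy_monom_series: "(\<lambda>n. hardy_monom n \<otimes> taylor_coeff F n) sums F"
  unfolding sums_def
proof (rule LIM_zero_cancel, rule tendsto_norm_zero_cancel)
  define c where "c n = (norm (taylor_coeff F n))\<^sup>2" for n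
  have c: "c sums (norm F)\<^sup>2" unfolding c_def by (rule taylor_coeff_norm_sums)
  have eq: "norm ((\<Sum>n<m. hardy_monom n \<otimes> taylor_coeff F n) - F) = sqrt ((norm F)\<^sup>2 - sum c {..<m})" for m
  proof -
    let ?R = "(\<Sum>n<m. hardy_monom n \<otimes> taylor_coeff F n) - F"
    have "taylor_coeff ?R n = (if n \<in> {..<m} then 0 else - taylor_coeff F n)" for n
      by (simp add: taylor_coeff_diff taylor_coeff_sum taylor_coeff_monom_tensor)
    then have "(norm (taylor_coeff ?R n))\<^sup>2 = (if n \<in> {..<m} then 0 else c n)" for n by (simp add: c_def)
    then have "(\<lambda>n. if n \<in> {..<m} then 0 else c n) sums (norm ?R)\<^sup>2"
      using taylor_coeff_norm_sums[of ?R] by simp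
    moreover have "(\<lambda>n. if n \<in> {..<m} then 0 else c n) sums ((norm F)\<^sup>2 - sum c {..<m})"
      by (rule sums_If_finite_set'[OF c]) (auto simp: sum_negf)
    ultimately have "(norm ?R)\<^sup>2 = (norm F)\<^sup>2 - sum c {..<m}" by (rule sums_unique2)
    then show ?thesis by (metis norm_ge_zero real_sqrt_unique)
  qed
  have "(\<lambda>m. sqrt ((norm F)\<^sup>2 - sum c {..<m})) \<longlonglongrightarrow> sqrt ((norm F)\<^sup>2 - (norm F)\<^sup>2)"
    using c unfolding sums_def by (intro tendsto_intros)
  then show "(\<lambda>m. norm ((\<Sum>n<m. hardy_monom n \<otimes> taylor_coeff F n) - F)) \<longlonglongrightarrow> 0"
    unfolding eq by simp
qed

lemma bounded_linear_taylor_coeff: "bounded_linear (\<lambda>F. taylor_coeff F n)"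
proof (rule bounded_linear_intro)
  show "taylor_coeff (r *\<^sub>R F) n = r *\<^sub>R taylor_coeff F n" for r and F :: "'a hardy"
    by (simp add: scaleR_scaleC taylor_coeff_scaleC)
  show "norm (taylor_coeff F n) \<le> norm F * 1" for F :: "'a hardy" using norm_taylor_coeff_le by simp
qed (simp add: taylor_coeff_add)

lemma csubspace_hull_minimal: "X \<subseteq> S \<Longrightarrow> csubspace S \<Longrightarrow> csubspace hull X \<subseteq> S"
  by (rule hull_minimal)

lemma csubspace_hull: "csubspace (csubspace hull X)"
  by (rule hull_in) (auto simp: csubspace_def)

lemma closed_csubspace_coeffs:
  assumes "\<And>n. closed_csubspace (E n)"
  shows "closed_csubspace {F. \<forall>n. taylor_coeff F n \<in> E n}"
proof -
  have E: "\<And>n. csubspace (E n)" "\<And>n. closed (E n)" using assms by (auto dest: closed_csubspaceD)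
  have "csubspace {F. \<forall>n. taylor_coeff F n \<in> E n}"
    using E(1) by (auto simp: csubspace_def taylor_coeff_zero taylor_coeff_add taylor_coeff_scaleC)
  moreover have "closed {F. \<forall>n. taylor_coeff F n \<in> E n}"
    unfolding closed_sequential_limits
  proof (intro allI impI, elim conjE)
    fix F G assume F: "\<forall>k. F k \<in> {F. \<forall>n. taylor_coeff F n \<in> E n}" and G: "F \<longlonglongrightarrow> G"
    have lim: "(\<lambda>k. taylor_coeff (F k) n) \<longlonglongrightarrow> taylor_coeff G n" for n
      by (rule bounded_linear.tendsto[OF bounded_linear_taylor_coeff G])
    have "taylor_coeff G n \<in> E n" for n
      by (rule closed_sequentially[OF E(2) _ lim]) (use F in simp)
    then show "G \<in> {F. \<forall>n. taylor_coeff F n \<in> E n}" by simp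
  qed
  ultimately show ?thesis by (simp add: closed_csubspace_def)
qed

text \<open>The coefficient condition is closed, and a function satisfying it is the limit of its Taylor polynomials.\<close>

lemma hardy_space_eq:
  assumes E: "closed_csubspace E"
  shows "hardy_space E = {F. \<forall>n. taylor_coeff F n \<in> E}"
proof
  have E': "csubspace E" using E by (rule closed_csubspaceD)
  note K = closed_csubspace_coeffs[OF E]
  have "{f \<otimes> v |f v. v \<in> E} \<subseteq> {F. \<forall>n. taylor_coeff F n \<in> E}"
    using E' by (auto simp: taylor_coeff_tensor csubspace_scaleC)
  then show "hardy_space E \<subseteq> {F. \<forall>n. taylor_coeff F n \<in> E}"
    unfolding hardy_space_def
    by (intro closure_minimal csubspace_hull_minimal closed_csubspaceD[OF K])
  show "{F. \<forall>n. taylor_coeff F n \<in> E} \<subseteq> hardy_space E"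
  proof
    fix F assume F: "F \<in> {F. \<forall>n. taylor_coeff F n \<in> E}"
    have "(\<Sum>n<m. hardy_monom n \<otimes> taylor_coeff F n) \<in> csubspace hull {f \<otimes> v |f v. v \<in> E}" for m
      using F by (intro csubspace_sum[OF csubspace_hull] hull_inc) blast
    then have "(\<Sum>n<m. hardy_monom n \<otimes> taylor_coeff F n) \<in> hardy_space E" for m
      unfolding hardy_space_def using closure_subset by blast
    moreover have "(\<lambda>m. \<Sum>n<m. hardy_monom n \<otimes> taylor_coeff F n) \<longlonglongrightarrow> F"
      using hardy_monom_series[of F] by (simp add: sums_def)
    ultimately show "F \<in> hardy_space E"
      unfolding hardy_space_def by (rule closed_sequentially[OF closed_closure])
  qed
qed

lemma taylor_coeff_in: "closed_csubspace E \<Longrightarrow> F \<in> hardy_space E \<Longrightarrow> taylor_coeff F n \<in> E"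
  by (simp add: hardy_space_eq)

lemma hardy_spaceI: "closed_csubspace E \<Longrightarrow> (\<And>n. taylor_coeff F n \<in> E) \<Longrightarrow> F \<in> hardy_space E"
  by (simp add: hardy_space_eq)

lemma closed_csubspace_hardy_space: "closed_csubspace E \<Longrightarrow> closed_csubspace (hardy_space E)"
  by (simp add: hardy_space_eq closed_csubspace_coeffs)

text \<open>A bounded operator is determined by its values on elementary tensors.\<close>

lemma tensor_op_eq:
  assumes E: "closed_csubspace E" and R: "bounded_op (hardy_space E) R"
    and tensor: "\<And>f v. v \<in> E \<Longrightarrow> R (f \<otimes> v) = T f \<otimes> A v" and F: "F \<in> hardy_space E"
  shows "tensor_op E T A F = R F"
proof -
  let ?K = "hardy_space E"
  have K: "csubspace ?K" "closed ?K" using closed_csubspace_hardy_space[OF E] by (auto dest: closed_csubspaceD)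
  have tK: "f \<otimes> v \<in> ?K" if "v \<in> E" for f v
    using that E closed_csubspaceD(1)[OF E] by (intro hardy_spaceI) (auto simp: taylor_coeff_tensor csubspace_scaleC)
  define R0 where "R0 F = (if F \<in> ?K then R F else 0)" for F
  have R0: "bounded_op ?K R0" using R bounded_op_cong[OF K(1), of R0 R] by (simp add: R0_def)
  have "tensor_op E T A = R0"
    unfolding tensor_op_def
  proof (rule the_equality)
    show "bounded_op ?K R0 \<and> (\<forall>f. \<forall>v\<in>E. R0 (f \<otimes> v) = T f \<otimes> A v) \<and> (\<forall>F. F \<notin> ?K \<longrightarrow> R0 F = 0)"
      using R0 tK tensor by (simp add: R0_def)
    fix R' assume R': "bounded_op ?K R' \<and> (\<forall>f. \<forall>v\<in>E. R' (f \<otimes> v) = T f \<otimes> A v) \<and> (\<forall>F. F \<notin> ?K \<longrightarrow> R' F = 0)"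
    then have b: "bounded_op ?K R'" by blast
    let ?A = "{F \<in> ?K. R' F = R0 F}"
    have "csubspace ?A"
      using K(1) unfolding csubspace_def
      by (auto simp: bounded_op_add[OF b] bounded_op_add[OF R0] bounded_op_scaleC[OF b] bounded_op_scaleC[OF R0]
          bounded_op_0[OF b K(1)] bounded_op_0[OF R0 K(1)])
    moreover have "closed ?A"
      unfolding closed_sequential_limits
    proof (intro allI impI, elim conjE)
      fix f l assume f: "\<forall>n. f n \<in> ?A" and l: "f \<longlonglongrightarrow> l"
      have fK: "f n \<in> ?K" for n using f by simp
      have lK: "l \<in> ?K" by (rule closed_sequentially[OF K(2) fK l])
      have "(\<lambda>n. R' (f n)) \<longlonglongrightarrow> R' l" "(\<lambda>n. R0 (f n)) \<longlonglongrightarrow> R0 l"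
        by (rule bounded_op_tendsto[OF K(1) b fK lK l], rule bounded_op_tendsto[OF K(1) R0 fK lK l])
      moreover have "(\<lambda>n. R' (f n)) = (\<lambda>n. R0 (f n))" using f by simp
      ultimately show "l \<in> ?A" using lK LIMSEQ_unique by force
    qed
    moreover have "{f \<otimes> v |f v. v \<in> E} \<subseteq> ?A"
      using R' tK tensor by (auto simp: R0_def)
    ultimately have "?K \<subseteq> ?A"
      unfolding hardy_space_def[of E, THEN arg_cong[of _ _ "\<lambda>X. X \<subseteq> ?A"]]
      by (intro closure_minimal csubspace_hull_minimal)
    then show "R' = R0" using R' by (auto simp: R0_def fun_eq_iff)
  qed
  then show ?thesis using F by (simp add: R0_def)
qed

text \<open>The operator \<open>I \<otimes> B\<close>, and the isometry \<open>z\<^sup>n \<otimes> v \<mapsto> z\<^bsup>s n\<^esup> \<otimes> v\<close> for an injection \<open>s\<close> with its adjoint. All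
  shifts and embeddings of index sets below are of this form.\<close>

definition amp :: "('a::chilbert_space \<Rightarrow> 'a) \<Rightarrow> 'a hardy \<Rightarrow> 'a hardy"
  where "amp B F = of_coeffs (\<lambda>n. B (taylor_coeff F n))"

definition push :: "(nat \<Rightarrow> nat) \<Rightarrow> 'a::chilbert_space hardy \<Rightarrow> 'a hardy"
  where "push s F = of_coeffs (\<lambda>n. if n \<in> range s then taylor_coeff F (inv s n) else 0)"

definition pull :: "(nat \<Rightarrow> nat) \<Rightarrow> 'a::chilbert_space hardy \<Rightarrow> 'a hardy"
  where "pull s F = of_coeffs (\<lambda>n. taylor_coeff F (s n))"

lemma taylor_coeff_amp:
  assumes "closed_csubspace E" "bounded_op E B" "F \<in> hardy_space E"
  shows "taylor_coeff (amp B F) n = B (taylor_coeff F n)"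
    and "\<exists>C. \<forall>F\<in>hardy_space E. norm (amp B F) \<le> C * norm F"
proof -
  obtain C where C: "C > 0" "\<And>x. x \<in> E \<Longrightarrow> norm (B x) \<le> C * norm x" using bounded_op_bound[OF assms(2)] by blast
  have le: "(norm (B (taylor_coeff F n)))\<^sup>2 \<le> C\<^sup>2 * (norm (taylor_coeff F n))\<^sup>2" if "F \<in> hardy_space E" for F n
    using power_mono[OF C(2)[OF taylor_coeff_in[OF assms(1) that]], where n = 2] by (simp add: power_mult_distrib)
  have sm: "summable (\<lambda>n. C\<^sup>2 * (norm (taylor_coeff F n))\<^sup>2)" for F :: "'a hardy"
    by (intro summable_mult sums_summable[OF taylor_coeff_norm_sums])
  have ss: "square_summable (\<lambda>n. B (taylor_coeff F n))" if "F \<in> hardy_space E" for F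
    unfolding square_summable_def by (rule summable_comparison_test'[OF sm[of F]]) (simp add: le[OF that])
  show "taylor_coeff (amp B F) n = B (taylor_coeff F n)"
    unfolding amp_def taylor_coeff_of_coeffs[OF ss[OF assms(3)]] ..
  have "norm (amp B F) \<le> C * norm F" if F: "F \<in> hardy_space E" for F
  proof (rule power2_le_imp_le)
    show "(norm (amp B F))\<^sup>2 \<le> (C * norm F)\<^sup>2"
      unfolding power_mult_distrib amp_def
      by (rule sums_le[OF le[OF F] norm_of_coeffs_sums[OF ss[OF F]] sums_mult[OF taylor_coeff_norm_sums]])
  qed (use C in simp)
  then show "\<exists>C. \<forall>F\<in>hardy_space E. norm (amp B F) \<le> C * norm F" by blast
qed

lemma adjoint_on_amp:
  assumes E: "closed_csubspace E" and B: "adjoint_on E B B'"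
  shows "adjoint_on (hardy_space E) (amp B) (amp B')"
proof -
  have b: "bounded_op (hardy_space E) (amp B)" if B: "bounded_op E B" for B
  proof -
    note c = taylor_coeff_amp[OF E B]
    note K = closed_csubspaceD(1)[OF closed_csubspace_hardy_space[OF E]]
    obtain C where C: "\<And>F. F \<in> hardy_space E \<Longrightarrow> norm (amp B F) \<le> C * norm F"
      using c(2)[OF csubspace_0[OF K]] by blast
    show ?thesis
    proof (rule bounded_opI[OF _ _ _ C])
      show "amp B F \<in> hardy_space E" if "F \<in> hardy_space E" for F
        by (rule hardy_spaceI[OF E]) (simp add: c(1)[OF that] bounded_op_in[OF B] taylor_coeff_in[OF E that])
      show "amp B (F + G) = amp B F + amp B G" if "F \<in> hardy_space E" "G \<in> hardy_space E" for F G
        using that by (intro hardy_eqI)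
          (simp add: c(1) csubspace_add[OF K] taylor_coeff_add bounded_op_add[OF B] taylor_coeff_in[OF E])
      show "amp B (d *\<^sub>C F) = d *\<^sub>C amp B F" if "F \<in> hardy_space E" for d F
        using that by (intro hardy_eqI)
          (simp add: c(1) csubspace_scaleC[OF K] taylor_coeff_scaleC bounded_op_scaleC[OF B] taylor_coeff_in[OF E])
    qed
  qed
  have "cinner (amp B F) G = cinner F (amp B' G)" if "F \<in> hardy_space E" "G \<in> hardy_space E" for F G
    unfolding cinner_hardy_def
    using that adjoint_on_bounded[OF B] adjoint_on_cinner[OF B] by (simp add: taylor_coeff_amp(1)[OF E]
        taylor_coeff_in[OF E])
  then show ?thesis using b adjoint_on_bounded[OF B] by (simp add: adjoint_on_def)
qed

lemma inj_sums_iff: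
  assumes s: "inj s" and 0: "\<And>n. n \<notin> range s \<Longrightarrow> f n = 0" and sm: "summable (\<lambda>n. f (s n))" "\<And>n. f (s n) \<ge> 0"
  shows "summable (f :: nat \<Rightarrow> real)" "(\<Sum>n. f n) = (\<Sum>n. f (s n))"
proof -
  have "((\<lambda>n. f (s n)) has_sum (\<Sum>n. f (s n))) UNIV"
    by (intro sums_nonneg_imp_has_sum summable_sums sm)
  then have "(f has_sum (\<Sum>n. f (s n))) (range s)"
    using has_sum_reindex[OF s, of f] by (simp add: o_def)
  then have "(f has_sum (\<Sum>n. f (s n))) UNIV"
    by (rule has_sum_cong_neutral[THEN iffD1, rotated -1]) (use 0 in auto)
  then have "f sums (\<Sum>n. f (s n))" by (rule has_sum_imp_sums)
  then show "summable (f :: nat \<Rightarrow> real)" "(\<Sum>n. f n) = (\<Sum>n. f (s n))" by (auto simp: sums_iff)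
qed

lemma taylor_coeff_push:
  assumes s: "inj s"
  shows "taylor_coeff (push s F) n = (if n \<in> range s then taylor_coeff F (inv s n) else 0)"
    and "norm (push s F) = norm F"
proof -
  let ?a = "\<lambda>n. if n \<in> range s then taylor_coeff F (inv s n) else 0"
  have a: "?a (s n) = taylor_coeff F n" for n using s by simp
  note r = inj_sums_iff[OF s, of "\<lambda>n. (norm (?a n))\<^sup>2", unfolded a]
  have "square_summable ?a"
    unfolding square_summable_def by (rule r(1)) (auto intro: sums_summable[OF taylor_coeff_norm_sums])
  then show c: "taylor_coeff (push s F) n = ?a n" for n
    unfolding push_def by (simp only: taylor_coeff_of_coeffs)
  have "(norm (push s F))\<^sup>2 = (\<Sum>n. (norm (?a n))\<^sup>2)"
    using taylor_coeff_norm_sums[of "push s F"] unfolding c by (simp only: sums_iff)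
  also have "\<dots> = (\<Sum>n. (norm (taylor_coeff F n))\<^sup>2)"
    by (rule r(2)) (auto intro: sums_summable[OF taylor_coeff_norm_sums])
  also have "\<dots> = (norm F)\<^sup>2" using taylor_coeff_norm_sums[of F] by (simp only: sums_iff)
  finally show "norm (push s F) = norm F" by simp
qed

lemma taylor_coeff_push_apply: "inj s \<Longrightarrow> taylor_coeff (push s F) (s n) = taylor_coeff F n"
  by (simp add: taylor_coeff_push)

lemma taylor_coeff_pull:
  assumes s: "inj s"
  shows "taylor_coeff (pull s F) n = taylor_coeff F (s n)" and "norm (pull s F) \<le> norm F"
proof -
  have sm: "summable ((\<lambda>n. (norm (taylor_coeff F n))\<^sup>2) \<circ> s)"
    by (rule summable_reindex[OF sums_summable[OF taylor_coeff_norm_sums] s]) simp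
  then have ss: "square_summable (\<lambda>n. taylor_coeff F (s n))" by (simp add: square_summable_def o_def)
  then show c: "taylor_coeff (pull s F) n = taylor_coeff F (s n)" for n
    unfolding pull_def by (simp only: taylor_coeff_of_coeffs)
  have "(\<Sum>n. (norm (taylor_coeff F (s n)))\<^sup>2) \<le> (\<Sum>n. (norm (taylor_coeff F n))\<^sup>2)"
    using suminf_reindex_mono[OF sums_summable[OF taylor_coeff_norm_sums] s, of F] by (simp add: o_def)
  then have "(norm (pull s F))\<^sup>2 \<le> (norm F)\<^sup>2"
    using taylor_coeff_norm_sums[of "pull s F"] taylor_coeff_norm_sums[of F] unfolding c by (simp only: sums_iff)
  then show "norm (pull s F) \<le> norm F" by (rule power2_le_imp_le) simp
qed

lemma pull_push: "inj s \<Longrightarrow> pull s (push s F) = F"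
  by (intro hardy_eqI) (simp add: taylor_coeff_pull taylor_coeff_push_apply)

lemma push_pull: "bij s \<Longrightarrow> push s (pull s F) = F"
  by (intro hardy_eqI) (simp add: taylor_coeff_pull taylor_coeff_push bij_is_inj bij_is_surj surj_f_inv_f)

lemma push_eqI:
  assumes "inj s" "\<And>n. taylor_coeff G (s n) = taylor_coeff F n" "\<And>n. n \<notin> range s \<Longrightarrow> taylor_coeff G n = 0"
  shows "push s F = G"
proof (rule hardy_eqI)
  fix n show "taylor_coeff (push s F) n = taylor_coeff G n"
    using assms by (cases "n \<in> range s") (auto simp: taylor_coeff_push)
qed

lemma push_comp: "inj s \<Longrightarrow> inj t \<Longrightarrow> push s (push t F) = push (s \<circ> t) F"
  by (intro push_eqI[symmetric] inj_compose) (auto simp: taylor_coeff_push taylor_coeff_push_apply image_def o_def)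

text \<open>\<open>push s\<close> preserves inner products by polarization, and \<open>G - push s (pull s G)\<close> has no coefficients
  in the range of \<open>s\<close>.\<close>

lemma adjoint_on_push:
  assumes E: "closed_csubspace E" and s: "inj s"
  shows "adjoint_on (hardy_space E) (push s) (pull s)"
proof -
  note E' = closed_csubspaceD(1)[OF E]
  have "bounded_op (hardy_space E) (push s)"
    by (rule bounded_opI[where B = 1])
      (auto intro!: hardy_eqI hardy_spaceI[OF E] simp: taylor_coeff_push[OF s] taylor_coeff_add taylor_coeff_scaleC
        taylor_coeff_in[OF E] csubspace_0[OF E'])
  moreover have "bounded_op (hardy_space E) (pull s)"
    by (rule bounded_opI[where B = 1])
      (auto intro!: hardy_eqI hardy_spaceI[OF E] simp: taylor_coeff_pull[OF s] taylor_coeff_add taylor_coeff_scaleC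
        taylor_coeff_in[OF E])
  moreover have "cinner (push s F) G = cinner F (pull s G)" for F G :: "'a hardy"
  proof -
    have polar: "cinner (push s F) (push s H) = cinner F H" for H
    proof -
      have add: "push s (F + c *\<^sub>C H) = push s F + c *\<^sub>C push s H" for c
        by (rule hardy_eqI) (simp add: taylor_coeff_push[OF s] taylor_coeff_add taylor_coeff_scaleC)
      have "cinner (push s F + c *\<^sub>C push s H) (push s F + c *\<^sub>C push s H) = cinner (F + c *\<^sub>C H) (F + c *\<^sub>C H)" for c
        unfolding add[symmetric] cinner_self taylor_coeff_push(2)[OF s] ..
      then have *: "cnj c * cinner (push s F) (push s H) + c * cinner (push s H) (push s F) =
          cnj c * cinner F H + c * cinner H F" for c
        unfolding cinner_add_left cinner_add_right cinner_scaleC_left cinner_scaleC_right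
        by (simp add: cinner_self taylor_coeff_push(2)[OF s] algebra_simps)
      from *[of 1] *[of \<i>] show ?thesis by (simp add: complex_eq_iff)
    qed
    have "cinner (push s F) (G - push s (pull s G)) = 0"
    proof -
      have "taylor_coeff (push s F) n = 0 \<or> taylor_coeff (G - push s (pull s G)) n = 0" for n
        by (cases "n \<in> range s")
          (auto simp: taylor_coeff_diff taylor_coeff_push_apply[OF s] taylor_coeff_pull[OF s]
              taylor_coeff_push[OF s] inv_f_f[OF s])
      then have "cinner (taylor_coeff (push s F) n) (taylor_coeff (G - push s (pull s G)) n) = 0" for n
        by (metis cinner_zero_left cinner_zero_right)
      then show ?thesis unfolding cinner_hardy_def by simp
    qed
    then show ?thesis using polar[of "pull s G"] by (simp add: cinner_diff_right)
  qed
  ultimately show ?thesis by (simp add: adjoint_on_def)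
qed

section \<open>Normal quadruples with spectrum in the boundary\<close>

text \<open>For small \<open>e > 0\<close> the map \<open>x \<mapsto> x - e (Q x - y)\<close> is a strict contraction, and its fixed point solves \<open>Q x = y\<close>.\<close>

lemma coercive_inverse:
  fixes S :: "'a::chilbert_space set"
  assumes S: "closed_csubspace S" and Q: "bounded_op S Q" and d: "d > 0"
    and coercive: "\<And>x. x \<in> S \<Longrightarrow> d * (norm x)\<^sup>2 \<le> Re (cinner (Q x) x)"
  obtains R where "\<And>y. y \<in> S \<Longrightarrow> R y \<in> S" "\<And>y. y \<in> S \<Longrightarrow> Q (R y) = y" "\<And>x. x \<in> S \<Longrightarrow> R (Q x) = x"
proof -
  have S': "csubspace S" "closed S" using S by (auto dest: closed_csubspaceD)
  obtain B0 where B0: "B0 > 0" "\<And>x. x \<in> S \<Longrightarrow> norm (Q x) \<le> B0 * norm x" using bounded_op_bound[OF Q] by blast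
  define B where "B = max B0 d"
  have B: "B > 0" "B \<ge> d" "\<And>x. x \<in> S \<Longrightarrow> norm (Q x) \<le> B * norm x"
    using B0 by (auto simp: B_def intro: order_trans[OF B0(2) mult_right_mono])
  define e where "e = d / B\<^sup>2"
  have e: "e > 0" "e * B\<^sup>2 = d" using B d by (auto simp: e_def)
  define c where "c = sqrt (1 - e * d)"
  have ed: "e * d > 0" "e * d \<le> 1"
  proof -
    have "d\<^sup>2 \<le> B\<^sup>2" using B d by (intro power_mono) auto
    then show "e * d > 0" "e * d \<le> 1" using d B by (auto simp: e_def power2_eq_square divide_le_eq_1)
  qed
  have c: "0 \<le> c" "c < 1" using ed by (auto simp: c_def)
  have small: "norm (v - e *\<^sub>R Q v) \<le> c * norm v" if v: "v \<in> S" for v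
  proof (rule power2_le_imp_le)
    have "(norm (v - e *\<^sub>R Q v))\<^sup>2 = (norm v)\<^sup>2 - 2 * e * Re (cinner (Q v) v) + e\<^sup>2 * (norm (Q v))\<^sup>2"
      unfolding power2_norm_eq_inner inner_eq_Re_cinner[of "Q v" v, symmetric]
      by (simp add: inner_simps inner_commute power2_eq_square[of e] algebra_simps)
    also have "\<dots> \<le> (norm v)\<^sup>2 - 2 * e * (d * (norm v)\<^sup>2) + e\<^sup>2 * (B * norm v)\<^sup>2"
      using coercive[OF v] B(3)[OF v] e by (intro add_mono diff_mono mult_left_mono power_mono) auto
    also have "\<dots> = (1 - e * d) * (norm v)\<^sup>2"
      by (simp add: e(2)[symmetric] power_mult_distrib power2_eq_square algebra_simps)
    also have "\<dots> = (c * norm v)\<^sup>2" using ed by (simp add: c_def power_mult_distrib)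
    finally show "(norm (v - e *\<^sub>R Q v))\<^sup>2 \<le> (c * norm v)\<^sup>2" .
  qed (use c in simp)
  have "\<exists>!x\<in>S. Q x = y" if y: "y \<in> S" for y
  proof -
    let ?f = "\<lambda>x. x - e *\<^sub>R (Q x - y)"
    have "\<exists>!x\<in>S. ?f x = x"
    proof (rule Banach_fix[of S c ?f])
      show "complete S" using S'(2) by (simp add: complete_eq_closed)
      show "S \<noteq> {}" using y by auto
      show "?f ` S \<subseteq> S"
        using y by (auto intro!: csubspace_diff[OF S'(1)] csubspace_scaleR[OF S'(1)] bounded_op_in[OF Q])
      show "dist (?f x) (?f x') \<le> c * dist x x'" if "x \<in> S" "x' \<in> S" for x x'
        using small[OF csubspace_diff[OF S'(1) that]]
        by (simp add: dist_norm bounded_op_diff[OF Q S'(1) that] algebra_simps)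
    qed (use c in auto)
    moreover have "?f x = x \<longleftrightarrow> Q x = y" for x using e(1) by auto
    ultimately show ?thesis by simp
  qed
  then have R: "(THE x. x \<in> S \<and> Q x = y) \<in> S \<and> Q (THE x. x \<in> S \<and> Q x = y) = y" if "y \<in> S" for y
    using theI'[of "\<lambda>x. x \<in> S \<and> Q x = y"] that by blast
  show thesis
  proof (rule that[of "\<lambda>y. THE x. x \<in> S \<and> Q x = y"])
    show "(THE x'. x' \<in> S \<and> Q x' = Q x) = x" if "x \<in> S" for x
      using that \<open>\<And>y. y \<in> S \<Longrightarrow> \<exists>!x\<in>S. Q x = y\<close>[OF bounded_op_in[OF Q that]] by blast
  qed (use R in auto)
qed

text \<open>The operator \<open>Q = \<Sum>i. U\<^sub>i\<^sup>* U\<^sub>i\<close> is coercive and commutes with all \<open>U\<^sub>j\<close>,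
    so \<open>U\<^sub>i\<^sup>* Q\<^sup>-\<^sup>1\<close> contracts the Koszul complex.\<close>

lemma taylor_nonsingular_normal:
  fixes S :: "'a::chilbert_space set"
  assumes S: "closed_csubspace S" and n: "n = length Us"
    and ad: "\<And>i. i < n \<Longrightarrow> adjoint_on S (Us ! i) (U' i)"
    and comm: "\<And>i j x. i < n \<Longrightarrow> j < n \<Longrightarrow> x \<in> S \<Longrightarrow> (Us ! i) ((Us ! j) x) = (Us ! j) ((Us ! i) x)"
    and comm': "\<And>i j x. i < n \<Longrightarrow> j < n \<Longrightarrow> x \<in> S \<Longrightarrow> (Us ! i) (U' j x) = U' j ((Us ! i) x)"
    and d: "d > 0" and below: "\<And>x. x \<in> S \<Longrightarrow> d * (norm x)\<^sup>2 \<le> (\<Sum>i<n. (norm ((Us ! i) x))\<^sup>2)"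
  shows "taylor_nonsingular S Us"
proof -
  have S': "csubspace S" using S by (rule closed_csubspaceD)
  have b: "bounded_op S (Us ! i)" "bounded_op S (U' i)" if "i < n" for i
    using adjoint_on_bounded[OF ad[OF that]] by auto
  define Q where "Q x = (\<Sum>i<n. U' i ((Us ! i) x))" for x
  have "bounded_op S (\<lambda>x. \<Sum>i\<in>I. U' i ((Us ! i) x))" if "finite I" "I \<subseteq> {..<n}" for I
    using that
  proof (induction I rule: finite_induct)
    case empty
    show ?case by (rule bounded_opI[where B = 0]) (auto simp: csubspace_0[OF S'])
  next
    case (insert i I)
    then have i: "i < n" and IH: "bounded_op S (\<lambda>x. \<Sum>i\<in>I. U' i ((Us ! i) x))" by auto
    have "bounded_op S (\<lambda>x. U' i ((Us ! i) x) + (\<Sum>i\<in>I. U' i ((Us ! i) x)))"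
      by (rule bounded_op_plus[OF S' bounded_op_comp[OF b(2)[OF i] b(1)[OF i]] IH])
    then show ?case using insert by simp
  qed
  then have bQ: "bounded_op S Q" unfolding Q_def by blast
  have "cinner (Q x) x = complex_of_real (\<Sum>i<n. (norm ((Us ! i) x))\<^sup>2)" if x: "x \<in> S" for x
  proof -
    have "cinner (Q x) x = (\<Sum>i<n. cinner (U' i ((Us ! i) x)) x)"
      unfolding Q_def by (rule linear_sum[OF bounded_linear.linear[OF bounded_linear_cinner_left]])
    also have "\<dots> = (\<Sum>i<n. complex_of_real ((norm ((Us ! i) x))\<^sup>2))"
      by (rule sum.cong[OF refl])
        (use adjoint_on_cinner[OF adjoint_on_sym[OF ad]] x in \<open>simp add: bounded_op_in[OF b(1)] cinner_self\<close>)
    finally show ?thesis by simp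
  qed
  then have "d * (norm x)\<^sup>2 \<le> Re (cinner (Q x) x)" if "x \<in> S" for x using below[OF that] that by simp
  then obtain R where R: "\<And>y. y \<in> S \<Longrightarrow> R y \<in> S" "\<And>y. y \<in> S \<Longrightarrow> Q (R y) = y" "\<And>x. x \<in> S \<Longrightarrow> R (Q x) = x"
    using coercive_inverse[OF S bQ d] by blast
  have linR: "clinear_on S R"
    unfolding clinear_on_def
  proof (intro conjI ballI allI)
    fix x y assume xy: "x \<in> S" "y \<in> S"
    have "Q (R x + R y) = x + y" using xy by (simp add: bounded_op_add[OF bQ] R)
    then show "R (x + y) = R x + R y" using R(3)[OF csubspace_add[OF S' R(1)[OF xy(1)] R(1)[OF xy(2)]]] by simp
  next
    fix c x assume x: "x \<in> S"
    have "Q (c *\<^sub>C R x) = c *\<^sub>C x" using x by (simp add: bounded_op_scaleC[OF bQ] R)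
    then show "R (c *\<^sub>C x) = c *\<^sub>C R x" using R(3)[OF csubspace_scaleC[OF S' R(1)[OF x], of c]] by simp
  qed
  have QU: "Q ((Us ! j) x) = (Us ! j) (Q x)" if j: "j < n" and x: "x \<in> S" for j x
  proof -
    have "(Us ! j) (Q x) = (\<Sum>i<n. (Us ! j) (U' i ((Us ! i) x)))"
      unfolding Q_def by (rule clinear_on_sum[OF bounded_op_clinear[OF b(1)[OF j]] S'])
        (simp add: bounded_op_in[OF b(1)] bounded_op_in[OF b(2)] x)
    also have "\<dots> = Q ((Us ! j) x)"
      unfolding Q_def by (rule sum.cong[OF refl]) (simp add: comm' comm j x bounded_op_in[OF b(1)])
    finally show ?thesis by simp
  qed
  have RU: "R ((Us ! j) x) = (Us ! j) (R x)" if j: "j < n" and x: "x \<in> S" for j x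
  proof -
    have "Q ((Us ! j) (R x)) = (Us ! j) x" using QU[OF j R(1)[OF x]] by (simp add: R x)
    then show ?thesis using R(3)[OF bounded_op_in[OF b(1)[OF j] R(1)[OF x]]] by simp
  qed
  show ?thesis
  proof (rule taylor_nonsingularI[OF S' n, of "\<lambda>i x. U' i (R x)"])
    fix i assume i: "i < n"
    show "clinear_on S (Us ! i)" by (rule bounded_op_clinear[OF b(1)[OF i]])
    show "clinear_on S (\<lambda>x. U' i (R x))"
      using linR by (simp add: clinear_on_def bounded_op_add[OF b(2)[OF i]] bounded_op_scaleC[OF b(2)[OF i]] R)
    fix x assume x: "x \<in> S"
    show "(Us ! i) x \<in> S" "U' i (R x) \<in> S"
      using x i by (simp_all add: bounded_op_in[OF b(1)] bounded_op_in[OF b(2)] R)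
    fix j assume j: "j < n"
    show "(Us ! i) ((Us ! j) x) = (Us ! j) ((Us ! i) x)" by (rule comm[OF i j x])
    show "(Us ! i) (U' j (R x)) = U' j (R ((Us ! i) x))"
      using comm'[OF i j R(1)[OF x]] RU[OF i x] by simp
  next
    fix x assume x: "x \<in> S"
    have "(\<Sum>i<n. (Us ! i) (U' i (R x))) = Q (R x)"
      unfolding Q_def by (rule sum.cong[OF refl]) (simp add: comm' R x)
    then show "(\<Sum>i<n. (Us ! i) (U' i (R x))) = x" by (simp add: R x)
  qed
qed

text \<open>Commuting operators satisfying the equations \<open>x\<^sub>3 x\<^sub>3\<^sup>* = 1\<close>, \<open>x\<^sub>1 = x\<^sub>2\<^sup>* x\<^sub>3\<close>, \<open>a\<^sup>* a + x\<^sub>1\<^sup>* x\<^sub>1 = 1\<close> of the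
  distinguished boundary. Here \<open>T\<^sub>1, T\<^sub>2, T\<^sub>3\<close> are necessarily normal, but \<open>T\<^sub>0\<close> is only quasinormal:
  it may be a non-unitary isometry while \<open>T\<^sub>1 = T\<^sub>2 = 0\<close>.\<close>

locale boundary_relations =
  fixes S :: "'a::chilbert_space set" and T0 T1 T2 T3 T0' T1' T2' T3' :: "'a \<Rightarrow> 'a"
  assumes S: "closed_csubspace S"
    and ad0: "adjoint_on S T0 T0'" and ad1: "adjoint_on S T1 T1'"
    and ad2: "adjoint_on S T2 T2'" and ad3: "adjoint_on S T3 T3'"
    and c01: "x \<in> S \<Longrightarrow> T0 (T1 x) = T1 (T0 x)" and c02: "x \<in> S \<Longrightarrow> T0 (T2 x) = T2 (T0 x)"
    and c03: "x \<in> S \<Longrightarrow> T0 (T3 x) = T3 (T0 x)" and c12: "x \<in> S \<Longrightarrow> T1 (T2 x) = T2 (T1 x)"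
    and c13: "x \<in> S \<Longrightarrow> T1 (T3 x) = T3 (T1 x)" and c23: "x \<in> S \<Longrightarrow> T2 (T3 x) = T3 (T2 x)"
    and unitary: "x \<in> S \<Longrightarrow> T3' (T3 x) = x" "x \<in> S \<Longrightarrow> T3 (T3' x) = x"
    and T1_eq: "x \<in> S \<Longrightarrow> T1 x = T2' (T3 x)"
    and sum_one: "x \<in> S \<Longrightarrow> T0' (T0 x) + T1' (T1 x) = x"
begin

lemma S': "csubspace S"
  using S by (rule closed_csubspaceD)

lemma bounded: "bounded_op S T0" "bounded_op S T1" "bounded_op S T2" "bounded_op S T3"
    "bounded_op S T0'" "bounded_op S T1'" "bounded_op S T2'" "bounded_op S T3'"
  using ad0 ad1 ad2 ad3 by (auto dest: adjoint_on_bounded)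

lemmas in_S = bounded[THEN bounded_op_in]

lemma T1'_eq: "x \<in> S \<Longrightarrow> T1' x = T3' (T2 x)"
  by (rule csubspace_eqI[OF S'])
    (simp_all add: in_S adjoint_on_cinner[OF adjoint_on_sym[OF ad1]] T1_eq
      adjoint_on_cinner[OF adjoint_on_sym[OF ad3]] adjoint_on_cinner[OF ad2])

lemma T2'_eq: "x \<in> S \<Longrightarrow> T2' x = T1 (T3' x)"
  by (simp add: T1_eq in_S unitary)

text \<open>The adjoints are words in the operators themselves: \<open>T\<^sub>3\<^sup>* = T\<^sub>3\<^sup>-\<^sup>1\<close>, \<open>T\<^sub>1\<^sup>* = T\<^sub>3\<^sup>-\<^sup>1 T\<^sub>2\<close> and
  \<open>T\<^sub>2\<^sup>* = T\<^sub>1 T\<^sub>3\<^sup>-\<^sup>1\<close>.\<close>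

lemma commute_adjoint:
  assumes X: "\<And>x. x \<in> S \<Longrightarrow> X x \<in> S"
    and c: "\<And>x. x \<in> S \<Longrightarrow> X (T1 x) = T1 (X x)" "\<And>x. x \<in> S \<Longrightarrow> X (T2 x) = T2 (X x)"
      "\<And>x. x \<in> S \<Longrightarrow> X (T3 x) = T3 (X x)" and x: "x \<in> S"
  shows "X (T1' x) = T1' (X x)" "X (T2' x) = T2' (X x)" "X (T3' x) = T3' (X x)"
proof -
  have 3: "X (T3' y) = T3' (X y)" if y: "y \<in> S" for y
  proof -
    have "X (T3' y) = T3' (T3 (X (T3' y)))" using y by (simp add: unitary X in_S)
    also have "T3 (X (T3' y)) = X (T3 (T3' y))" using y by (simp add: c in_S)
    finally show ?thesis using y by (simp add: unitary)
  qed
  show "X (T1' x) = T1' (X x)" "X (T2' x) = T2' (X x)" "X (T3' x) = T3' (X x)"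
    using x by (simp_all add: T1'_eq T2'_eq 3 in_S X c)
qed

lemma T0_commute_adjoint:
  assumes "x \<in> S"
  shows "T0 (T1' x) = T1' (T0 x)" "T0 (T2' x) = T2' (T0 x)" "T0 (T3' x) = T3' (T0 x)"
  by (rule commute_adjoint[of T0, OF _ _ _ _ assms]; simp add: in_S c01 c02 c03)+

lemma T1_commute_adjoint:
  assumes "x \<in> S"
  shows "T1 (T1' x) = T1' (T1 x)" "T1 (T2' x) = T2' (T1 x)" "T1 (T3' x) = T3' (T1 x)"
  by (rule commute_adjoint[of T1, OF _ _ _ _ assms]; simp add: in_S c12 c13)+

lemma T2_commute_adjoint:
  assumes "x \<in> S"
  shows "T2 (T1' x) = T1' (T2 x)" "T2 (T2' x) = T2' (T2 x)" "T2 (T3' x) = T3' (T2 x)"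
  by (rule commute_adjoint[of T2, OF _ _ _ _ assms]; simp add: in_S c12 c23)+

lemma T3_commute_adjoint:
  assumes "x \<in> S"
  shows "T3 (T1' x) = T1' (T3 x)" "T3 (T2' x) = T2' (T3 x)" "T3 (T3' x) = T3' (T3 x)"
  by (rule commute_adjoint[of T3, OF _ _ _ _ assms]; simp add: in_S c13 c23)+

lemma T0'_commute:
  assumes x: "x \<in> S"
  shows "T1 (T0' x) = T0' (T1 x)" "T2 (T0' x) = T0' (T2 x)" "T3 (T0' x) = T0' (T3 x)"
  using adjoint_on_commute[OF S' ad0 adjoint_on_sym[OF ad1], of x]
      adjoint_on_commute[OF S' ad0 adjoint_on_sym[OF ad2], of x]
    adjoint_on_commute[OF S' ad0 adjoint_on_sym[OF ad3], of x] x T0_commute_adjoint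
  by simp_all

text \<open>\<open>T\<^sub>0\<^sup>* T\<^sub>0 = 1 - T\<^sub>1\<^sup>* T\<^sub>1\<close>, and \<open>T\<^sub>0\<close> commutes with \<open>T\<^sub>1\<close> and \<open>T\<^sub>1\<^sup>*\<close>.\<close>

lemma quasinormal:
  assumes x: "x \<in> S"
  shows "T0' (T0 (T0 x)) = T0 (T0' (T0 x))"
proof -
  have e: "T0' (T0 y) = y - T1' (T1 y)" if "y \<in> S" for y using sum_one[OF that] by (simp add: eq_diff_eq)
  show ?thesis
    using x by (simp add: e in_S bounded_op_diff[OF bounded(1) S'] T0_commute_adjoint c01)
qed

text \<open>For a normal operator \<open>T\<close> the vectors \<open>(T - c) x\<close> and \<open>(T\<^sup>* - cnj c) x\<close> have the same norm. So subtracting from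
  an operator equation the equation that fails for the point bounds a multiple of \<open>x\<close>.\<close>

lemma bounded_below:
  assumes normal: "\<And>x. x \<in> S \<Longrightarrow> T0' (T0 x) = T0 (T0' x)" and c: "(c0, c1, c2, c3) \<notin> hexa_boundary"
  obtains d where "d > 0" "\<And>x. x \<in> S \<Longrightarrow> d * norm x \<le> norm (T0 x - c0 *\<^sub>C x) + norm (T1 x - c1 *\<^sub>C x) +
      norm (T2 x - c2 *\<^sub>C x) + norm (T3 x - c3 *\<^sub>C x)"
proof -
  let ?n = "\<lambda>x. norm (T0 x - c0 *\<^sub>C x) + norm (T1 x - c1 *\<^sub>C x) + norm (T2 x - c2 *\<^sub>C x) + norm (T3 x - c3 *\<^sub>C x)"
  note found = that
  have red: thesis if "e > 0" "C > 0" "\<And>x. x \<in> S \<Longrightarrow> e * norm x \<le> C * ?n x" for e C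
    by (rule found[of "e / C"]) (use that in \<open>auto simp: field_simps\<close>)
  have nadj: "norm (T' x - cnj c *\<^sub>C x) = norm (T x - c *\<^sub>C x)"
    if ad: "adjoint_on S T T'" and n: "\<And>x. x \<in> S \<Longrightarrow> T (T' x) = T' (T x)" and x: "x \<in> S" for T T' c x
  proof (rule norm_eq_of_cinner_eq)
    have b: "T x \<in> S" "T' x \<in> S" using x adjoint_on_bounded[OF ad] by (auto simp: bounded_op_in)
    show "cinner (T' x - cnj c *\<^sub>C x) (T' x - cnj c *\<^sub>C x) = cinner (T x - c *\<^sub>C x) (T x - c *\<^sub>C x)"
      using adjoint_on_cinner[OF ad x b(2)] adjoint_on_cinner[OF ad x b(1)] adjoint_on_cinner[OF ad b(2) x]
        adjoint_on_cinner[OF ad x x] adjoint_on_cinner[OF adjoint_on_sym[OF ad] x x]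
        adjoint_on_cinner[OF adjoint_on_sym[OF ad] b(1) x] n[OF x]
      by (simp add: cinner_simps algebra_simps)
  qed
  have n0: "norm (T0' x - cnj c0 *\<^sub>C x) = norm (T0 x - c0 *\<^sub>C x)" if "x \<in> S" for x
    by (rule nadj[OF ad0 _ that]) (simp add: normal)
  have n1: "norm (T1' x - cnj c1 *\<^sub>C x) = norm (T1 x - c1 *\<^sub>C x)" if "x \<in> S" for x
    by (rule nadj[OF ad1 _ that]) (simp add: T1_commute_adjoint)
  have n2: "norm (T2' x - cnj c2 *\<^sub>C x) = norm (T2 x - c2 *\<^sub>C x)" if "x \<in> S" for x
    by (rule nadj[OF ad2 _ that]) (simp add: T2_commute_adjoint)
  obtain B0 where B0: "B0 > 0" "\<And>x. x \<in> S \<Longrightarrow> norm (T0' x) \<le> B0 * norm x" using bounded_op_bound[OF bounded(5)] by blast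
  obtain B1 where B1: "B1 > 0" "\<And>x. x \<in> S \<Longrightarrow> norm (T1' x) \<le> B1 * norm x" using bounded_op_bound[OF bounded(6)] by blast
  obtain B2 where B2: "B2 > 0" "\<And>x. x \<in> S \<Longrightarrow> norm (T2' x) \<le> B2 * norm x" using bounded_op_bound[OF bounded(7)] by blast
  have shift_S: "T0 x - c0 *\<^sub>C x \<in> S" "T1 x - c1 *\<^sub>C x \<in> S" "T3 x - c3 *\<^sub>C x \<in> S" if "x \<in> S" for x
    using that by (auto intro!: csubspace_diff[OF S'] csubspace_scaleC[OF S'] in_S)
  consider "cmod c3 \<noteq> 1" | "c1 \<noteq> cnj c2 * c3" | "(cmod c0)\<^sup>2 + (cmod c1)\<^sup>2 \<noteq> 1"
    using c by (auto simp: hexa_boundary_def)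
  then show thesis
  proof cases
    case 1
    have "\<bar>1 - cmod c3\<bar> * norm x \<le> 1 * ?n x" if x: "x \<in> S" for x
    proof -
      have "norm (T3 x) = norm x"
        by (rule norm_eq_of_cinner_eq) (use adjoint_on_cinner[OF ad3 x in_S(4)[OF x]] x in \<open>simp add: unitary\<close>)
      then have "\<bar>norm x - cmod c3 * norm x\<bar> \<le> norm (T3 x - c3 *\<^sub>C x)"
        using norm_triangle_ineq3[of "T3 x" "c3 *\<^sub>C x"] by (simp add: norm_scaleC)
      moreover have "norm x - cmod c3 * norm x = (1 - cmod c3) * norm x" by (simp add: algebra_simps)
      ultimately have "\<bar>1 - cmod c3\<bar> * norm x \<le> norm (T3 x - c3 *\<^sub>C x)" by (simp add: abs_mult)
      also have "\<dots> \<le> 1 * ?n x" by simp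
      finally show ?thesis .
    qed
    then show thesis by (rule red[rotated 2]) (use 1 in auto)
  next
    case 2
    have "cmod (c1 - cnj c2 * c3) * norm x \<le> (1 + B2 + cmod c3) * ?n x" if x: "x \<in> S" for x
    proof -
      have "(c1 - cnj c2 * c3) *\<^sub>C x = T2' (T3 x - c3 *\<^sub>C x) + c3 *\<^sub>C (T2' x - cnj c2 *\<^sub>C x) - (T1 x - c1 *\<^sub>C x)"
      proof -
        have "(c1 - cnj c2 * c3) *\<^sub>C x = c1 *\<^sub>C x - c3 *\<^sub>C cnj c2 *\<^sub>C x"
          using scaleC_add_left[of "c1 - cnj c2 * c3" "cnj c2 * c3" x]
          by (simp add: scaleC_scaleC mult.commute)
        then show ?thesis using x
          by (simp add: bounded_op_diff[OF bounded(7) S'] bounded_op_scaleC[OF bounded(7)]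
              in_S csubspace_scaleC[OF S']
              T1_eq scaleC_diff_right)
      qed
      then have "cmod (c1 - cnj c2 * c3) * norm x \<le> norm (T2' (T3 x - c3 *\<^sub>C x)) + norm (c3 *\<^sub>C (T2' x - cnj c2 *\<^sub>C
          x)) + norm (T1 x - c1 *\<^sub>C x)"
        unfolding norm_scaleC[symmetric]
        by (simp only:) (rule order_trans[OF norm_triangle_ineq4 add_right_mono[OF norm_triangle_ineq]])
      also have "\<dots> \<le> B2 * norm (T3 x - c3 *\<^sub>C x) + cmod c3 * norm (T2 x - c2 *\<^sub>C x) + 1 * norm (T1 x - c1 *\<^sub>C x)"
        using B2(2)[OF shift_S(3)[OF x]] by (simp add: norm_scaleC n2[OF x])
      also have "\<dots> \<le> B2 * ?n x + cmod c3 * ?n x + 1 * ?n x"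
        using B2 by (intro add_mono mult_left_mono) auto
      finally show ?thesis by (simp add: algebra_simps)
    qed
    then show thesis by (rule red[rotated 2]) (use 2 B2 in \<open>auto simp: add_pos_nonneg\<close>)
  next
    case 3
    have "\<bar>1 - ((cmod c0)\<^sup>2 + (cmod c1)\<^sup>2)\<bar> * norm x \<le> (B0 + cmod c0 + B1 + cmod c1) * ?n x" if x: "x \<in> S" for x
    proof -
      have "(1 - ((cmod c0)\<^sup>2 + (cmod c1)\<^sup>2)) *\<^sub>R x = (T0' (T0 x) - c0 *\<^sub>C cnj c0 *\<^sub>C x) + (T1' (T1 x) - c1 *\<^sub>C cnj c1
          *\<^sub>C x)"
      proof -
        have "c *\<^sub>C cnj c *\<^sub>C x = (cmod c)\<^sup>2 *\<^sub>R x" for c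
          unfolding scaleC_scaleC complex_norm_square[symmetric] by (simp add: scaleR_scaleC)
        then show ?thesis using sum_one[OF x] by (simp add: algebra_simps)
      qed
      also have "\<dots> = T0' (T0 x - c0 *\<^sub>C x) + c0 *\<^sub>C (T0' x - cnj c0 *\<^sub>C x) + (T1' (T1 x - c1 *\<^sub>C x) + c1 *\<^sub>C (T1' x -
          cnj c1 *\<^sub>C x))"
        using x by (simp add: bounded_op_diff[OF bounded(5) S'] bounded_op_scaleC[OF bounded(5)]
            bounded_op_diff[OF bounded(6) S'] bounded_op_scaleC[OF bounded(6)] in_S csubspace_scaleC[OF S']
                scaleC_diff_right)
      finally have "\<bar>1 - ((cmod c0)\<^sup>2 + (cmod c1)\<^sup>2)\<bar> * norm x = norm (T0' (T0 x - c0 *\<^sub>C x) + c0 *\<^sub>C (T0' x - cnj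
          c0 *\<^sub>C x) +
          (T1' (T1 x - c1 *\<^sub>C x) + c1 *\<^sub>C (T1' x - cnj c1 *\<^sub>C x)))"
        by (metis norm_scaleR)
      also have "\<dots> \<le> (norm (T0' (T0 x - c0 *\<^sub>C x)) + norm (c0 *\<^sub>C (T0' x - cnj c0 *\<^sub>C x))) +
          (norm (T1' (T1 x - c1 *\<^sub>C x)) + norm (c1 *\<^sub>C (T1' x - cnj c1 *\<^sub>C x)))"
        by (rule order_trans[OF norm_triangle_ineq add_mono[OF norm_triangle_ineq norm_triangle_ineq]])
      also have "\<dots> \<le> (B0 * norm (T0 x - c0 *\<^sub>C x) + cmod c0 * norm (T0 x - c0 *\<^sub>C x)) +
          (B1 * norm (T1 x - c1 *\<^sub>C x) + cmod c1 * norm (T1 x - c1 *\<^sub>C x))"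
        using B0(2)[OF shift_S(1)[OF x]] B1(2)[OF shift_S(2)[OF x]] by (simp add: norm_scaleC n0[OF x] n1[OF x])
      also have "\<dots> \<le> (B0 * ?n x + cmod c0 * ?n x) + (B1 * ?n x + cmod c1 * ?n x)"
        using B0 B1 by (intro add_mono mult_left_mono) auto
      finally show ?thesis by (simp add: algebra_simps)
    qed
    then show thesis by (rule red[rotated 2]) (use 3 B0 B1 in \<open>auto simp: add_pos_nonneg\<close>)
  qed
qed

lemma hexablock_unitary_of_normal:
  assumes normal: "\<And>x. x \<in> S \<Longrightarrow> T0' (T0 x) = T0 (T0' x)"
  shows "hexablock_unitary S (T0, T1, T2, T3)"
proof -
  define Ts where "Ts = [T0, T1, T2, T3]"
  define Ts' where "Ts' = [T0', T1', T2', T3']"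
  have four: "i = 0 \<or> i = 1 \<or> i = 2 \<or> i = 3" if "i < 4" for i :: nat using that by linarith
  have ad: "adjoint_on S (Ts ! i) (Ts' ! i)" if "i < 4" for i
    using four[OF that] ad0 ad1 ad2 ad3 by (elim disjE) (simp_all add: Ts_def Ts'_def numeral_2_eq_2 numeral_3_eq_3)
  have comm: "(Ts ! i) ((Ts ! j) x) = (Ts ! j) ((Ts ! i) x)" if "i < 4" "j < 4" "x \<in> S" for i j x
    using four[OF that(1)] four[OF that(2)] that(3) c01 c02 c03 c12 c13 c23
    by (elim disjE) (simp_all add: Ts_def numeral_2_eq_2 numeral_3_eq_3)
  have comm': "(Ts ! i) ((Ts' ! j) x) = (Ts' ! j) ((Ts ! i) x)" if "i < 4" "j < 4" "x \<in> S" for i j x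
    using four[OF that(1)] four[OF that(2)] that(3) normal T0_commute_adjoint T1_commute_adjoint
      T2_commute_adjoint T3_commute_adjoint T0'_commute
    by (elim disjE) (simp_all add: Ts_def Ts'_def numeral_2_eq_2 numeral_3_eq_3)
  have "cs \<in> quad_list ` hexa_boundary" if cs: "cs \<in> taylor_spectrum S Ts" for cs
  proof (rule ccontr)
    assume not: "cs \<notin> quad_list ` hexa_boundary"
    have len: "length cs = 4" using cs by (simp add: taylor_spectrum_def Ts_def)
    then obtain c0 c1 c2 c3 where cs_eq: "cs = [c0, c1, c2, c3]"
      by (auto simp: numeral_eq_Suc length_Suc_conv)
    have "(c0, c1, c2, c3) \<notin> hexa_boundary"
      using not cs_eq by (auto simp: image_iff)
    from bounded_below[OF normal this] obtain d where d: "d > 0" "\<And>x. x \<in> S \<Longrightarrow> d * norm x \<le>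
        norm (T0 x - c0 *\<^sub>C x) + norm (T1 x - c1 *\<^sub>C x) + norm (T2 x - c2 *\<^sub>C x) + norm (T3 x - c3 *\<^sub>C x)" by blast
    let ?U = "map2 (\<lambda>T c x. T x - c *\<^sub>C x) Ts cs"
    have U: "?U ! i = (\<lambda>x. (Ts ! i) x - cs ! i *\<^sub>C x)" if "i < 4" for i
      using that len by (simp add: Ts_def)
    have bT: "bounded_op S (Ts ! i)" "bounded_op S (Ts' ! i)" if "i < 4" for i
      using adjoint_on_bounded[OF ad[OF that]] by auto
    have "taylor_nonsingular S ?U"
    proof (rule taylor_nonsingular_normal[OF S, of 4])
      show "4 = length ?U" by (simp add: Ts_def len)
      fix i :: nat assume i: "i < 4"
      show "adjoint_on S (?U ! i) (\<lambda>x. (Ts' ! i) x - cnj (cs ! i) *\<^sub>C x)"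
        unfolding U[OF i] by (intro adjoint_on_minus S' ad[OF i] adjoint_on_scale adjoint_on_ident)
      fix j :: nat and x assume j: "j < 4" and x: "x \<in> S"
      show "(?U ! i) ((?U ! j) x) = (?U ! j) ((?U ! i) x)"
        using x unfolding U[OF i] U[OF j]
        by (simp add: bounded_op_diff[OF bT(1) S'] bounded_op_scaleC[OF bT(1)] bounded_op_in[OF bT(1)] i j
            csubspace_scaleC[OF S'] comm scaleC_diff_right scaleC_scaleC mult.commute)
      show "(?U ! i) ((Ts' ! j) x - cnj (cs ! j) *\<^sub>C x) = (Ts' ! j) ((?U ! i) x) - cnj (cs ! j) *\<^sub>C (?U ! i) x"
        using x unfolding U[OF i]
        by (simp add: bounded_op_diff[OF bT(1) S'] bounded_op_scaleC[OF bT(1)] bounded_op_diff[OF bT(2) S']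
            bounded_op_scaleC[OF bT(2)] bounded_op_in[OF bT(1)] bounded_op_in[OF bT(2)] i j
            csubspace_scaleC[OF S'] comm' scaleC_diff_right scaleC_scaleC mult.commute)
    next
      show "d\<^sup>2 / 4 > 0" using d by simp
      fix x assume x: "x \<in> S"
      let ?a = "norm (T0 x - c0 *\<^sub>C x)" and ?b = "norm (T1 x - c1 *\<^sub>C x)" and ?c = "norm (T2 x - c2 *\<^sub>C x)"
        and ?e = "norm (T3 x - c3 *\<^sub>C x)"
      have "(d * norm x)\<^sup>2 \<le> (?a + ?b + ?c + ?e)\<^sup>2" using d x by (intro power_mono) auto
      also have "\<dots> \<le> 4 * (?a\<^sup>2 + ?b\<^sup>2 + ?c\<^sup>2 + ?e\<^sup>2)"
      proof -
        have "4 * (?a\<^sup>2 + ?b\<^sup>2 + ?c\<^sup>2 + ?e\<^sup>2) - (?a + ?b + ?c + ?e)\<^sup>2 =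
            (?a - ?b)\<^sup>2 + (?a - ?c)\<^sup>2 + (?a - ?e)\<^sup>2 + (?b - ?c)\<^sup>2 + (?b - ?e)\<^sup>2 + (?c - ?e)\<^sup>2"
          by algebra
        also have "\<dots> \<ge> 0" by simp
        finally show ?thesis by linarith
      qed
      also have "?a\<^sup>2 + ?b\<^sup>2 + ?c\<^sup>2 + ?e\<^sup>2 = (\<Sum>i<4. (norm ((?U ! i) x))\<^sup>2)"
        by (simp add: Ts_def cs_eq numeral_eq_Suc)
      finally show "d\<^sup>2 / 4 * (norm x)\<^sup>2 \<le> (\<Sum>i<4. (norm ((?U ! i) x))\<^sup>2)"
        by (simp add: power_mult_distrib)
    qed
    then show False using cs by (simp add: taylor_spectrum_def)
  qed
  then have spec: "taylor_spectrum S Ts \<subseteq> quad_list ` distinguished_boundary"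
    by (auto simp: distinguished_boundary_eq)
  have "commuting S Ts"
    by (auto simp: commuting_def comm_def Ts_def c01 c02 c03 c12 c13 c23)
  moreover have normal_Ts: "normal_op S (Ts ! i)" if i: "i < 4" for i
    using adjoint_on_bounded[OF ad[OF i]] comm'[OF i i] adj_eq[OF S' ad[OF i]]
    by (simp add: normal_op_def comm_def bounded_op_in)
  ultimately show ?thesis
    using spec normal_Ts[of 0] normal_Ts[of 1] normal_Ts[of 2] normal_Ts[of 3]
    by (simp add: hexablock_unitary_def Ts_def numeral_2_eq_2 numeral_3_eq_3)
qed

end

section \<open>Normal extensions\<close>

text \<open>The isometric image of a complete space is complete.\<close>

lemma closed_csubspace_isometric_image:
  fixes J :: "'a::chilbert_space \<Rightarrow> 'b::complex_inner"
  assumes S: "closed_csubspace S" and J: "isometric S S' J"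
  shows "closed_csubspace (J ` S)"
proof -
  have S': "csubspace S" "closed S" using S by (auto dest: closed_csubspaceD)
  have lin: "clinear_on S J" and norm: "\<And>x. x \<in> S \<Longrightarrow> norm (J x) = norm x" using J by (auto simp: isometric_def)
  have "csubspace (J ` S)" by (rule csubspace_image[OF S'(1) lin])
  moreover have "closed (J ` S)"
    unfolding closed_sequential_limits
  proof (intro allI impI, elim conjE)
    fix f l assume f: "\<forall>n. f n \<in> J ` S" and l: "f \<longlonglongrightarrow> l"
    from f obtain x where x: "\<And>n. x n \<in> S" "\<And>n. f n = J (x n)" unfolding image_iff by metis
    have d: "dist (J u) (J v) = dist u v" if "u \<in> S" "v \<in> S" for u v
      using norm[OF csubspace_diff[OF S'(1) that]] clinear_on_diff[OF lin S'(1) that] by (simp add: dist_norm)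
    have "Cauchy f" by (rule LIMSEQ_imp_Cauchy[OF l])
    then have "Cauchy x" by (simp add: Cauchy_def x d)
    then obtain y where y: "x \<longlonglongrightarrow> y" using Cauchy_convergent convergent_def by blast
    have yS: "y \<in> S" by (rule closed_sequentially[OF S'(2) x(1) y])
    have "f \<longlonglongrightarrow> J y"
      unfolding tendsto_dist_iff[of f] using y by (simp add: x d yS flip: tendsto_dist_iff)
    then have "l = J y" using l LIMSEQ_unique by blast
    then show "l \<in> J ` S" using yS by blast
  qed
  ultimately show ?thesis by (simp add: closed_csubspace_def)
qed

text \<open>The space \<open>S \<oplus> S\<close> is realized by the coefficients of \<open>1\<close> and \<open>z\<close>, because a hexablock isometry on \<open>S\<close> has to
  extend to a unitary quadruple on a subspace of this Hardy space.\<close>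

definition pair :: "'a::chilbert_space \<Rightarrow> 'a \<Rightarrow> 'a hardy"
  where "pair x y = hardy_monom 0 \<otimes> x + hardy_monom 1 \<otimes> y"

definition pair_space :: "'a::chilbert_space set \<Rightarrow> 'a hardy set"
  where "pair_space S = {F. \<forall>n. taylor_coeff F n \<in> (if n < 2 then S else {0})}"

definition block :: "('a::chilbert_space \<Rightarrow> 'a) \<Rightarrow> ('a \<Rightarrow> 'a) \<Rightarrow> ('a \<Rightarrow> 'a) \<Rightarrow> ('a \<Rightarrow> 'a) \<Rightarrow> 'a hardy \<Rightarrow> 'a hardy"
  where "block a b c d F = pair (a (taylor_coeff F 0) + b (taylor_coeff F (Suc 0))) (c (taylor_coeff F 0) + d
      (taylor_coeff F (Suc 0)))"

lemma taylor_coeff_pair: "taylor_coeff (pair x y) n = (if n = 0 then x else if n = 1 then y else 0)"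
  by (simp add: pair_def taylor_coeff_add taylor_coeff_monom_tensor)

lemma taylor_coeff_block:
  "taylor_coeff (block a b c d F) 0 = a (taylor_coeff F 0) + b (taylor_coeff F (Suc 0))"
  "taylor_coeff (block a b c d F) (Suc 0) = c (taylor_coeff F 0) + d (taylor_coeff F (Suc 0))"
  by (simp_all add: block_def taylor_coeff_pair)

lemma closed_csubspace_zero: "closed_csubspace {0}"
  by (simp add: closed_csubspace_def csubspace_def)

lemma closed_csubspace_pair_space: "closed_csubspace S \<Longrightarrow> closed_csubspace (pair_space S)"
  unfolding pair_space_def by (rule closed_csubspace_coeffs) (simp add: closed_csubspace_zero)

lemma pair_space_coeff:
  assumes "F \<in> pair_space S"
  shows "taylor_coeff F 0 \<in> S" "taylor_coeff F (Suc 0) \<in> S" "n \<ge> 2 \<Longrightarrow> taylor_coeff F n = 0"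
proof -
  have *: "taylor_coeff F n \<in> (if n < 2 then S else {0})" for n using assms by (simp add: pair_space_def)
  show "taylor_coeff F 0 \<in> S" "taylor_coeff F (Suc 0) \<in> S" "n \<ge> 2 \<Longrightarrow> taylor_coeff F n = 0"
    using *[of 0] *[of 1] *[of n] by auto
qed

lemma pair_in_pair_space: "x \<in> S \<Longrightarrow> y \<in> S \<Longrightarrow> pair x y \<in> pair_space S"
  by (auto simp: pair_space_def taylor_coeff_pair)

lemma pair_space_eqI:
  assumes "F \<in> pair_space S" "G \<in> pair_space S'"
    "taylor_coeff F 0 = taylor_coeff G 0" "taylor_coeff F (Suc 0) = taylor_coeff G (Suc 0)"
  shows "F = G"
proof (rule hardy_eqI)
  fix n :: nat
  consider "n = 0" | "n = 1" | "n \<ge> 2" by linarith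
  then show "taylor_coeff F n = taylor_coeff G n"
    by cases (use assms pair_space_coeff(3)[OF assms(1)] pair_space_coeff(3)[OF assms(2)] in auto)
qed

lemma cinner_pair_space:
  assumes "F \<in> pair_space S"
  shows "cinner F G = cinner (taylor_coeff F 0) (taylor_coeff G 0) + cinner (taylor_coeff F (Suc 0))
      (taylor_coeff G (Suc 0))"
proof -
  have "cinner (taylor_coeff F n) (taylor_coeff G n) = 0" if "n \<notin> {0, 1}" for n
    using that pair_space_coeff(3)[OF assms, of n] by (simp add: cinner_zero_left)
  then show ?thesis unfolding cinner_hardy_def by (subst suminf_finite[of "{0, 1}"]) auto
qed

lemma norm_pair_le: "norm (pair x y) \<le> norm x + norm y"
proof -
  have "norm (hardy_monom n \<otimes> v) = norm v" for n and v :: 'a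
  proof (rule norm_eq_of_cinner_eq)
    have "cinner (hardy_monom n) (hardy_monom n) = (\<Sum>k. if k = n then 1 else 0)"
      unfolding cinner_hardy_def by (rule arg_cong[of _ _ suminf]) (auto simp: taylor_coeff_hardy_monom
          cinner_complex_def)
    also have "\<dots> = 1" by (subst suminf_finite[of "{n}"]) auto
    finally show "cinner (hardy_monom n \<otimes> v) (hardy_monom n \<otimes> v) = cinner v v" by (simp add: cinner_tensor)
  qed
  then show ?thesis unfolding pair_def by (metis norm_triangle_ineq)
qed

lemma adjoint_on_block:
  assumes S: "csubspace S" and a: "adjoint_on S a a'" and b: "adjoint_on S b b'"
    and c: "adjoint_on S c c'" and d: "adjoint_on S d d'"
  shows "adjoint_on (pair_space S) (block a b c d) (block a' c' b' d')"
proof -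
  have bd: "bounded_op (pair_space S) (block a b c d)"
    if T: "bounded_op S a" "bounded_op S b" "bounded_op S c" "bounded_op S d" for a b c d
  proof -
    obtain A where A: "A > 0" "\<And>x. x \<in> S \<Longrightarrow> norm (a x) \<le> A * norm x" using bounded_op_bound[OF T(1)] by blast
    obtain B where B: "B > 0" "\<And>x. x \<in> S \<Longrightarrow> norm (b x) \<le> B * norm x" using bounded_op_bound[OF T(2)] by blast
    obtain C where C: "C > 0" "\<And>x. x \<in> S \<Longrightarrow> norm (c x) \<le> C * norm x" using bounded_op_bound[OF T(3)] by blast
    obtain D where D: "D > 0" "\<And>x. x \<in> S \<Longrightarrow> norm (d x) \<le> D * norm x" using bounded_op_bound[OF T(4)] by blast
    have in_S: "x \<in> S \<Longrightarrow> y \<in> S \<Longrightarrow> a x + b y \<in> S" "x \<in> S \<Longrightarrow> y \<in> S \<Longrightarrow> c x + d y \<in> S" for x y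
      by (simp_all add: csubspace_add[OF S] T[THEN bounded_op_in])
    have block_in: "block a b c d F \<in> pair_space S" if "F \<in> pair_space S" for F
      unfolding block_def using pair_space_coeff[OF that] by (intro pair_in_pair_space in_S)
    show ?thesis
    proof (rule bounded_opI)
      fix F assume F: "F \<in> pair_space S"
      note f = pair_space_coeff[OF F]
      show "block a b c d F \<in> pair_space S" by (rule block_in[OF F])
      show "block a b c d (z *\<^sub>C F) = z *\<^sub>C block a b c d F" for z
        by (rule hardy_eqI)
          (simp add: block_def taylor_coeff_pair taylor_coeff_scaleC T[THEN bounded_op_scaleC] f scaleC_add_right)
      have "norm (block a b c d F) \<le> norm (a (taylor_coeff F 0) + b (taylor_coeff F (Suc 0))) + norm (c
          (taylor_coeff F 0) + d (taylor_coeff F (Suc 0)))"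
        unfolding block_def by (rule norm_pair_le)
      also have "\<dots> \<le> (norm (a (taylor_coeff F 0)) + norm (b (taylor_coeff F (Suc 0)))) + (norm (c (taylor_coeff
          F 0)) + norm (d (taylor_coeff F (Suc 0))))"
        by (intro add_mono norm_triangle_ineq)
      also have "\<dots> \<le> (A * norm F + B * norm F) + (C * norm F + D * norm F)"
        by (intro add_mono order_trans[OF A(2)[OF f(1)]] order_trans[OF B(2)[OF f(2)]] order_trans[OF C(2)[OF f(1)]]
            order_trans[OF D(2)[OF f(2)]] mult_left_mono norm_taylor_coeff_le less_imp_le[OF A(1)]
                less_imp_le[OF B(1)]
            less_imp_le[OF C(1)] less_imp_le[OF D(1)])
      also have "\<dots> = (A + B + C + D) * norm F" by (simp add: algebra_simps)
      finally show "norm (block a b c d F) \<le> (A + B + C + D) * norm F" .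
      fix G assume G: "G \<in> pair_space S"
      show "block a b c d (F + G) = block a b c d F + block a b c d G"
        by (rule hardy_eqI)
          (simp add: block_def taylor_coeff_pair taylor_coeff_add T[THEN bounded_op_add] f pair_space_coeff[OF G])
    qed
  qed
  have b1: "bounded_op (pair_space S) (block a b c d)" and b2: "bounded_op (pair_space S) (block a' c' b' d')"
    using a b c d by (auto intro!: bd dest: adjoint_on_bounded)
  have "cinner (block a b c d F) G = cinner F (block a' c' b' d' G)" if F: "F \<in> pair_space S"
      and G: "G \<in> pair_space S" for F G
    unfolding cinner_pair_space[OF F] cinner_pair_space[OF bounded_op_in[OF b1 F]] taylor_coeff_block
    using pair_space_coeff[OF F] pair_space_coeff[OF G]
    by (simp add: cinner_simps adjoint_on_cinner[OF a] adjoint_on_cinner[OF b] adjoint_on_cinner[OF c]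
        adjoint_on_cinner[OF d])
  with b1 b2 show ?thesis by (simp add: adjoint_on_def)
qed

lemma adjoint_on_zero: "csubspace S \<Longrightarrow> adjoint_on S (\<lambda>x. 0) (\<lambda>x. 0)"
  unfolding adjoint_on_def by (auto intro!: bounded_opI[where B = 0] simp: csubspace_0 cinner_zero_left)

context boundary_relations
begin

definition self_comm :: "'a \<Rightarrow> 'a"
  where "self_comm x = T0' (T0 x) - T0 (T0' x)"

lemma adjoint_on_self_comm: "adjoint_on S self_comm self_comm"
  unfolding self_comm_def
  by (intro adjoint_on_minus S' adjoint_on_comp[OF adjoint_on_sym[OF ad0] ad0]
      adjoint_on_comp[OF ad0 adjoint_on_sym[OF ad0]])

lemma self_comm_in_S: "x \<in> S \<Longrightarrow> self_comm x \<in> S"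
  by (rule bounded_op_in[OF adjoint_on_bounded(1)[OF adjoint_on_self_comm]])

lemma self_comm_T0: "x \<in> S \<Longrightarrow> self_comm (T0 x) = 0"
  by (simp add: self_comm_def quasinormal in_S)

text \<open>The adjoint of the preceding relation.\<close>

lemma T0'_self_comm: "x \<in> S \<Longrightarrow> T0' (self_comm x) = 0"
  by (rule csubspace_eq_0I[of _ S])
    (simp_all add: in_S self_comm_in_S adjoint_on_cinner[OF adjoint_on_sym[OF ad0]]
      adjoint_on_cinner[OF adjoint_on_self_comm] self_comm_T0)

lemma self_comm_square: "x \<in> S \<Longrightarrow> self_comm (self_comm x) = T0' (T0 (self_comm x))"
  using T0'_self_comm[of x] bounded_op_0[OF bounded(1) S'] by (simp add: self_comm_def[of "self_comm x"])

lemma self_comm_commute: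
  assumes "x \<in> S"
  shows "self_comm (T1 x) = T1 (self_comm x)" "self_comm (T2 x) = T2 (self_comm x)"
      "self_comm (T3 x) = T3 (self_comm x)"
  using assms by (simp_all add: self_comm_def bounded_op_diff[OF bounded(2) S'] bounded_op_diff[OF bounded(3) S']
    bounded_op_diff[OF bounded(4) S'] in_S T0'_commute c01[symmetric] c02[symmetric] c03[symmetric])

text \<open>A quasinormal operator is hyponormal: \<open>Z = T\<^sub>0\<^sup>* T\<^sub>0 - T\<^sub>0 T\<^sub>0\<^sup>*\<close> is positive on its range, because
  \<open>Z\<^sup>2 = T\<^sub>0\<^sup>* T\<^sub>0 Z\<close>, and vanishes on the orthogonal complement of its range.\<close>

lemma self_comm_nonneg:
  assumes x: "x \<in> S"
  shows "0 \<le> Re (cinner (self_comm x) x)"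
proof -
  note ad = adjoint_on_self_comm
  note bZ = adjoint_on_bounded(1)[OF ad]
  let ?M = "closure (self_comm ` S)"
  have cl: "closed S" using S by (rule closed_csubspaceD)
  have MS: "?M \<subseteq> S" using self_comm_in_S by (intro closure_minimal cl) auto
  have M: "closed_csubspace ?M"
    by (intro closed_csubspace_closure csubspace_image S' bounded_op_clinear[OF bZ])
  obtain p where p: "p \<in> ?M" "\<And>y. y \<in> ?M \<Longrightarrow> cinner (x - p) y = 0"
    using orthogonal_projection[OF M] by blast
  have pS: "p \<in> S" using p(1) MS by blast
  have v: "x - p \<in> S" by (rule csubspace_diff[OF S' x pS])
  have "self_comm (x - p) = 0"
  proof (rule csubspace_eq_0I[of _ S, OF self_comm_in_S[OF v]])
    fix y assume y: "y \<in> S"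
    have "self_comm y \<in> ?M" by (rule subsetD[OF closure_subset imageI[OF y]])
    then show "cinner (self_comm (x - p)) y = 0" using adjoint_on_cinner[OF ad v y] p(2) by simp
  qed
  then have eq: "self_comm x = self_comm p" by (simp add: bounded_op_diff[OF bZ S' x pS])
  have "cinner (self_comm x) x = cinner p (self_comm x)" using adjoint_on_cinner[OF ad pS x] by (simp add: eq)
  also have "\<dots> = cinner (self_comm p) p" unfolding eq using adjoint_on_cinner[OF ad pS pS] by simp
  finally have *: "cinner (self_comm x) x = cinner (self_comm p) p" .
  obtain f where f: "\<forall>n. f n \<in> self_comm ` S" and fp: "f \<longlonglongrightarrow> p" using p(1) unfolding closure_sequential by blast
  then obtain w where w1: "\<And>n. w n \<in> S" and w: "\<And>n. f n = self_comm (w n)" unfolding image_iff by metis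
  have w2: "(\<lambda>n. self_comm (w n)) \<longlonglongrightarrow> p" using fp by (simp add: w[symmetric])
  have pos: "0 \<le> Re (cinner (self_comm (self_comm y)) (self_comm y))" if y: "y \<in> S" for y
  proof -
    have "cinner (self_comm (self_comm y)) (self_comm y) = cinner (T0 (self_comm y)) (T0 (self_comm y))"
      using y adjoint_on_cinner[OF adjoint_on_sym[OF ad0], of "T0 (self_comm y)" "self_comm y"]
      by (simp add: self_comm_square in_S self_comm_in_S)
    then show ?thesis by (simp add: cinner_self)
  qed
  have "(\<lambda>n. inner (self_comm (self_comm (w n))) (self_comm (w n))) \<longlonglongrightarrow> inner (self_comm p) p"
    by (rule tendsto_inner[OF bounded_op_tendsto[OF S' bZ self_comm_in_S[OF w1] pS w2] w2])
  then have "0 \<le> inner (self_comm p) p"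
    by (rule LIMSEQ_le_const) (use pos[OF w1] in \<open>auto simp: inner_eq_Re_cinner\<close>)
  then show ?thesis by (simp add: * inner_eq_Re_cinner)
qed

text \<open>\<open>Z\<^sup>2 = T\<^sub>0\<^sup>* T\<^sub>0 Z = Z - T\<^sub>1\<^sup>* Z T\<^sub>1 \<le> Z\<close>. So \<open>1 - Z\<close> is a contraction and \<open>Z\<close> has a positive square root.\<close>

lemma norm_one_minus_self_comm_le:
  assumes x: "x \<in> S"
  shows "norm (x - self_comm x) \<le> norm x"
proof (rule power2_le_imp_le)
  note ad = adjoint_on_self_comm
  have Zx: "self_comm x \<in> S" by (rule self_comm_in_S[OF x])
  have "cinner (self_comm x) (self_comm x) = cinner (self_comm (self_comm x)) x"
    using adjoint_on_cinner[OF ad Zx x] by simp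
  also have "self_comm (self_comm x) = self_comm x - T1' (T1 (self_comm x))"
    using sum_one[OF Zx] self_comm_square[OF x] by (simp add: eq_diff_eq)
  also have "cinner (self_comm x - T1' (T1 (self_comm x))) x = cinner (self_comm x) x - cinner (self_comm (T1
      x)) (T1 x)"
    using x Zx by (simp add: cinner_diff_left self_comm_commute adjoint_on_cinner[OF adjoint_on_sym[OF ad1]] in_S)
  finally have "(norm (self_comm x))\<^sup>2 \<le> Re (cinner (self_comm x) x)"
    using self_comm_nonneg[OF in_S(2)[OF x]] by (simp add: cinner_self complex_eq_iff)
  moreover have "(norm (x - self_comm x))\<^sup>2 = (norm x)\<^sup>2 - 2 * Re (cinner (self_comm x) x) + (norm (self_comm x))\<^sup>2"
    by (simp add: power2_norm_eq_inner inner_simps inner_commute inner_eq_Re_cinner[of "self_comm x" x, symmetric])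
  ultimately show "(norm (x - self_comm x))\<^sup>2 \<le> (norm x)\<^sup>2"
    using self_comm_nonneg[OF x] by linarith
qed simp

text \<open>The normal extension is the matrix with rows \<open>T\<^sub>0, C\<close> and \<open>0, T\<^sub>0\<^sup>*\<close>, where \<open>C\<close> is the square root of
  the self-commutator \<open>Z\<close>. It is normal because \<open>Z T\<^sub>0 = 0\<close> forces \<open>C T\<^sub>0 = 0\<close> and \<open>T\<^sub>0\<^sup>* C = 0\<close>, and the other three
  operators are doubled diagonally, as they commute with \<open>C\<close>.\<close>

lemma hexablock_isometry: "hexablock_isometry S (T0, T1, T2, T3)"
proof -
  have "adjoint_on S (\<lambda>x. x - self_comm x) (\<lambda>x. x - self_comm x)"
    by (intro adjoint_on_minus S' adjoint_on_ident adjoint_on_self_comm)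
  then obtain C where pC: "positive_op S C" and CC: "\<And>x. x \<in> S \<Longrightarrow> C (C x) = x - (x - self_comm x)"
    and Ccomm: "\<And>T x. bounded_op S T \<Longrightarrow> (\<And>x. x \<in> S \<Longrightarrow> T (x - self_comm x) = T x - self_comm (T x)) \<Longrightarrow> x \<in> S \<Longrightarrow> T (C
        x) = C (T x)"
    by (rule positive_sqrt_exists[OF S _ norm_one_minus_self_comm_le]) auto
  have adC: "adjoint_on S C C" by (rule positive_op_adjoint[OF S' pC])
  note bC = adjoint_on_bounded(1)[OF adC]
  note C_S = bounded_op_in[OF bC]
  have C_T0: "C (T0 x) = 0" if x: "x \<in> S" for x
  proof -
    have "cinner (C (T0 x)) (C (T0 x)) = cinner (C (C (T0 x))) (T0 x)"
      using adjoint_on_cinner[OF adC C_S[OF in_S(1)[OF x]] in_S(1)[OF x]] by simp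
    also have "\<dots> = 0" using x by (simp add: CC in_S self_comm_T0 cinner_zero_left)
    finally show ?thesis by (simp add: cinner_self_eq_0)
  qed
  have T0'_C: "T0' (C x) = 0" if x: "x \<in> S" for x
    by (rule csubspace_eq_0I[of _ S])
      (use x in \<open>simp_all add: in_S C_S adjoint_on_cinner[OF adjoint_on_sym[OF ad0]] adjoint_on_cinner[OF adC] C_T0\<close>)
  have C_comm: "T1 (C x) = C (T1 x)" "T2 (C x) = C (T2 x)" "T3 (C x) = C (T3 x)" if "x \<in> S" for x
    by (rule Ccomm[OF bounded(2) _ that], simp add: bounded_op_diff[OF bounded(2) S']
        self_comm_in_S self_comm_commute,
        rule Ccomm[OF bounded(3) _ that], simp add: bounded_op_diff[OF bounded(3) S']
            self_comm_in_S self_comm_commute,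
        rule Ccomm[OF bounded(4) _ that], simp add: bounded_op_diff[OF bounded(4) S']
            self_comm_in_S self_comm_commute)
  define Z where "Z = (\<lambda>x::'a. 0::'a)"
  have adZ: "adjoint_on S Z Z" unfolding Z_def by (rule adjoint_on_zero[OF S'])
  have Z0: "Z x = 0" for x by (simp add: Z_def)
  let ?L = "pair_space S"
  let ?N0 = "block T0 C Z T0'" and ?N0' = "block T0' Z C T0"
  let ?D = "\<lambda>T. block T Z Z T"
  have L: "closed_csubspace ?L" by (rule closed_csubspace_pair_space[OF S])
  have a0: "adjoint_on ?L ?N0 ?N0'"
    by (rule adjoint_on_block[OF S' ad0 adC adZ adjoint_on_sym[OF ad0]])
  have aD: "adjoint_on ?L (?D T) (?D T')" if "adjoint_on S T T'" for T T'
    by (rule adjoint_on_block[OF S' that adZ adZ that])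
  note bL = adjoint_on_bounded[OF a0] adjoint_on_bounded[OF aD[OF ad1]] adjoint_on_bounded[OF aD[OF ad2]]
      adjoint_on_bounded[OF aD[OF ad3]]
  note inL = bL[THEN bounded_op_in]
  note zero = bounded[THEN bounded_op_0, OF S'] bounded_op_0[OF bC S']
  have R: "T0' (T0 x) = x - T1' (T1 x)" if "x \<in> S" for x using sum_one[OF that] by (simp add: eq_diff_eq)
  have ext: "boundary_relations ?L ?N0 (?D T1) (?D T2) (?D T3) ?N0' (?D T1') (?D T2') (?D T3')"
  proof
    show "closed_csubspace ?L" by (rule L)
    show "adjoint_on ?L ?N0 ?N0'" by (rule a0)
    show "adjoint_on ?L (?D T1) (?D T1')" "adjoint_on ?L (?D T2) (?D T2')" "adjoint_on ?L (?D T3) (?D T3')"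
      by (intro aD ad1 ad2 ad3)+
    fix F assume F: "F \<in> ?L"
    note f = pair_space_coeff(1,2)[OF F]
    show "?N0 (?D T1 F) = ?D T1 (?N0 F)" "?N0 (?D T2 F) = ?D T2 (?N0 F)" "?N0 (?D T3 F) = ?D T3 (?N0 F)"
      by (rule pair_space_eqI[of _ S _ S]; use f F in \<open>simp add: taylor_coeff_block inL Z0 in_S C_S C_comm c01
          c02 c03 T0'_commute
        bounded[THEN bounded_op_add]\<close>)+
    show "?D T1 (?D T2 F) = ?D T2 (?D T1 F)" "?D T1 (?D T3 F) = ?D T3 (?D T1 F)" "?D T2 (?D T3 F) = ?D T3 (?D T2 F)"
      by (rule pair_space_eqI[of _ S _ S]; use f F in \<open>simp add: taylor_coeff_block inL Z0 c12 c13 c23\<close>)+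
    show "?D T3' (?D T3 F) = F" "?D T3 (?D T3' F) = F" "?D T1 F = ?D T2' (?D T3 F)"
      by (rule pair_space_eqI[of _ S _ S]; use f F in \<open>simp add: taylor_coeff_block inL Z0 unitary T1_eq\<close>)+
    show "?N0' (?N0 F) + ?D T1' (?D T1 F) = F"
      by (rule pair_space_eqI[of _ S _ S, OF csubspace_add[OF closed_csubspaceD(1)[OF L]]])
        (use f F in \<open>simp_all add: taylor_coeff_block taylor_coeff_add inL Z0 in_S C_S
          bounded[THEN bounded_op_add] bounded_op_add[OF bC] C_T0 T0'_C CC sum_one self_comm_def\<close>)
  qed
  interpret L: boundary_relations ?L ?N0 "?D T1" "?D T2" "?D T3" ?N0' "?D T1'" "?D T2'" "?D T3'" by (rule ext)
  have "?N0' (?N0 F) = ?N0 (?N0' F)" if F: "F \<in> ?L" for F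
    by (rule pair_space_eqI[of _ S _ S])
      (use pair_space_coeff(1,2)[OF F] F in \<open>simp_all add: taylor_coeff_block inL Z0 in_S C_S
          bounded[THEN bounded_op_add] bounded_op_add[OF bC] C_T0 T0'_C CC self_comm_def\<close>)
  then have uni: "hexablock_unitary ?L (?N0, ?D T1, ?D T2, ?D T3)" by (rule L.hexablock_unitary_of_normal)
  define J where "J x = pair x 0" for x :: 'a
  have J_L: "J x \<in> ?L" if "x \<in> S" for x unfolding J_def by (rule pair_in_pair_space[OF that csubspace_0[OF S']])
  have J: "isometric S ?L J"
    unfolding isometric_def clinear_on_def
  proof (intro conjI ballI allI)
    show "J ` S \<subseteq> ?L" using J_L by blast
    fix x assume x: "x \<in> S"
    show "norm (J x) = norm x"
      by (rule norm_eq_of_cinner_eq) (simp add: cinner_pair_space[OF J_L[OF x]], simp add: J_def taylor_coeff_pair)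
    show "J (c *\<^sub>C x) = c *\<^sub>C J x" for c
      by (rule hardy_eqI) (simp add: J_def taylor_coeff_pair taylor_coeff_scaleC)
    show "J (x + y) = J x + J y" for y
      by (rule hardy_eqI) (simp add: J_def taylor_coeff_pair taylor_coeff_add)
  qed
  have N_J: "?N0 (J x) = J (T0 x)" "?D T1 (J x) = J (T1 x)" "?D T2 (J x) = J (T2 x)" "?D T3 (J x) = J (T3 x)" for x
    by (simp_all add: block_def J_def taylor_coeff_pair Z0 zero)
  have "joint_invariant ?L (J ` S) (quad_list (?N0, ?D T1, ?D T2, ?D T3))"
    using closed_csubspace_isometric_image[OF S J] J_L by (auto simp: joint_invariant_def N_J in_S)
  moreover have "(quad_list (?N0, ?D T1, ?D T2, ?D T3) ! i) (J x) = J ((quad_list (T0, T1, T2, T3) ! i) x)"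
      if "i < 4" for i x
  proof -
    have "i = 0 \<or> i = 1 \<or> i = 2 \<or> i = 3" using that by linarith
    then show ?thesis by (elim disjE) (simp_all add: N_J numeral_2_eq_2 numeral_3_eq_3)
  qed
  moreover have "\<forall>U\<in>set (quad_list (T0, T1, T2, T3)). bounded_op S U" using bounded by simp
  ultimately show ?thesis unfolding hexablock_isometry_def using L uni J by blast
qed

end

lemma hexablock_isometry_restrict:
  fixes S K :: "'a::chilbert_space set"
  assumes K: "closed_csubspace K" and M: "hexablock_isometry S M" and J: "isometric K S J"
    and V: "\<forall>U\<in>set (quad_list V). bounded_op K U"
    and intertwine: "\<And>i x. i < 4 \<Longrightarrow> x \<in> K \<Longrightarrow> (quad_list M ! i) (J x) = J ((quad_list V ! i) x)"
  shows "hexablock_isometry K V"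
proof -
  obtain L N J' where L: "closed_csubspace (L :: 'a hardy set)" "hexablock_unitary L N" "isometric S L J'"
    and N: "\<And>i x. i < 4 \<Longrightarrow> x \<in> S \<Longrightarrow> (quad_list N ! i) (J' x) = J' ((quad_list M ! i) x)"
    using M unfolding hexablock_isometry_def by blast
  have len: "length (quad_list N) = 4" "length (quad_list V) = 4" by (cases N, simp, cases V, simp)
  have JS: "J x \<in> S" if "x \<in> K" for x using J that by (auto simp: isometric_def)
  have I: "isometric K L (\<lambda>x. J' (J x))"
    using J L(3) JS unfolding isometric_def clinear_on_def by auto
  have eq: "(quad_list N ! i) (J' (J x)) = J' (J ((quad_list V ! i) x))" if "i < 4" "x \<in> K" for i x
    using that by (simp add: N JS intertwine)
  have "joint_invariant L ((\<lambda>x. J' (J x)) ` K) (quad_list N)"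
    unfolding joint_invariant_def
  proof (intro conjI ballI)
    show "closed_csubspace ((\<lambda>x. J' (J x)) ` K)" by (rule closed_csubspace_isometric_image[OF K I])
    show "(\<lambda>x. J' (J x)) ` K \<subseteq> L" using I by (simp add: isometric_def)
    fix T assume "T \<in> set (quad_list N)"
    then obtain i where i: "i < 4" "T = quad_list N ! i" using len by (metis in_set_conv_nth)
    then have "quad_list V ! i \<in> set (quad_list V)" using len by simp
    then have "bounded_op K (quad_list V ! i)" using V by blast
    then show "T ` (\<lambda>x. J' (J x)) ` K \<subseteq> (\<lambda>x. J' (J x)) ` K"
      using i eq by (auto simp: bounded_op_in)
  qed
  then show ?thesis unfolding hexablock_isometry_def using V L(1,2) I eq by blast
qed

section \<open>Operators with linear symbol\<close>

text \<open>\<open>shift_op s A B\<close> is \<open>I \<otimes> A + U \<otimes> B\<close> for the isometry \<open>U z\<^sup>n = z\<^bsup>s n\<^esup>\<close>, and \<open>shift_adj s A' B'\<close> its adjoint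
  when \<open>A', B'\<close> are the adjoints of \<open>A, B\<close>. For \<open>s = Suc\<close> this is the analytic Toeplitz operator
  with symbol \<open>A + z B\<close>.\<close>

definition shift_op :: "(nat \<Rightarrow> nat) \<Rightarrow> ('a::chilbert_space \<Rightarrow> 'a) \<Rightarrow> ('a \<Rightarrow> 'a) \<Rightarrow> 'a hardy \<Rightarrow> 'a hardy"
  where "shift_op s A B F = amp A F + push s (amp B F)"

definition shift_adj :: "(nat \<Rightarrow> nat) \<Rightarrow> ('a::chilbert_space \<Rightarrow> 'a) \<Rightarrow> ('a \<Rightarrow> 'a) \<Rightarrow> 'a hardy \<Rightarrow> 'a hardy"
  where "shift_adj s A B F = amp A F + amp B (pull s F)"

context
  fixes E :: "'a::chilbert_space set" and s :: "nat \<Rightarrow> nat"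
  assumes E: "closed_csubspace E" and s: "inj s"
begin

lemma adjoint_on_shift_op:
  assumes "adjoint_on E A A'" "adjoint_on E B B'"
  shows "adjoint_on (hardy_space E) (shift_op s A B) (shift_adj s A' B')"
  unfolding shift_op_def shift_adj_def
  by (intro adjoint_on_plus closed_csubspaceD(1)[OF closed_csubspace_hardy_space[OF E]]
      adjoint_on_amp[OF E assms(1)] adjoint_on_comp[OF adjoint_on_push[OF E s] adjoint_on_amp[OF E assms(2)]])

lemma taylor_coeff_shift_op:
  assumes "bounded_op E A" "bounded_op E B" "F \<in> hardy_space E"
  shows "taylor_coeff (shift_op s A B F) (s m) = A (taylor_coeff F (s m)) + B (taylor_coeff F m)"
  using assms by (simp add: shift_op_def taylor_coeff_add taylor_coeff_push(1)[OF s] inv_f_f[OF s]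
      taylor_coeff_amp(1)[OF E])

lemma pull_in: "F \<in> hardy_space E \<Longrightarrow> pull s F \<in> hardy_space E"
  using adjoint_on_bounded(2)[OF adjoint_on_push[OF E s]] by (rule bounded_op_in)

lemma push_in: "F \<in> hardy_space E \<Longrightarrow> push s F \<in> hardy_space E"
  using adjoint_on_bounded(1)[OF adjoint_on_push[OF E s]] by (rule bounded_op_in)

lemma taylor_coeff_shift_adj:
  assumes "bounded_op E A" "bounded_op E B" "F \<in> hardy_space E"
  shows "taylor_coeff (shift_adj s A B F) n = A (taylor_coeff F n) + B (taylor_coeff F (s n))"
  using assms by (simp add: shift_adj_def taylor_coeff_add taylor_coeff_amp(1)[OF E]
      pull_in taylor_coeff_pull(1)[OF s])

end

lemma tensor_op_amp:
  assumes E: "closed_csubspace E" and B: "bounded_op E B" and F: "F \<in> hardy_space E"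
  shows "tensor_op E id B F = amp B F" and "tensor_op E mult_z B F = push Suc (amp B F)"
proof -
  note adB = adjoint_on_amp[OF E adjoint_on_adj[OF E B]]
  note push = adjoint_on_push[OF E, of Suc, OF inj_Suc]
  have tK: "f \<otimes> v \<in> hardy_space E" if "v \<in> E" for f v
    using that closed_csubspaceD(1)[OF E] by (intro hardy_spaceI[OF E]) (simp add: taylor_coeff_tensor
        csubspace_scaleC)
  have 1: "amp B (f \<otimes> v) = f \<otimes> B v" if "v \<in> E" for f v
    by (rule hardy_eqI) (simp add: taylor_coeff_amp(1)[OF E B tK[OF that]]
        taylor_coeff_tensor bounded_op_scaleC[OF B that])
  show "tensor_op E id B F = amp B F"
    by (rule tensor_op_eq[OF E adjoint_on_bounded(1)[OF adB] _ F]) (simp add: 1)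
  have 2: "push Suc (f \<otimes> w) = mult_z f \<otimes> w" for f and w :: 'a
  proof (rule push_eqI)
    show "taylor_coeff (mult_z f \<otimes> w) n = 0" if "n \<notin> range Suc" for n
      using that by (cases n) (auto simp: taylor_coeff_tensor taylor_coeff_mult_z)
  qed (simp_all add: taylor_coeff_tensor taylor_coeff_mult_z)
  show "tensor_op E mult_z B F = push Suc (amp B F)"
    by (rule tensor_op_eq[OF E bounded_op_comp[OF adjoint_on_bounded(1)[OF push] adjoint_on_bounded(1)[OF adB]] _ F])
      (simp add: 1 2)
qed

text \<open>With \<open>\<nat>\<close> identified with \<open>\<int>\<close>, \<open>L\<^sup>2\<close> of the circle is modelled on \<open>H\<^sup>2\<close>: \<open>push bilateral\<close> is the bilateral
    shift and
  \<open>push embed_nat\<close> the inclusion of \<open>H\<^sup>2\<close> in \<open>L\<^sup>2\<close>.\<close>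

definition bilateral :: "nat \<Rightarrow> nat"
  where "bilateral n = int_encode (int_decode n + 1)"

definition embed_nat :: "nat \<Rightarrow> nat"
  where "embed_nat n = int_encode (int n)"

lemma bij_bilateral: "bij bilateral"
  by (rule bij_betw_byWitness[where f' = "\<lambda>n. int_encode (int_decode n - 1)"]) (auto simp: bilateral_def)

lemma inj_embed_nat: "inj embed_nat"
  by (rule injI) (simp add: embed_nat_def int_encode_eq)

lemma bilateral_embed_nat: "bilateral \<circ> embed_nat = embed_nat \<circ> Suc"
  by (auto simp: bilateral_def embed_nat_def fun_eq_iff add.commute)

lemma shift_op_embed:
  assumes E: "closed_csubspace E" and A: "bounded_op E A" and B: "bounded_op E B" and F: "F \<in> hardy_space E"
  shows "shift_op bilateral A B (push embed_nat F) = push embed_nat (shift_op Suc A B F)"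
proof -
  note E' = closed_csubspaceD(1)[OF E]
  note push = adjoint_on_push[OF E inj_embed_nat]
  note bp = adjoint_on_bounded(1)[OF push]
  have amp_push: "amp T (push embed_nat F) = push embed_nat (amp T F)" if T: "bounded_op E T" for T
  proof (rule push_eqI[OF inj_embed_nat, symmetric])
    note pF = bounded_op_in[OF bp F]
    show "taylor_coeff (amp T (push embed_nat F)) (embed_nat n) = taylor_coeff (amp T F) n" for n
      by (simp add: taylor_coeff_amp(1)[OF E T pF] taylor_coeff_amp(1)[OF E T F]
          taylor_coeff_push_apply[OF inj_embed_nat])
    show "taylor_coeff (amp T (push embed_nat F)) n = 0" if "n \<notin> range embed_nat" for n
      using that by (simp add: taylor_coeff_amp(1)[OF E T pF] taylor_coeff_push(1)[OF inj_embed_nat]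
          bounded_op_0[OF T E'])
  qed
  have in_K: "amp T F \<in> hardy_space E" if "bounded_op E T" for T
    by (rule bounded_op_in[OF adjoint_on_bounded(1)[OF adjoint_on_amp[OF E adjoint_on_adj[OF E that]]] F])
  have "push bilateral (push embed_nat (amp B F)) = push embed_nat (push Suc (amp B F))"
    by (simp add: push_comp bij_is_inj[OF bij_bilateral] inj_embed_nat bilateral_embed_nat)
  then show ?thesis
    by (simp add: shift_op_def amp_push A B bounded_op_add[OF bp in_K[OF A] push_in[OF E inj_Suc in_K[OF B]]])
qed

text \<open>On the bilateral space the operators with symbols \<open>A\<^sub>0 + z A\<^sub>1\<close>, \<open>G\<^sub>1\<^sup>* + z G\<^sub>2\<close>, \<open>G\<^sub>2\<^sup>* + z G\<^sub>1\<close>, \<open>z\<close> satisfy the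
  equations of the distinguished boundary: compare the coefficients of \<open>1\<close>, \<open>z\<close>, \<open>z\<^sup>2\<close> in
  the commutators and those of \<open>z\<^sup>-\<^sup>1\<close>, \<open>1\<close>, \<open>z\<close> in the sum of squares.\<close>

lemma laurent_boundary_relations:
  fixes E :: "'a::chilbert_space set"
  assumes E: "closed_csubspace E"
    and g1: "adjoint_on E G1 G1'" and g2: "adjoint_on E G2 G2'"
    and a0: "adjoint_on E A0 A0'" and a1: "adjoint_on E A1 A1'"
    and c1: "\<And>x. x \<in> E \<Longrightarrow> G1 (G2 x) = G2 (G1 x)"
    and c2: "\<And>x. x \<in> E \<Longrightarrow> G1' (G1 x) - G1 (G1' x) = G2' (G2 x) - G2 (G2' x)"
    and c3: "\<And>x. x \<in> E \<Longrightarrow> G2' (A0 x) = A0 (G2' x)"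
    and c4: "\<And>x. x \<in> E \<Longrightarrow> G1 (A0 x) - A0 (G1 x) = A1 (G2' x) - G2' (A1 x)"
    and c5: "\<And>x. x \<in> E \<Longrightarrow> G1 (A1 x) = A1 (G1 x)"
    and c6: "\<And>x. x \<in> E \<Longrightarrow> G1' (A0 x) = A0 (G1' x)"
    and c7: "\<And>x. x \<in> E \<Longrightarrow> G2 (A0 x) - A0 (G2 x) = A1 (G1' x) - G1' (A1 x)"
    and c8: "\<And>x. x \<in> E \<Longrightarrow> G2 (A1 x) = A1 (G2 x)"
    and c9: "\<And>x. x \<in> E \<Longrightarrow> A0' (A0 x) + A1' (A1 x) = x - G1 (G1' x) - G2' (G2 x)"
    and c10: "\<And>x. x \<in> E \<Longrightarrow> A0' (A1 x) + G1 (G2 x) = 0"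
  shows "boundary_relations (hardy_space E) (shift_op bilateral A0 A1) (shift_op bilateral G1' G2)
    (shift_op bilateral G2' G1) (push bilateral) (shift_adj bilateral A0' A1') (shift_adj bilateral G1 G2')
    (shift_adj bilateral G2 G1') (pull bilateral)"
proof -
  note E' = closed_csubspaceD(1)[OF E]
  have inj: "inj bilateral" and surj: "surj bilateral" using bij_bilateral by (auto simp: bij_def)
  note b = adjoint_on_bounded[OF g1] adjoint_on_bounded[OF g2] adjoint_on_bounded[OF a0] adjoint_on_bounded[OF a1]
  note inE = b[THEN bounded_op_in] and add = b[THEN bounded_op_add]
  have ad: "adjoint_on (hardy_space E) (shift_op bilateral A0 A1) (shift_adj bilateral A0' A1')"
    "adjoint_on (hardy_space E) (shift_op bilateral G1' G2) (shift_adj bilateral G1 G2')"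
    "adjoint_on (hardy_space E) (shift_op bilateral G2' G1) (shift_adj bilateral G2 G1')"
    "adjoint_on (hardy_space E) (push bilateral) (pull bilateral)"
    by (rule adjoint_on_shift_op[OF E inj a0 a1], rule adjoint_on_shift_op[OF E inj adjoint_on_sym[OF g1] g2],
        rule adjoint_on_shift_op[OF E inj adjoint_on_sym[OF g2] g1], rule adjoint_on_push[OF E inj])
  have inK: "\<And>F. F \<in> hardy_space E \<Longrightarrow> shift_op bilateral A0 A1 F \<in> hardy_space E"
    "\<And>F. F \<in> hardy_space E \<Longrightarrow> shift_op bilateral G1' G2 F \<in> hardy_space E"
    "\<And>F. F \<in> hardy_space E \<Longrightarrow> shift_op bilateral G2' G1 F \<in> hardy_space E"
    "\<And>F. F \<in> hardy_space E \<Longrightarrow> push bilateral F \<in> hardy_space E"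
    using ad[THEN adjoint_on_bounded(1)] by (simp_all add: bounded_op_in)
  have cf: "\<And>F m. F \<in> hardy_space E \<Longrightarrow> taylor_coeff (shift_op bilateral A0 A1 F) (bilateral m) = A0 (taylor_coeff
      F (bilateral m)) + A1 (taylor_coeff F m)"
    "\<And>F m. F \<in> hardy_space E \<Longrightarrow> taylor_coeff (shift_op bilateral G1' G2 F) (bilateral m) = G1' (taylor_coeff F
        (bilateral m)) + G2 (taylor_coeff F m)"
    "\<And>F m. F \<in> hardy_space E \<Longrightarrow> taylor_coeff (shift_op bilateral G2' G1 F) (bilateral m) = G2' (taylor_coeff F
        (bilateral m)) + G1 (taylor_coeff F m)"
    "\<And>F m. taylor_coeff (push bilateral F) (bilateral m) = taylor_coeff F m"
    "\<And>F m. taylor_coeff (pull bilateral F) m = taylor_coeff F (bilateral m)"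
    by (simp_all add: taylor_coeff_shift_op[OF E inj] b taylor_coeff_push_apply[OF inj] taylor_coeff_pull(1)[OF inj])
  have cf': "\<And>F n. F \<in> hardy_space E \<Longrightarrow> taylor_coeff (shift_adj bilateral A0' A1' F) n = A0' (taylor_coeff F n) +
      A1' (taylor_coeff F (bilateral n))"
    "\<And>F n. F \<in> hardy_space E \<Longrightarrow> taylor_coeff (shift_adj bilateral G1 G2' F) n = G1 (taylor_coeff F n) + G2'
        (taylor_coeff F (bilateral n))"
    "\<And>F n. F \<in> hardy_space E \<Longrightarrow> taylor_coeff (shift_adj bilateral G2 G1' F) n = G2 (taylor_coeff F n) + G1'
        (taylor_coeff F (bilateral n))"
    by (simp_all add: taylor_coeff_shift_adj[OF E inj] b)
  have eqI: "F = G" if "\<And>m. taylor_coeff F (bilateral m) = taylor_coeff G (bilateral m)" for F G :: "'a hardy"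
  proof (rule hardy_eqI)
    fix n
    obtain m where "n = bilateral m" using surjD[OF surj] by blast
    then show "taylor_coeff F n = taylor_coeff G n" using that by simp
  qed
  have eqI2: "F = G" if "\<And>m. taylor_coeff F (bilateral (bilateral m)) = taylor_coeff G (bilateral (bilateral
      m))" for F G :: "'a hardy"
  proof (rule eqI)
    fix n
    obtain m where "n = bilateral m" using surjD[OF surj] by blast
    then show "taylor_coeff F (bilateral n) = taylor_coeff G (bilateral n)" using that by simp
  qed
  have c1': "G1' (G2' x) = G2' (G1' x)" if "x \<in> E" for x
    by (rule adjoint_on_commute[OF E' g1 g2 c1 that])
  have c10': "A1' (A0 x) + G2' (G1' x) = 0" if "x \<in> E" for x
  proof (rule csubspace_eq_0I[of _ E])
    show "A1' (A0 x) + G2' (G1' x) \<in> E" using that by (intro csubspace_add[OF E'] inE)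
    fix y assume y: "y \<in> E"
    have "cinner (A1' (A0 x) + G2' (G1' x)) y = cinner x (A0' (A1 y) + G1 (G2 y))"
      using that y by (simp add: cinner_simps inE adjoint_on_cinner[OF adjoint_on_sym[OF a1]] adjoint_on_cinner[OF a0]
          adjoint_on_cinner[OF adjoint_on_sym[OF g2]] adjoint_on_cinner[OF adjoint_on_sym[OF g1]])
    then show "cinner (A1' (A0 x) + G2' (G1' x)) y = 0" using c10[OF y] by simp
  qed
  note coeff = taylor_coeff_in[OF E]
  let ?T0 = "shift_op bilateral A0 A1" and ?T1 = "shift_op bilateral G1' G2" and ?T2 = "shift_op bilateral G2' G1"
  let ?T0' = "shift_adj bilateral A0' A1'" and ?T1' = "shift_adj bilateral G1 G2'"
  show ?thesis
  proof
    show "closed_csubspace (hardy_space E)" by (rule closed_csubspace_hardy_space[OF E])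
    fix F assume F: "F \<in> hardy_space E"
    note fE = coeff[OF F]
    have mid: "A0 (G2 b) + A1 (G1' b) = G1' (A1 b) + G2 (A0 b)" "A0 (G1 b) + A1 (G2' b) = G2' (A1 b) + G1 (A0 b)"
      "G1' (G1 b) + G2 (G2' b) = G2' (G2 b) + G1 (G1' b)" if "b \<in> E" for b
      using c7[OF that] c4[OF that] c2[OF that] by (simp_all add: algebra_simps)
    show "?T0 (?T1 F) = ?T1 (?T0 F)"
    proof (rule eqI2)
      show "taylor_coeff (?T0 (?T1 F)) (bilateral (bilateral m)) = taylor_coeff (?T1 (?T0 F)) (bilateral
          (bilateral m))" for m
        using F mid(1)[OF fE, of "bilateral m"] c6[OF fE] c8[OF fE] by (simp add: cf inK add inE fE algebra_simps)
    qed
    show "?T0 (?T2 F) = ?T2 (?T0 F)"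
    proof (rule eqI2)
      show "taylor_coeff (?T0 (?T2 F)) (bilateral (bilateral m)) = taylor_coeff (?T2 (?T0 F)) (bilateral
          (bilateral m))" for m
        using F mid(2)[OF fE, of "bilateral m"] c3[OF fE] c5[OF fE] by (simp add: cf inK add inE fE algebra_simps)
    qed
    show "?T1 (?T2 F) = ?T2 (?T1 F)"
    proof (rule eqI2)
      show "taylor_coeff (?T1 (?T2 F)) (bilateral (bilateral m)) = taylor_coeff (?T2 (?T1 F)) (bilateral
          (bilateral m))" for m
        using F mid(3)[OF fE, of "bilateral m"] c1[OF fE] c1'[OF fE] by (simp add: cf inK add inE fE algebra_simps)
    qed
    show "?T0 (push bilateral F) = push bilateral (?T0 F)" "?T1 (push bilateral F) = push bilateral (?T1 F)"
      "?T2 (push bilateral F) = push bilateral (?T2 F)"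
      by (rule eqI2, simp add: cf inK F)+
    show "pull bilateral (push bilateral F) = F" by (rule pull_push[OF inj])
    show "push bilateral (pull bilateral F) = F" by (rule push_pull[OF bij_bilateral])
    show "?T1 F = shift_adj bilateral G2 G1' (push bilateral F)"
      by (rule eqI) (simp add: cf cf' inK F add.commute)
    show "?T0' (?T0 F) + ?T1' (?T1 F) = F"
    proof (rule eqI)
      fix m
      let ?a = "taylor_coeff F (bilateral (bilateral m))" and ?b = "taylor_coeff F (bilateral m)"
          and ?c = "taylor_coeff F m"
      have "taylor_coeff (?T0' (?T0 F) + ?T1' (?T1 F)) (bilateral m) =
          (A0' (A0 ?b) + A1' (A1 ?b) + G1 (G1' ?b) + G2' (G2 ?b)) + (A0' (A1 ?c) + G1 (G2 ?c)) + (A1' (A0 ?a) +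
              G2' (G1' ?a))"
        using F by (simp add: taylor_coeff_add cf cf' inK add inE fE algebra_simps)
      also have "\<dots> = ?b" using c9[OF fE] c10[OF fE] c10'[OF fE] by simp
      finally show "taylor_coeff (?T0' (?T0 F) + ?T1' (?T1 F)) (bilateral m) = ?b" .
    qed
  qed (rule ad)+
qed

section \<open>Contractions of the hexablock\<close>

text \<open>Apply the contractivity inequality to the polynomial \<open>x\<^sub>3\<close>, which is bounded by one on the closed hexablock.\<close>

lemma hexablock_contraction_X3_norm_le:
  fixes X3 :: "'a::complex_inner \<Rightarrow> 'a"
  assumes "hexablock_contraction UNIV (A, X1, X2, X3)"
  shows "norm (X3 x) \<le> norm x"
proof -
  have b: "bounded_op UNIV X3" using assms by (simp add: hexablock_contraction_def)
  let ?F = "{(0, 0, 0, 1)} :: nat quad set"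
  have "op_norm UNIV (poly4_op ?F (\<lambda>_. 1) (A, X1, X2, X3)) \<le> (SUP q\<in>closure hexablock. cmod (poly4 ?F (\<lambda>_. 1) q))"
    using assms unfolding hexablock_contraction_def by blast
  moreover have "poly4_op ?F (\<lambda>_. 1) (A, X1, X2, X3) = X3" by (rule ext) simp
  moreover have "(SUP q\<in>closure hexablock. cmod (poly4 ?F (\<lambda>_. 1) q)) \<le> 1"
  proof (rule cSUP_least)
    have "(1, 0, 0, 1) \<in> hexa_boundary" by (simp add: hexa_boundary_def)
    then have "hexa_boundary \<noteq> {}" by auto
    then show "closure hexablock \<noteq> {}" using hexa_boundary_subset_closure by (metis subset_empty)
    fix q assume "q \<in> closure hexablock"
    then show "cmod (poly4 ?F (\<lambda>_. 1) q) \<le> 1" by (cases q) (auto dest: closure_hexablock_bounds(3))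
  qed
  ultimately have le: "op_norm UNIV X3 \<le> 1" by simp
  obtain B where B: "B > 0" "\<And>x. norm (X3 x) \<le> B * norm x" using bounded_op_bound[OF b] by auto
  have bdd: "bdd_above ((\<lambda>x. norm (X3 x)) ` {x\<in>UNIV. norm x \<le> 1})"
  proof (rule bdd_aboveI2)
    fix x :: 'a assume "x \<in> {x\<in>UNIV. norm x \<le> 1}"
    then have "B * norm x \<le> B * 1" using B(1) by (intro mult_left_mono) auto
    with B(2) show "norm (X3 x) \<le> B * 1" by (rule order_trans)
  qed
  show ?thesis
  proof (cases "x = 0")
    case True
    have "X3 0 = 0" by (rule bounded_op_0[OF b closed_csubspaceD(1)[OF closed_csubspace_UNIV]])
    then show ?thesis using True by simp
  next
    case False
    define y where "y = (1 / norm x) *\<^sub>R x"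
    have "norm y \<le> 1" using False by (simp add: y_def)
    then have "norm (X3 y) \<le> op_norm UNIV X3" unfolding op_norm_def by (intro cSUP_upper bdd) simp
    also have "X3 y = (1 / norm x) *\<^sub>R X3 x"
      unfolding y_def by (rule clinear_on_scaleR[OF bounded_op_clinear[OF b]]) simp
    finally have "norm ((1 / norm x) *\<^sub>R X3 x) \<le> 1" using le by (rule order_trans)
    then show ?thesis using False by (simp add: field_simps)
  qed
qed

text \<open>After multiplication by the defect operator, which is injective on the closure of its range, this
  becomes \<open>X - Z\<^sup>* Z X = (X - Y\<^sup>* Z) + (Y\<^sup>* Z - Z\<^sup>* X Z)\<close>.\<close>

lemma fundamental_intertwining:
  fixes X Y Z D :: "'a::chilbert_space \<Rightarrow> 'a"
  assumes X: "adjoint_on UNIV X X'" and Y: "adjoint_on UNIV Y Y'" and Z: "adjoint_on UNIV Z Z'"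
    and D: "adjoint_on UNIV D D" and sq: "\<And>x. D (D x) = x - Z' (Z x)"
    and E: "E = closure (range D)" and F: "bounded_op E F" and G: "adjoint_on E G G'"
    and f: "\<And>h. X h - Y' (Z h) = D (F (D h))" and g: "\<And>h. Y h - X' (Z h) = D (G (D h))"
    and ZX: "\<And>h. Z (X h) = X (Z h)"
  shows "D (X h) = F (D h) + G' (D (Z h))"
proof -
  have U: "csubspace (UNIV :: 'a set)" by (rule closed_csubspaceD) simp
  note bD = adjoint_on_bounded(1)[OF D]
  have E': "closed_csubspace E"
    unfolding E by (intro closed_csubspace_closure csubspace_image U bounded_op_clinear[OF bD])
  have DE: "D x \<in> E" for x unfolding E by (rule subsetD[OF closure_subset]) simp
  have inj: "x = 0" if x: "x \<in> E" "D x = 0" for x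
  proof -
    have "closed {y. cinner x y = 0}"
      unfolding closed_sequential_limits
      by (auto dest!: tendsto_cinner_right[of _ _ _ x] simp: LIMSEQ_const_iff)
    moreover have "range D \<subseteq> {y. cinner x y = 0}"
      using adjoint_on_cinner[OF D, of x] x(2) by (auto simp: cinner_zero_left)
    ultimately have "E \<subseteq> {y. cinner x y = 0}" unfolding E by (rule closure_minimal[rotated])
    then show ?thesis using x(1) cinner_self_eq_0 by blast
  qed
  have DG: "D (G' (D y)) = Y' y - Z' (X y)" for y
  proof (rule csubspace_eqI[OF U])
    fix z
    have "cinner (D (G' (D y))) z = cinner (D y) (G (D z))"
      using adjoint_on_cinner[OF D, of "G' (D y)" z] adjoint_on_cinner[OF adjoint_on_sym[OF G] DE DE] by simp
    also have "\<dots> = cinner y (Y z - X' (Z z))"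
      using adjoint_on_cinner[OF D, of y "G (D z)"] by (simp add: g)
    also have "\<dots> = cinner (Y' y - Z' (X y)) z"
      using adjoint_on_cinner[OF adjoint_on_sym[OF Y], of y z] adjoint_on_cinner[OF X, of y "Z z"]
        adjoint_on_cinner[OF adjoint_on_sym[OF Z], of "X y" z]
      by (simp add: cinner_simps)
    finally show "cinner (D (G' (D y))) z = cinner (Y' y - Z' (X y)) z" .
  qed simp_all
  let ?r = "F (D h) + G' (D (Z h))"
  have rE: "?r \<in> E"
    by (rule csubspace_add[OF closed_csubspaceD(1)[OF E'] bounded_op_in[OF F DE]
        bounded_op_in[OF adjoint_on_bounded(2)[OF G] DE]])
  have "D (D (X h) - ?r) = D (D (X h)) - (D (F (D h)) + D (G' (D (Z h))))"
    by (simp add: bounded_op_diff[OF bD U] bounded_op_add[OF bD])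
  also have "\<dots> = 0" by (simp add: sq DG f[symmetric] ZX)
  finally have "D (X h) - ?r = 0"
    by (rule inj[OF csubspace_diff[OF closed_csubspaceD(1)[OF E'] DE rE]])
  then show ?thesis by simp
qed

section \<open>The model of a pure hexablock contraction\<close>

theorem theorem5p5:
  fixes A X1 X2 X3 :: "'h::chilbert_space \<Rightarrow> 'h"
    and G1 G2 A0 A1 D :: "'h \<Rightarrow> 'h"
    and E :: "'h set"
    and K :: "'h hardy set"
    and V V1 V2 V3 N N1 N2 N3 :: "'h hardy \<Rightarrow> 'h hardy"
    and W :: "'h \<Rightarrow> 'h hardy"
  assumes contr: "hexablock_contraction UNIV (A, X1, X2, X3)"
    and strong: "\<And>h. (\<lambda>n. (X3 ^^ n) h) \<longlonglongrightarrow> 0"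
    and D: "D = defect_op X3"
    and E: "E = defect_space X3"
    and fundamental: "fundamental_operators X1 X2 X3 G1 G2"
    and A0: "bounded_op E A0"
    and A1: "bounded_op E A1"
    and c1: "\<forall>x\<in>E. comm G1 G2 x = 0"
    and c2: "\<forall>x\<in>E. comm (adj E G1) G1 x = comm (adj E G2) G2 x"
    and c3: "\<forall>x\<in>E. comm (adj E G2) A0 x = 0"
    and c4: "\<forall>x\<in>E. comm G1 A0 x = comm A1 (adj E G2) x"
    and c5: "\<forall>x\<in>E. comm G1 A1 x = 0"
    and c6: "\<forall>x\<in>E. comm (adj E G1) A0 x = 0"
    and c7: "\<forall>x\<in>E. comm G2 A0 x = comm A1 (adj E G1) x"
    and c8: "\<forall>x\<in>E. comm G2 A1 x = 0"
    and c9: "\<forall>x\<in>E. adj E A0 (A0 x) + adj E A1 (A1 x) = x - G1 (adj E G1 x) - adj E G2 (G2 x)"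
    and c10: "\<forall>x\<in>E. adj E A0 (A1 x) + G1 (G2 x) = 0"
    and c11: "\<forall>x\<in>E. adj UNIV A (D x) = D (A0 x) + adj UNIV X3 (D (A1 x))"
    and K: "K = hardy_space E"
    and V: "V = (\<lambda>F. tensor_op E id A0 F + tensor_op E mult_z A1 F)"
    and V1: "V1 = (\<lambda>F. tensor_op E id (adj E G1) F + tensor_op E mult_z G2 F)"
    and V2: "V2 = (\<lambda>F. tensor_op E id (adj E G2) F + tensor_op E mult_z G1 F)"
    and V3: "V3 = tensor_op E mult_z id"
    and N: "N = adj K V" and N1: "N1 = adj K V1" and N2: "N2 = adj K V2" and N3: "N3 = adj K V3"
    and W: "W = (\<lambda>h. \<Sum>n. hardy_monom n \<otimes> D ((X3 ^^ n) h))"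
  shows "hexablock_coisometry K (N, N1, N2, N3) \<and> pure_coisometry K N3 \<and>
    (\<forall>h. summable (\<lambda>n. hardy_monom n \<otimes> D ((X3 ^^ n) h))) \<and>
    isometric UNIV K W \<and>
    joint_invariant K (range W) [N, N1, N2, N3] \<and>
    (\<forall>h. N (W h) = W (A h)) \<and> (\<forall>h. N1 (W h) = W (X1 h)) \<and>
    (\<forall>h. N2 (W h) = W (X2 h)) \<and> (\<forall>h. N3 (W h) = W (X3 h))"
proof -
  note Kcontr = hexablock_contraction_X3_norm_le[OF contr]
  have U: "csubspace (UNIV :: 'h set)" by (rule closed_csubspaceD) simp
  have bX: "bounded_op UNIV A" "bounded_op UNIV X1" "bounded_op UNIV X2" "bounded_op UNIV X3"
    using contr by (simp_all add: hexablock_contraction_def)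
  have "commuting UNIV [A, X1, X2, X3]" using contr by (simp add: hexablock_contraction_def)
  then have "comm X3 A h = 0" "comm X3 X1 h = 0" "comm X3 X2 h = 0" for h by (simp_all add: commuting_def)
  then have X3_comm: "X3 (A h) = A (X3 h)" "X3 (X1 h) = X1 (X3 h)" "X3 (X2 h) = X2 (X3 h)" for h
    unfolding comm_def right_minus_eq by blast+
  have adX: "adjoint_on UNIV X (adj UNIV X)" if "bounded_op UNIV X" for X :: "'h \<Rightarrow> 'h"
    by (rule adjoint_on_adj[OF closed_csubspace_UNIV that])
  have adD: "adjoint_on UNIV D D"
    unfolding D by (rule positive_op_adjoint[OF U positive_defect_op[OF bX(4) Kcontr]])
  have DD: "D (D x) = x - adj UNIV X3 (X3 x)" for x
    unfolding D by (rule defect_op_square[OF bX(4) Kcontr])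
  have E_eq: "E = closure (range D)" by (simp add: E D defect_space_def)
  have clE: "closed_csubspace E"
    unfolding E_eq by (intro closed_csubspace_closure csubspace_image U bounded_op_clinear[OF
        adjoint_on_bounded(1)[OF adD]])
  have E': "csubspace E" by (rule closed_csubspaceD[OF clE])
  have DE: "D x \<in> E" for x unfolding E_eq by (rule subsetD[OF closure_subset]) simp
  have bG: "bounded_op E G1" "bounded_op E G2"
    using fundamental by (simp_all add: fundamental_operators_def E)
  note adG1 = adjoint_on_adj[OF clE bG(1)] and adG2 = adjoint_on_adj[OF clE bG(2)]
  note adA0 = adjoint_on_adj[OF clE A0] and adA1 = adjoint_on_adj[OF clE A1]
  note bE = adjoint_on_bounded[OF adG1] adjoint_on_bounded[OF adG2] adjoint_on_bounded[OF adA0]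
      adjoint_on_bounded[OF adA1]
  have clK: "closed_csubspace K" unfolding K by (rule closed_csubspace_hardy_space[OF clE])
  have K': "csubspace K" by (rule closed_csubspaceD[OF clK])

  \<comment> \<open>The model operators and their adjoints in terms of Taylor coefficients.\<close>
  have V_eq: "V F = shift_op Suc A0 A1 F" "V1 F = shift_op Suc (adj E G1) G2 F" "V2 F = shift_op Suc (adj E G2) G1 F"
    "V3 F = push Suc F" if F: "F \<in> K" for F
  proof -
    show "V F = shift_op Suc A0 A1 F" "V1 F = shift_op Suc (adj E G1) G2 F" "V2 F = shift_op Suc (adj E G2) G1 F"
      using F bE by (simp_all add: V V1 V2 K shift_op_def tensor_op_amp[OF clE])
    have "amp id F = F" by (simp add: amp_def)
    moreover have "bounded_op E id" using bounded_op_ident[of E] by (simp add: id_def)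
    ultimately show "V3 F = push Suc F" using F by (simp add: V3 K tensor_op_amp[OF clE])
  qed
  have adV: "adjoint_on K V (shift_adj Suc (adj E A0) (adj E A1))" "adjoint_on K V1 (shift_adj Suc G1 (adj E G2))"
    "adjoint_on K V2 (shift_adj Suc G2 (adj E G1))" "adjoint_on K V3 (pull Suc)"
    by (rule adjoint_on_cong[OF K' _ refl adjoint_on_shift_op[OF clE inj_Suc adA0 adA1, folded K]], simp add: V_eq,
        rule adjoint_on_cong[OF K' _ refl adjoint_on_shift_op[OF clE inj_Suc adjoint_on_sym[OF adG1] adG2,
            folded K]], simp add: V_eq,
        rule adjoint_on_cong[OF K' _ refl adjoint_on_shift_op[OF clE inj_Suc adjoint_on_sym[OF adG2] adG1,
            folded K]], simp add: V_eq,
        rule adjoint_on_cong[OF K' _ refl adjoint_on_push[OF clE inj_Suc, folded K]], simp add: V_eq)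
  note adN = adjoint_on_adj[OF clK adjoint_on_bounded(1)[OF adV(1)], folded N]
    adjoint_on_adj[OF clK adjoint_on_bounded(1)[OF adV(2)], folded N1]
    adjoint_on_adj[OF clK adjoint_on_bounded(1)[OF adV(3)], folded N2]
    adjoint_on_adj[OF clK adjoint_on_bounded(1)[OF adV(4)], folded N3]
  have bN: "bounded_op K N" "bounded_op K N1" "bounded_op K N2" "bounded_op K N3"
    using adN by (auto dest: adjoint_on_bounded)
  have NN: "adj K N F = V F" "adj K N1 F = V1 F" "adj K N2 F = V2 F" "adj K N3 F = V3 F" if "F \<in> K" for F
    using adN[THEN adjoint_on_sym, THEN adj_eq[OF K' _ that]] by simp_all
  have N_coeff: "taylor_coeff (N F) n = adj E A0 (taylor_coeff F n) + adj E A1 (taylor_coeff F (Suc n))"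
    "taylor_coeff (N1 F) n = G1 (taylor_coeff F n) + adj E G2 (taylor_coeff F (Suc n))"
    "taylor_coeff (N2 F) n = G2 (taylor_coeff F n) + adj E G1 (taylor_coeff F (Suc n))"
    "taylor_coeff (N3 F) n = taylor_coeff F (Suc n)" if F: "F \<in> K" for F n
    using F bE adj_eq[OF K' adV(1) F] adj_eq[OF K' adV(2) F] adj_eq[OF K' adV(3) F] adj_eq[OF K' adV(4) F]
    by (simp_all add: N N1 N2 N3 K taylor_coeff_shift_adj[OF clE inj_Suc] taylor_coeff_pull(1)[OF inj_Suc])

  have coiso: "hexablock_coisometry K (N, N1, N2, N3)"
  proof -
    interpret boundary_relations K "shift_op bilateral A0 A1" "shift_op bilateral (adj E G1) G2"
      "shift_op bilateral (adj E G2) G1" "push bilateral" "shift_adj bilateral (adj E A0) (adj E A1)"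
      "shift_adj bilateral G1 (adj E G2)" "shift_adj bilateral G2 (adj E G1)" "pull bilateral"
      unfolding K by (rule laurent_boundary_relations[OF clE adG1 adG2 adA0 adA1])
        (use c1 c2 c3 c4 c5 c6 c7 c8 c9 c10 in \<open>simp_all add: comm_def\<close>)
    have J: "isometric K K (push embed_nat)"
      using adjoint_on_bounded(1)[OF adjoint_on_push[OF clE inj_embed_nat], folded K]
      by (auto simp: isometric_def bounded_op_in bounded_op_clinear taylor_coeff_push(2)[OF inj_embed_nat])
    have "hexablock_isometry K (adj K N, adj K N1, adj K N2, adj K N3)"
    proof (rule hexablock_isometry_restrict[OF clK hexablock_isometry J])
      show "\<forall>U\<in>set (quad_list (adj K N, adj K N1, adj K N2, adj K N3)). bounded_op K U"
        using bN by (auto dest: adjoint_on_adj[OF clK] adjoint_on_bounded(2))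
      fix i :: nat and F assume i: "i < 4" and F: "F \<in> K"
      have "i = 0 \<or> i = 1 \<or> i = 2 \<or> i = 3" using i by linarith
      moreover have "push bilateral (push embed_nat F) = push embed_nat (push Suc F)"
        by (simp add: push_comp bij_is_inj[OF bij_bilateral] inj_embed_nat bilateral_embed_nat)
      ultimately show "(quad_list (shift_op bilateral A0 A1, shift_op bilateral (adj E G1) G2,
          shift_op bilateral (adj E G2) G1,
          push bilateral) ! i) (push embed_nat F) =
          push embed_nat ((quad_list (adj K N, adj K N1, adj K N2, adj K N3) ! i) F)"
        using F bE shift_op_embed[OF clE _ _ F[unfolded K]]
        by (elim disjE) (simp_all add: NN V_eq numeral_2_eq_2 numeral_3_eq_3)
    qed
    then show ?thesis using bN by simp
  qed

  have pure: "pure_coisometry K N3"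
    unfolding pure_coisometry_def pure_isometry_def
  proof (intro conjI allI impI bN)
    have bV: "bounded_op K (adj K N3)" by (rule adjoint_on_bounded(2)[OF adjoint_on_adj[OF clK bN(4)]])
    have "norm (adj K N3 F) = norm F" if "F \<in> K" for F
      using that by (simp add: NN V_eq taylor_coeff_push(2)[OF inj_Suc])
    then show "isometric K K (adj K N3)"
      using bounded_op_in[OF bV] bounded_op_clinear[OF bV] by (auto simp: isometric_def)
    fix M assume "joint_invariant K M [adj K N3, adj K (adj K N3)] \<and> adj K N3 ` M = M"
    then have MK: "M \<subseteq> K" and M0: "0 \<in> M" and eq: "adj K N3 ` M = M"
      by (auto simp: joint_invariant_def dest!: closed_csubspaceD(1) csubspace_0)
    \<comment> \<open>Each function in \<open>M\<close> is divisible by every power of \<open>z\<close> within \<open>M\<close>.\<close>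
    have preimage: "\<exists>G\<in>M. F = push Suc G" if "F \<in> M" for F
    proof -
      obtain G where G: "G \<in> M" "F = adj K N3 G" using \<open>F \<in> M\<close> eq by blast
      then show ?thesis using subsetD[OF MK G(1)] by (auto simp: NN V_eq)
    qed
    have "\<forall>F\<in>M. taylor_coeff F n = 0" for n
    proof (induction n)
      case 0
      show ?case
      proof
        fix F assume "F \<in> M"
        then obtain G where "G \<in> M" "F = push Suc G" using preimage by blast
        then show "taylor_coeff F 0 = 0" by (auto simp: taylor_coeff_push(1)[OF inj_Suc])
      qed
    next
      case (Suc n)
      show ?case
      proof
        fix F assume "F \<in> M"
        then obtain G where "G \<in> M" "F = push Suc G" using preimage by blast
        then show "taylor_coeff F (Suc n) = 0" using Suc by (simp add: taylor_coeff_push_apply[OF inj_Suc])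
      qed
    qed
    then show "M = {0}" using M0 by (auto intro!: hardy_eqI simp: taylor_coeff_zero)
  qed

  have bD: "bounded_op UNIV D" by (rule adjoint_on_bounded(1)[OF adD])
  have bX3n: "bounded_op UNIV (X3 ^^ n)" for n
    by (induction n) (use bounded_op_comp[OF bX(4)] bounded_op_ident[of UNIV] in \<open>auto simp: o_def id_def\<close>)
  \<comment> \<open>The squared norms of the coefficients of \<open>W h\<close> telescope.\<close>
  have normD: "(norm (D x))\<^sup>2 = (norm x)\<^sup>2 - (norm (X3 x))\<^sup>2" for x
  proof -
    have "cinner (D x) (D x) = cinner x x - cinner (X3 x) (X3 x)"
      using adjoint_on_cinner[OF adD, of x "D x"] adjoint_on_cinner[OF adX[OF bX(4)], of x "X3 x"]
      by (simp add: DD cinner_diff_right)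
    then show ?thesis by (simp add: cinner_self complex_eq_iff)
  qed
  have W_sums: "(\<lambda>n. (norm (D ((X3 ^^ n) h)))\<^sup>2) sums (norm h)\<^sup>2" for h
  proof -
    have "(\<lambda>n. (norm ((X3 ^^ n) h))\<^sup>2) \<longlonglongrightarrow> (norm (0::'h))\<^sup>2" by (intro tendsto_intros strong)
    then have "(\<lambda>n. (norm ((X3 ^^ n) h))\<^sup>2 - (norm ((X3 ^^ Suc n) h))\<^sup>2) sums ((norm ((X3 ^^ 0) h))\<^sup>2 - (norm (0::'h))\<^sup>2)"
      by (rule telescope_sums')
    then show ?thesis by (simp add: normD)
  qed
  define c where "c h = (\<lambda>n. D ((X3 ^^ n) h))" for h
  have ss: "square_summable (c h)" for h
    unfolding square_summable_def c_def by (rule sums_summable[OF W_sums])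
  have series: "(\<lambda>n. hardy_monom n \<otimes> D ((X3 ^^ n) h)) sums of_coeffs (c h)" for h
    using hardy_monom_series[of "of_coeffs (c h)"] unfolding taylor_coeff_of_coeffs[OF ss] by (simp add: c_def)
  then have W_eq: "W h = of_coeffs (c h)" for h by (simp add: W sums_iff)
  have W_coeff: "taylor_coeff (W h) n = D ((X3 ^^ n) h)" for h n
    unfolding W_eq taylor_coeff_of_coeffs[OF ss] by (simp add: c_def)
  have WK: "W h \<in> K" for h unfolding K by (rule hardy_spaceI[OF clE]) (simp add: W_coeff DE)
  have W_iso: "isometric UNIV K W"
    unfolding isometric_def clinear_on_def
  proof (intro conjI ballI allI)
    show "W ` UNIV \<subseteq> K" using WK by blast
    fix h
    have "(norm (W h))\<^sup>2 = (norm h)\<^sup>2"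
      using taylor_coeff_norm_sums[of "W h"] W_sums[of h] unfolding W_coeff by (rule sums_unique2)
    then show "norm (W h) = norm h" by simp
    show "W (z *\<^sub>C h) = z *\<^sub>C W h" for z
      by (rule hardy_eqI) (simp add: W_coeff taylor_coeff_scaleC bounded_op_scaleC[OF bX3n] bounded_op_scaleC[OF bD])
    show "W (h + k) = W h + W k" for k
      by (rule hardy_eqI) (simp add: W_coeff taylor_coeff_add bounded_op_add[OF bX3n] bounded_op_add[OF bD])
  qed

  have f1: "X1 h - adj UNIV X2 (X3 h) = D (G1 (D h))" and f2: "X2 h - adj UNIV X1 (X3 h) = D (G2 (D h))" for h
    using fundamental by (simp_all add: fundamental_operators_def D)
  have D_X1: "D (X1 h) = G1 (D h) + adj E G2 (D (X3 h))" for h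
    by (rule fundamental_intertwining[OF adX[OF bX(2)] adX[OF bX(3)] adX[OF bX(4)]
        adD DD E_eq bG(1) adG2 f1 f2 X3_comm(2)])
  have D_X2: "D (X2 h) = G2 (D h) + adj E G1 (D (X3 h))" for h
    by (rule fundamental_intertwining[OF adX[OF bX(3)] adX[OF bX(2)] adX[OF bX(4)]
        adD DD E_eq bG(2) adG1 f2 f1 X3_comm(3)])
  \<comment> \<open>The adjoint of \<open>c11\<close>.\<close>
  have D_A: "D (A h) = adj E A0 (D h) + adj E A1 (D (X3 h))" for h
  proof (rule csubspace_eqI[OF E' DE])
    show "adj E A0 (D h) + adj E A1 (D (X3 h)) \<in> E"
      by (intro csubspace_add[OF E'] bounded_op_in[OF bE(6)] bounded_op_in[OF bE(8)] DE)
    fix e assume e: "e \<in> E"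
    have "cinner (D (A h)) e = cinner h (adj UNIV A (D e))"
      using adjoint_on_cinner[OF adD, of "A h" e] adjoint_on_cinner[OF adX[OF bX(1)], of h "D e"] by simp
    also have "\<dots> = cinner (D h) (A0 e) + cinner (D (X3 h)) (A1 e)"
      using c11 e adjoint_on_cinner[OF adD, of h "A0 e"] adjoint_on_cinner[OF adX[OF bX(4)], of h "D (A1 e)"]
        adjoint_on_cinner[OF adD, of "X3 h" "A1 e"]
      by (simp add: cinner_add_right)
    also have "\<dots> = cinner (adj E A0 (D h) + adj E A1 (D (X3 h))) e"
      by (simp add: cinner_add_left adjoint_on_cinner[OF adjoint_on_sym[OF adA0] DE e]
          adjoint_on_cinner[OF adjoint_on_sym[OF adA1] DE e])
    finally show "cinner (D (A h)) e = cinner (adj E A0 (D h) + adj E A1 (D (X3 h))) e" .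
  qed
  have pow: "(X3 ^^ n) (X h) = X ((X3 ^^ n) h)" if "\<And>h. X3 (X h) = X (X3 h)" for X :: "'h \<Rightarrow> 'h" and n h
    by (induction n) (simp_all add: that)
  have inter: "N (W h) = W (A h)" "N1 (W h) = W (X1 h)" "N2 (W h) = W (X2 h)" "N3 (W h) = W (X3 h)" for h
    by (rule hardy_eqI, simp add: N_coeff WK W_coeff D_A D_X1 D_X2 pow[of A, OF X3_comm(1)] pow[of X1, OF X3_comm(2)]
        pow[of X2, OF X3_comm(3)] pow[of X3, OF refl])+
  have "closed_csubspace (range W)"
    by (rule closed_csubspace_isometric_image[OF closed_csubspace_UNIV W_iso])
  then have "joint_invariant K (range W) [N, N1, N2, N3]"
    using WK by (auto simp: joint_invariant_def inter)
  then show ?thesis by (intro conjI allI coiso pure W_iso inter sums_summable[OF series])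
qed

end
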